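(* Let $1\le k\le n$ be integers and let $\Lambda=(\lambda_{ij})$, $1\le i\le k$, $1\le j\le n$, be nonzero complex numbers with $\sum_j\lambda_{ij}=1$ for every $i$ and, if $k=n$, also $\sum_i\lambda_{ij}=1$ for every $j$. Put $\lambda_j=\sum_{i=1}^k\lambda_{ij}$, assume $\lambda_j\neq 0$ for all $j$, and let $\bar\Lambda=(\lambda_1,\dots,\lambda_n)$. Let $\Psi:\mathcal{M}_B\to\mathcal{M}_A$ be the morphism of moduli spaces induced by the algebra homomorphism $\psi:A_{n,\bar\Lambda}\to B_{\mathbf{\Lambda}}(\Gamma_{kn})$, $q_j\mapsto q_j$, $P\mapsto\sum_{i=1}^kp_i$. Then the pull-back along $\Psi$ to $\mathcal{M}_B$ of the symplectic form on $\mathcal{M}_A$ is zero (i.e. $\Psi^*\omega_A=0$ on $\Psi^{-1}(\mathcal{M}_A^{\circ})$, where $\mathcal{M}_A^{\circ}$ is the open part of $\mathcal{M}_A$ on which the symplectic form $\omega_A$ is defined).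
   Context: The base field is $\mathbb{C}$. A projector is an idempotent operator (not necessarily Hermitian). Algebra $B$: $\Gamma_{kn}$ is the full bipartite graph with $k$ vertices in one row and $n$ in the other, the edge $(ij)$ having weight $\lambda_{ij}$. $B_{\mathbf{\Lambda}}(\Gamma_{kn})$ is the unital $\mathbb{C}$-algebra with generators $p_1,\dots,p_k,q_1,\dots,q_n$ and relations $p_i^2=p_i$, $q_j^2=q_j$, $p_ip_{i'}=0$ for $i\ne i'$, $q_jq_{j'}=0$ for $j\ne j'$, $p_iq_jp_i=\lambda_{ij}p_i$, $q_jp_iq_j=\lambda_{ij}q_j$. $\mathcal{M}_B$ is the moduli space of representations of dimension $n$ and rank $1$, meaning that all $p_i,q_j$ act by projectors of rank $1$. Algebra $A$: $A_{n,\bar\Lambda}$, for $\bar\Lambda=(\lambda_1,\dots,\lambda_n)\in(\mathbb{C}^* )^n$, is the unital $\mathbb{C}$-algebra with generators $q_1,\dots,q_n,P$ and relations $q_j^2=q_j$, $P^2=P$, $q_iq_j=0$ for $i\neq j$, $q_jPq_j=\lambda_jq_j$. A representation is admissible if it has dimension $n$, each $q_j$ acts by a projector of rank $1$, and $P$ acts by a projector of rank $k$. $\mathcal{M}_A$ is the moduli space of admissible representations. Moduli spaces of representations are GIT quotients, by $\mathbf{GL}(V)$, of the affine variety of the representations in question in a vector space $V$ of dimension $n$ with given basis. The morphism $\Psi$ sends the class of a $B_{\mathbf{\Lambda}}(\Gamma_{kn})$-representation to the class of its restriction along $\psi$. Symplectic form on $\mathcal{M}_A$: let $\mathcal{O}_P\subset\mathfrak{gl}(n)\cong\mathfrak{gl}(n)^*$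 (identification by the trace pairing) be the coadjoint orbit of projectors of rank $k$, with its standard Kirillov–Kostant–Souriau symplectic form, and let $T=(\mathbb{C}^* )^n$ be the diagonal torus acting on $\mathcal{O}_P$ by conjugation. Choosing a basis of the representation space compatible with $q_1,\dots,q_n$ (unique up to $T$) identifies $\mathcal{M}_A$ with $\mu_A^{-1}(\bar\Lambda)/T$ (GIT quotient), where $\mu_A:\mathcal{O}_P\to\mathfrak{t}^*$ is the moment map sending a matrix to its diagonal. Thus $\mathcal{M}_A$ is a symplectic reduction of $\mathcal{O}_P$, and it carries the reduced symplectic form $\omega_A$, defined on the open subvariety $\mathcal{M}_A^{\circ}$ of smooth points represented by matrices in $\mu_A^{-1}(\bar\Lambda)$ with closed $T$-orbit and stabilizer in $T$ equal to the scalars. It is characterized by the property that its pull-back to the corresponding open subset of $\mu_A^{-1}(\bar\Lambda)$ is the restriction of the symplectic form of $\mathcal{O}_P$. *)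

theory Defs
  imports
    "HOL-Analysis.Analysis"
    "HOL-Algebra.QuotRing"
    "HOL-Algebra.Module"
    "HOL-Library.Poly_Mapping"
    "HOL-Library.Extended_Nat"
begin

section \<open>Unital complex algebras, presentations, representations\<close>

text \<open>
  A unital complex algebra, commutative or not, is carried by a \<^type>\<open>module\<close> record with
  scalars in \<^typ>\<open>complex\<close>.  Homomorphisms are unital and extensional functions, so that
  they are equal as soon as they agree on the carrier.
\<close>

definition alg_hom :: "(complex, 'a) module \<Rightarrow> (complex, 'b) module \<Rightarrow> ('a \<Rightarrow> 'b) set" where
  "alg_hom A B = {h \<in> carrier A \<rightarrow>\<^sub>E carrier B. h \<in> ring_hom A B \<and>
     (\<forall>c. \<forall>a \<in> carrier A. h (c \<odot>\<^bsub>A\<^esub> a) = c \<odot>\<^bsub>B\<^esub> h a)}"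

definition complex_alg :: "(complex, complex) module" where
  "complex_alg = \<lparr>carrier = UNIV, monoid.mult = (*), one = 1, ring.zero = 0, add = (+), smult = (*)\<rparr>"

definition mat_alg :: "(complex, complex^'n^'n) module" where
  "mat_alg = \<lparr>carrier = UNIV, monoid.mult = (**), one = mat 1, ring.zero = 0, add = (+),
     smult = (\<lambda>c M. \<chi> i j. c * M $ i $ j)\<rparr>"

text \<open>
  Words over the generators form the free monoid; the free algebra is its monoid algebra, i.e.
  finitely supported functions on words with the convolution product.
\<close>

instantiation list :: (type) monoid_add
begin
definition zero_list :: "'a list" where "zero_list = []"
definition plus_list :: "'a list \<Rightarrow> 'a list \<Rightarrow> 'a list" where "plus_list = (@)"
instance by standard (simp_all add: zero_list_def plus_list_def)
end

type_synonym 'g ncpoly = "'g list \<Rightarrow>\<^sub>0 complex"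

definition scal :: "complex \<Rightarrow> 'g ncpoly" where
  "scal c = Poly_Mapping.single [] c"

definition gen :: "'g \<Rightarrow> 'g ncpoly" where
  "gen g = Poly_Mapping.single [g] 1"

definition free_alg :: "(complex, 'g ncpoly) module" where
  "free_alg = \<lparr>carrier = UNIV, monoid.mult = (*), one = 1, ring.zero = 0, add = (+),
     smult = (\<lambda>c x. scal c * x)\<rparr>"

definition quot_alg :: "(complex, 'a) module \<Rightarrow> 'a set \<Rightarrow> (complex, 'a set) module" where
  "quot_alg A I = \<lparr>carrier = carrier (A Quot I), monoid.mult = monoid.mult (A Quot I),
     one = one (A Quot I), ring.zero = ring.zero (A Quot I), add = add (A Quot I),
     smult = (\<lambda>c X. \<Union>x\<in>X. I +>\<^bsub>A\<^esub> (c \<odot>\<^bsub>A\<^esub> x))\<rparr>"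

text \<open>
  The algebra with generators of type \<^typ>\<open>'g\<close> and relations \<open>r = 0\<close> for \<open>r \<in> R\<close>
  (\<^const>\<open>genideal\<close> generates two-sided ideals), and the class of a generator in it.
\<close>

definition presented :: "'g ncpoly set \<Rightarrow> (complex, 'g ncpoly set) module" where
  "presented R = quot_alg free_alg (genideal free_alg R)"

definition pgen :: "'g ncpoly set \<Rightarrow> 'g \<Rightarrow> 'g ncpoly set" where
  "pgen R g = genideal free_alg R +>\<^bsub>free_alg\<^esub> gen g"

definition presented_hom :: "'g ncpoly set \<Rightarrow> (complex, 'b) module \<Rightarrow> ('g \<Rightarrow> 'b) \<Rightarrow> ('g ncpoly set \<Rightarrow> 'b)" where
  "presented_hom R B v = (THE h. h \<in> alg_hom (presented R) B \<and> (\<forall>g. h (pgen R g) = v g))"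


section \<open>Affine varieties through their coordinate algebras\<close>

text \<open>
  \<open>fun_alg X F\<close> is the set \<open>F\<close> of complex functions on \<open>X\<close> with pointwise operations.
\<close>

definition fun_alg :: "'x set \<Rightarrow> ('x \<Rightarrow> complex) set \<Rightarrow> (complex, 'x \<Rightarrow> complex) module" where
  "fun_alg X F = \<lparr>carrier = F,
     monoid.mult = (\<lambda>f g. \<lambda>x\<in>X. f x * g x), one = (\<lambda>x\<in>X. 1),
     ring.zero = (\<lambda>x\<in>X. 0), add = (\<lambda>f g. \<lambda>x\<in>X. f x + g x),
     smult = (\<lambda>c f. \<lambda>x\<in>X. c * f x)\<rparr>"

text \<open>Polynomial functions on \<open>X\<close> in the coordinate functions \<open>S\<close>.\<close>

inductive_set polyfuns :: "'x set \<Rightarrow> ('x \<Rightarrow> complex) set \<Rightarrow> ('x \<Rightarrow> complex) set"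
  for X :: "'x set" and S :: "('x \<Rightarrow> complex) set" where
  const: "(\<lambda>x\<in>X. c) \<in> polyfuns X S"
| coord: "s \<in> S \<Longrightarrow> (\<lambda>x\<in>X. s x) \<in> polyfuns X S"
| add: "f \<in> polyfuns X S \<Longrightarrow> g \<in> polyfuns X S \<Longrightarrow> (\<lambda>x\<in>X. f x + g x) \<in> polyfuns X S"
| mult: "f \<in> polyfuns X S \<Longrightarrow> g \<in> polyfuns X S \<Longrightarrow> (\<lambda>x\<in>X. f x * g x) \<in> polyfuns X S"

text \<open>
  The GIT quotient of the affine variety \<open>X\<close> with regular functions \<open>F\<close> by a group \<open>G\<close> is
  the spectrum of the invariant regular functions; it is represented by its coordinate algebra.
\<close>

definition git_quotient ::
    "'x set \<Rightarrow> ('x \<Rightarrow> complex) set \<Rightarrow> 'g set \<Rightarrow> ('g \<Rightarrow> 'x \<Rightarrow> 'x) \<Rightarrow> (complex, 'x \<Rightarrow> complex) module" where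
  "git_quotient X F G act = fun_alg X {f \<in> F. \<forall>g\<in>G. \<forall>x\<in>X. f (act g x) = f x}"

text \<open>
  The (closed) points of the variety with coordinate algebra \<open>R\<close> are the characters of \<open>R\<close>, its
  Zariski tangent vectors at a point are the derivations there.  \<open>eval_at R x\<close> is the point
  represented by \<open>x\<close>, if \<open>R\<close> consists of functions.
\<close>

definition points :: "(complex, 'a) module \<Rightarrow> ('a \<Rightarrow> complex) set" where
  "points R = alg_hom R complex_alg"

definition eval_at :: "(complex, 'x \<Rightarrow> complex) module \<Rightarrow> 'x \<Rightarrow> (('x \<Rightarrow> complex) \<Rightarrow> complex)" where
  "eval_at R x = (\<lambda>f\<in>carrier R. f x)"

definition tangent :: "(complex, 'a) module \<Rightarrow> ('a \<Rightarrow> complex) \<Rightarrow> ('a \<Rightarrow> complex) set" where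
  "tangent R x = {D \<in> carrier R \<rightarrow>\<^sub>E UNIV.
     (\<forall>f\<in>carrier R. \<forall>g\<in>carrier R. D (f \<oplus>\<^bsub>R\<^esub> g) = D f + D g) \<and>
     (\<forall>c. \<forall>f\<in>carrier R. D (c \<odot>\<^bsub>R\<^esub> f) = c * D f) \<and>
     (\<forall>f\<in>carrier R. \<forall>g\<in>carrier R. D (f \<otimes>\<^bsub>R\<^esub> g) = x f * D g + x g * D f)}"

text \<open>
  A morphism is given by its comorphism \<open>\<phi>\<close>, defined on the coordinate algebra \<open>R\<close> of the
  target.  Both the image of a point and the differential on tangent vectors are given by
  composition with \<open>\<phi>\<close>.
\<close>

definition push :: "(complex, 'a) module \<Rightarrow> ('a \<Rightarrow> 'b) \<Rightarrow> ('b \<Rightarrow> complex) \<Rightarrow> ('a \<Rightarrow> complex)" where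
  "push R \<phi> x = compose (carrier R) x \<phi>"

text \<open>A 2-form \<open>\<omega>\<close> has the value \<open>\<omega> x u v\<close> at tangent vectors \<open>u\<close>, \<open>v\<close> at the point \<open>x\<close>.\<close>

type_synonym 'a two_form = "('a \<Rightarrow> complex) \<Rightarrow> ('a \<Rightarrow> complex) \<Rightarrow> ('a \<Rightarrow> complex) \<Rightarrow> complex"

definition pullback_form :: "(complex, 'a) module \<Rightarrow> ('a \<Rightarrow> 'b) \<Rightarrow> 'a two_form \<Rightarrow> 'b two_form" where
  "pullback_form R \<phi> \<omega> x u v = \<omega> (push R \<phi> x) (push R \<phi> u) (push R \<phi> v)"

definition height :: "(complex, 'a) module \<Rightarrow> 'a set \<Rightarrow> enat" where
  "height R m = Sup {enat d | d. \<exists>p :: nat \<Rightarrow> 'a set.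
     (\<forall>i\<le>d. primeideal (p i) R) \<and> (\<forall>i<d. p i \<subset> p (Suc i)) \<and> p d = m}"

text \<open>
  Regularity of the local ring: the tangent space has a finite basis \<open>B\<close> whose cardinality is
  the Krull dimension of the local ring, i.e. the height of its maximal ideal.
\<close>

definition smooth_point :: "(complex, 'a) module \<Rightarrow> ('a \<Rightarrow> complex) \<Rightarrow> bool" where
  "smooth_point R x \<longleftrightarrow> x \<in> points R \<and>
     (\<exists>B. finite B \<and> B \<subseteq> tangent R x \<and>
        (\<forall>D\<in>tangent R x. \<exists>!a. a \<in> B \<rightarrow>\<^sub>E UNIV \<and> D = (\<lambda>f\<in>carrier R. \<Sum>b\<in>B. a b * b f)) \<and>
        height R {f \<in> carrier R. x f = 0} = enat (card B))"


section \<open>Moduli of representations\<close>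

definition rep_funs :: "'g ncpoly set \<Rightarrow> ('g ncpoly set \<Rightarrow> complex^'n^'n) set \<Rightarrow>
    (('g ncpoly set \<Rightarrow> complex^'n^'n) \<Rightarrow> complex) set" where
  "rep_funs R X = polyfuns X {s. \<exists>g i j. s = (\<lambda>\<rho>. \<rho> (pgen R g) $ i $ j)}"

definition conj_rep :: "(complex, 'a) module \<Rightarrow> complex^'n^'n \<Rightarrow> ('a \<Rightarrow> complex^'n^'n) \<Rightarrow> ('a \<Rightarrow> complex^'n^'n)" where
  "conj_rep A h \<rho> = (\<lambda>a\<in>carrier A. h ** \<rho> a ** matrix_inv h)"

definition moduli :: "'g ncpoly set \<Rightarrow> ('g ncpoly set \<Rightarrow> complex^'n^'n) set \<Rightarrow>
    (complex, ('g ncpoly set \<Rightarrow> complex^'n^'n) \<Rightarrow> complex) module" where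
  "moduli R X = git_quotient X (rep_funs R X) {h. invertible h} (conj_rep (presented R))"

datatype 'n gen_A = Aq 'n | AP

definition rels_A :: "('n \<Rightarrow> complex) \<Rightarrow> 'n gen_A ncpoly set" where
  "rels_A l =
     {gen (Aq j) * gen (Aq j) - gen (Aq j) | j. True} \<union>
     {gen AP * gen AP - gen AP} \<union>
     {gen (Aq i) * gen (Aq j) | i j. i \<noteq> j} \<union>
     {gen (Aq j) * gen AP * gen (Aq j) - scal (l j) * gen (Aq j) | j. True}"

datatype ('k, 'n) gen_B = Bp 'k | Bq 'n

definition rels_B :: "('k \<Rightarrow> 'n \<Rightarrow> complex) \<Rightarrow> ('k, 'n) gen_B ncpoly set" where
  "rels_B lam =
     {gen (Bp i) * gen (Bp i) - gen (Bp i) | i. True} \<union>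
     {gen (Bq j) * gen (Bq j) - gen (Bq j) | j. True} \<union>
     {gen (Bp i) * gen (Bp i') | i i'. i \<noteq> i'} \<union>
     {gen (Bq j) * gen (Bq j') | j j'. j \<noteq> j'} \<union>
     {gen (Bp i) * gen (Bq j) * gen (Bp i) - scal (lam i j) * gen (Bp i) | i j. True} \<union>
     {gen (Bq j) * gen (Bp i) * gen (Bq j) - scal (lam i j) * gen (Bq j) | i j. True}"

definition alg_A :: "('n \<Rightarrow> complex) \<Rightarrow> (complex, 'n gen_A ncpoly set) module" where
  "alg_A l = presented (rels_A l)"

definition alg_B :: "('k \<Rightarrow> 'n \<Rightarrow> complex) \<Rightarrow> (complex, ('k, 'n) gen_B ncpoly set) module" where
  "alg_B lam = presented (rels_B lam)"

text \<open>
  The index type \<^typ>\<open>'n\<close> of the \<open>q\<^sub>j\<close> also indexes the basis of the representation space,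
  which therefore has dimension \<open>CARD('n)\<close>.
\<close>

definition reps_A :: "nat \<Rightarrow> ('n::finite \<Rightarrow> complex) \<Rightarrow> ('n gen_A ncpoly set \<Rightarrow> complex^'n^'n) set" where
  "reps_A k l = {\<rho> \<in> alg_hom (alg_A l) mat_alg.
     (\<forall>j. rank (\<rho> (pgen (rels_A l) (Aq j))) = 1) \<and> rank (\<rho> (pgen (rels_A l) AP)) = k}"

definition reps_B :: "('k \<Rightarrow> 'n::finite \<Rightarrow> complex) \<Rightarrow> (('k, 'n) gen_B ncpoly set \<Rightarrow> complex^'n^'n) set" where
  "reps_B lam = {\<rho> \<in> alg_hom (alg_B lam) mat_alg. \<forall>g. rank (\<rho> (pgen (rels_B lam) g)) = 1}"

definition moduli_A :: "nat \<Rightarrow> ('n::finite \<Rightarrow> complex) \<Rightarrow>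
    (complex, ('n gen_A ncpoly set \<Rightarrow> complex^'n^'n) \<Rightarrow> complex) module" where
  "moduli_A k l = moduli (rels_A l) (reps_A k l)"

definition moduli_B :: "('k \<Rightarrow> 'n::finite \<Rightarrow> complex) \<Rightarrow>
    (complex, (('k, 'n) gen_B ncpoly set \<Rightarrow> complex^'n^'n) \<Rightarrow> complex) module" where
  "moduli_B lam = moduli (rels_B lam) (reps_B lam)"

definition psi :: "('k::finite \<Rightarrow> 'n \<Rightarrow> complex) \<Rightarrow> ('n \<Rightarrow> complex) \<Rightarrow>
    'n gen_A ncpoly set \<Rightarrow> ('k, 'n) gen_B ncpoly set" where
  "psi lam l = presented_hom (rels_A l) (alg_B lam)
     (\<lambda>g. case g of Aq j \<Rightarrow> pgen (rels_B lam) (Bq j)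
                  | AP \<Rightarrow> (\<Oplus>\<^bsub>alg_B lam\<^esub>i\<in>UNIV. pgen (rels_B lam) (Bp i)))"

text \<open>
  Comorphism of the morphism \<open>\<Psi>\<close> induced by restriction of representations along
  \<^const>\<open>psi\<close>; the \<open>p\<^sub>i\<close> are indexed by \<^typ>\<open>'k\<close>, so the target has \<open>k = CARD('k)\<close>.
\<close>

definition Psi_comorphism :: "('k::finite \<Rightarrow> 'n::finite \<Rightarrow> complex) \<Rightarrow> ('n \<Rightarrow> complex) \<Rightarrow>
    (('n gen_A ncpoly set \<Rightarrow> complex^'n^'n) \<Rightarrow> complex) \<Rightarrow>
    ((('k, 'n) gen_B ncpoly set \<Rightarrow> complex^'n^'n) \<Rightarrow> complex)" where
  "Psi_comorphism lam l =
     (\<lambda>f\<in>carrier (moduli_A CARD('k) l). \<lambda>\<rho>\<in>reps_B lam. f (compose (carrier (alg_A l)) \<rho> (psi lam l)))"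


section \<open>The symplectic form on the moduli space of admissible representations\<close>

definition projector_orbit :: "nat \<Rightarrow> (complex^'n^'n) set" where
  "projector_orbit k = {M. M ** M = M \<and> rank M = k}"

text \<open>
  Under the trace pairing the tangent vector of the coadjoint orbit at \<open>P\<close> induced by \<open>X\<close> is
  the commutator \<open>[X, P]\<close>, and \<open>\<omega>([X, P], [Y, P]) = tr (P [X, Y])\<close>.
\<close>

definition kks :: "complex^'n^'n \<Rightarrow> complex^'n^'n \<Rightarrow> complex^'n^'n \<Rightarrow> complex" where
  "kks P U V = (THE c. \<exists>X Y. U = X ** P - P ** X \<and> V = Y ** P - P ** Y \<and>
     c = trace (P ** (X ** Y - Y ** X)))"

definition moment_map :: "complex^'n^'n \<Rightarrow> 'n \<Rightarrow> complex" where
  "moment_map M = (\<lambda>i. M $ i $ i)"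

definition level_set :: "nat \<Rightarrow> ('n \<Rightarrow> complex) \<Rightarrow> (complex^'n^'n) set" where
  "level_set k l = {M \<in> projector_orbit k. moment_map M = l}"

definition level_alg :: "nat \<Rightarrow> ('n \<Rightarrow> complex) \<Rightarrow> (complex, complex^'n^'n \<Rightarrow> complex) module" where
  "level_alg k l = fun_alg (level_set k l)
     (polyfuns (level_set k l) {s. \<exists>i j. s = (\<lambda>M. M $ i $ j)})"

text \<open>The matrix corresponding to an abstract tangent vector of the level set.\<close>

definition tangent_matrix :: "nat \<Rightarrow> ('n \<Rightarrow> complex) \<Rightarrow>
    ((complex^'n^'n \<Rightarrow> complex) \<Rightarrow> complex) \<Rightarrow> complex^'n^'n" where
  "tangent_matrix k l D = (\<chi> i j. D (\<lambda>M\<in>level_set k l. M $ i $ j))"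

definition torus :: "(complex^'n^'n) set" where
  "torus = {t. invertible t \<and> (\<forall>i j. i \<noteq> j \<longrightarrow> t $ i $ j = 0)}"

definition torus_act :: "complex^'n^'n \<Rightarrow> complex^'n^'n \<Rightarrow> complex^'n^'n" where
  "torus_act t M = t ** M ** matrix_inv t"

text \<open>Matrices of the level set with (Zariski) closed torus orbit and stabilizer the scalars.\<close>

definition stable_set :: "nat \<Rightarrow> ('n \<Rightarrow> complex) \<Rightarrow> (complex^'n^'n) set" where
  "stable_set k l = {M \<in> level_set k l.
     (\<exists>F \<subseteq> carrier (level_alg k l).
        {torus_act t M | t. t \<in> torus} = {N \<in> level_set k l. \<forall>f\<in>F. f N = 0}) \<and>
     {t \<in> torus. torus_act t M = M} = {mat c | c. c \<noteq> 0}}"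

text \<open>
  The representation with \<open>q\<^sub>j\<close> the \<open>j\<close>-th diagonal matrix unit and \<open>P\<close> the given matrix, and
  the comorphism of the resulting morphism from the level set to the moduli space, which is the
  quotient map by the torus under the identification of its target with the torus quotient.
\<close>

definition level_rep :: "('n::finite \<Rightarrow> complex) \<Rightarrow> complex^'n^'n \<Rightarrow> ('n gen_A ncpoly set \<Rightarrow> complex^'n^'n)" where
  "level_rep l M = presented_hom (rels_A l) mat_alg
     (\<lambda>g. case g of Aq j \<Rightarrow> (\<chi> a b. if a = j \<and> b = j then 1 else 0) | AP \<Rightarrow> M)"

definition level_comorphism :: "nat \<Rightarrow> ('n::finite \<Rightarrow> complex) \<Rightarrow>
    (('n gen_A ncpoly set \<Rightarrow> complex^'n^'n) \<Rightarrow> complex) \<Rightarrow> (complex^'n^'n \<Rightarrow> complex)" where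
  "level_comorphism k l = (\<lambda>f\<in>carrier (moduli_A k l). \<lambda>M\<in>level_set k l. f (level_rep l M))"

definition moduli_A_open :: "nat \<Rightarrow> ('n::finite \<Rightarrow> complex) \<Rightarrow>
    ((('n gen_A ncpoly set \<Rightarrow> complex^'n^'n) \<Rightarrow> complex) \<Rightarrow> complex) set" where
  "moduli_A_open k l = {y \<in> points (moduli_A k l). smooth_point (moduli_A k l) y \<and>
     (\<exists>M\<in>stable_set k l. y = eval_at (moduli_A k l) (level_rep l M))}"

text \<open>
  The reduced form: its value at \<open>u\<close>, \<open>v\<close> is the common value of the form of the orbit on all
  lifts of \<open>u\<close>, \<open>v\<close> to tangent vectors of the level set at stable matrices over \<open>y\<close>.
\<close>

definition omega_A :: "nat \<Rightarrow> ('n::finite \<Rightarrow> complex) \<Rightarrow>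
    (('n gen_A ncpoly set \<Rightarrow> complex^'n^'n) \<Rightarrow> complex) two_form" where
  "omega_A k l y u v = (THE c. \<forall>M\<in>stable_set k l. y = eval_at (moduli_A k l) (level_rep l M) \<longrightarrow>
     (\<forall>a\<in>tangent (level_alg k l) (eval_at (level_alg k l) M).
      \<forall>b\<in>tangent (level_alg k l) (eval_at (level_alg k l) M).
        push (moduli_A k l) (level_comorphism k l) a = u \<and>
        push (moduli_A k l) (level_comorphism k l) b = v \<longrightarrow>
        c = kks M (tangent_matrix k l a) (tangent_matrix k l b)))"

end

theory Submission
  imports Defs
begin

text \<open>
  A matrix \<open>M\<close> with closed torus orbit and scalar stabilizer is irreducible, so there are words in
  the \<open>q\<^sub>j\<close> and \<open>P\<close> whose entries in one fixed row and one fixed column do not vanish at \<open>M\<close>.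
  Conjugation by the diagonal matrix of the row entries fixes the torus gauge, and the entries of
  the gauge-fixed matrix are ratios of traces of words, hence of invariant functions. A point and a
  tangent vector of the moduli space of \<open>B\<close> therefore yield actual matrices \<open>Q\<^sub>i\<close> and \<open>U\<^sub>i\<close>
  that satisfy the relations of the \<open>p\<^sub>i\<close> and their linearization, without any appeal to the
  surjectivity of the GIT quotient map or to a lift of the tangent vector.

  Since \<open>p\<^sub>i q\<^sub>j p\<^sub>i = \<lambda>\<^sub>i\<^sub>j p\<^sub>i\<close> with \<open>\<lambda>\<^sub>i\<^sub>j \<noteq> 0\<close>, the quotients of the entries of \<open>U\<^sub>i\<close> by those of
  \<open>Q\<^sub>i\<close> form an additive cocycle, so \<open>U\<^sub>i = [C\<^sub>i, Q\<^sub>i]\<close> with \<open>C\<^sub>i\<close> diagonal. The idempotents also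
  deform by a common commutator: \<open>U\<^sub>i = [X, Q\<^sub>i]\<close>, and \<open>V\<^sub>i = [Y, Q\<^sub>i]\<close> for a second tangent vector.
  Up to sign the symplectic form is the sum over \<open>i\<close> of \<open>tr (U\<^sub>i Y) = tr ([C\<^sub>i, Q\<^sub>i] Y) = - tr (C\<^sub>i V\<^sub>i)\<close>,
  which vanishes because \<open>V\<^sub>i\<close> has zero diagonal.

  The value of the reduced form is a definite description over all lifts to the level set, so a lift
  must also be shown to exist; the gauge-fixed matrix is a local section which provides one.
\<close>

section \<open>Matrices, idempotents and their deformations\<close>

lemma mat_add_rdistrib: "((A::'a::semiring_1^'n^'m) + B) ** C = A ** C + B ** C"
  by (vector matrix_matrix_mult_def sum.distrib[symmetric] field_simps)

lemma mat_diff_ldistrib: "(A::'a::ring_1^'n^'m) ** (B - C) = A ** B - A ** C"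
  by (vector matrix_matrix_mult_def sum_subtractf[symmetric] field_simps)

lemma mat_diff_rdistrib: "((A::'a::ring_1^'n^'m) - B) ** C = A ** C - B ** C"
  by (vector matrix_matrix_mult_def sum_subtractf[symmetric] field_simps)

lemma mat_zero_left: "(0::'a::semiring_1^'n^'m) ** A = 0"
  by (vector matrix_matrix_mult_def)

lemma mat_zero_right: "(A::'a::semiring_1^'n^'m) ** 0 = 0"
  by (vector matrix_matrix_mult_def)

lemma mat_sum_left: "(\<Sum>s\<in>S. f s) ** (A::'a::semiring_1^'n^'m) = (\<Sum>s\<in>S. f s ** A)"
  by (induction S rule: infinite_finite_induct) (auto simp: mat_zero_left mat_add_rdistrib)

lemma mat_sum_right: "(A::'a::semiring_1^'n^'m) ** (\<Sum>s\<in>S. f s) = (\<Sum>s\<in>S. A ** f s)"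
  by (induction S rule: infinite_finite_induct) (auto simp: mat_zero_right matrix_add_ldistrib)

lemma trace_sum: "trace (\<Sum>s\<in>S. f s) = (\<Sum>s\<in>S. trace (f s :: complex^'n^'n))"
  by (induction S rule: infinite_finite_induct) (simp_all add: trace_add trace_0[simplified])

text \<open>Invariance of the trace pairing under the adjoint action: by cyclicity a commutator
  moves from one factor to the other. The trace computations for the orbit form rest on this
  identity.\<close>

lemma trace_commutator_left:
  "trace (A ** (B ** C - C ** B)) = trace ((A ** B - B ** A) ** (C::complex^'n^'n))"
proof -
  have "trace (A ** C ** B) = trace (B ** A ** C)"
    by (metis matrix_mul_assoc trace_mul_sym)
  then show ?thesis
    by (simp add: mat_diff_ldistrib mat_diff_rdistrib trace_sub matrix_mul_assoc)
qed

lemma matrix_inv_mult: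
  assumes "invertible (g::complex^'n^'n)"
  shows "g ** matrix_inv g = mat 1" "matrix_inv g ** g = mat 1"
  using someI_ex[OF assms[unfolded invertible_def]] by (auto simp: matrix_inv_def)

lemma matrix_inv_eqI:
  assumes "(g::complex^'n^'n) ** h = mat 1"
  shows "matrix_inv g = h"
proof -
  have "invertible g" using assms invertible_right_inverse by blast
  then show ?thesis
    by (metis assms matrix_inv_mult(2) matrix_mul_assoc matrix_mul_lid matrix_mul_rid)
qed

lemma matrix_inv_prod:
  assumes "invertible (g::complex^'n^'n)" "invertible (h::complex^'n^'n)"
  shows "matrix_inv (g ** h) = matrix_inv h ** matrix_inv g"
proof (rule matrix_inv_eqI)
  have "g ** h ** (matrix_inv h ** matrix_inv g) = g ** (h ** matrix_inv h) ** matrix_inv g"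
    by (simp add: matrix_mul_assoc)
  then show "g ** h ** (matrix_inv h ** matrix_inv g) = mat 1"
    using assms by (simp add: matrix_inv_mult)
qed

lemma conj_mult:
  assumes "invertible (g::complex^'n^'n)"
  shows "(g ** A ** matrix_inv g) ** (g ** B ** matrix_inv g) = g ** (A ** B) ** matrix_inv g"
proof -
  have "(g ** A ** matrix_inv g) ** (g ** B ** matrix_inv g)
      = g ** A ** (matrix_inv g ** g) ** B ** matrix_inv g"
    by (simp add: matrix_mul_assoc)
  then show ?thesis using assms by (simp add: matrix_inv_mult matrix_mul_assoc)
qed

lemma trace_conj:
  assumes "invertible (g::complex^'n^'n)"
  shows "trace (g ** A ** matrix_inv g) = trace A"
proof -
  have "trace (g ** A ** matrix_inv g) = trace (matrix_inv g ** g ** A)"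
    by (metis matrix_mul_assoc trace_mul_sym)
  then show ?thesis using assms by (simp add: matrix_inv_mult)
qed

section \<open>Diagonal matrices and matrix units\<close>

definition dmat :: "('n \<Rightarrow> complex) \<Rightarrow> complex^'n^'n" where
  "dmat c = (\<chi> i j. if i = j then c i else 0)"

definition munit :: "'n \<Rightarrow> complex^'n^'n" where
  "munit j = (\<chi> a b. if a = j \<and> b = j then 1 else 0)"

lemma dmat_mult_nth: "(dmat c ** A) $ i $ j = c i * A $ i $ j"
  by (simp add: dmat_def matrix_matrix_mult_def if_distrib[of "\<lambda>x. x * _"] sum.delta cong: if_cong)

lemma mult_dmat_nth: "(A ** dmat c) $ i $ j = A $ i $ j * c j"
  by (simp add: dmat_def matrix_matrix_mult_def if_distrib[of "\<lambda>x. _ * x"] sum.delta' cong: if_cong)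

lemma matrix_inv_dmat:
  assumes "\<And>i. c i \<noteq> 0"
  shows "matrix_inv (dmat c) = dmat (\<lambda>i. inverse (c i))" "invertible (dmat c)"
proof -
  have "dmat c ** dmat (\<lambda>i. inverse (c i)) = mat 1"
    by (simp add: vec_eq_iff mult_dmat_nth) (simp add: dmat_def mat_def assms)
  then show "matrix_inv (dmat c) = dmat (\<lambda>i. inverse (c i))" "invertible (dmat c)"
    using matrix_inv_eqI invertible_right_inverse by blast+
qed

lemma dmat_conj_nth:
  assumes "\<And>i. c i \<noteq> 0"
  shows "(dmat c ** A ** matrix_inv (dmat c)) $ i $ j = c i * A $ i $ j / c j"
  by (simp add: matrix_inv_dmat[OF assms] dmat_mult_nth mult_dmat_nth field_simps)

lemma munit_mult_nth: "(munit k ** A) $ i $ j = (if i = k then A $ i $ j else 0)"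
proof -
  have "munit k = dmat (\<lambda>i. if i = k then 1 else 0)"
    by (auto simp: munit_def dmat_def vec_eq_iff)
  then show ?thesis by (simp add: dmat_mult_nth)
qed

lemma mult_munit_nth: "(A ** munit k) $ i $ j = (if j = k then A $ i $ j else 0)"
proof -
  have "munit k = dmat (\<lambda>i. if i = k then 1 else 0)"
    by (auto simp: munit_def dmat_def vec_eq_iff)
  then show ?thesis by (simp add: mult_dmat_nth)
qed

lemma munit_mult_munit: "munit i ** munit j = (if i = j then munit j else 0)"
  by (auto simp: vec_eq_iff munit_mult_nth) (auto simp: munit_def)

lemma trace_munit: "trace (munit j) = 1"
  by (simp add: trace_def munit_def)

text \<open>An idempotent fixes every vector of its row space. When the rows are expanded in a basis
  \<open>B\<close> of that space, each basis vector contributes exactly 1 to the trace, so the trace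
  counts \<open>B\<close>. Ranks of idempotents thereby become additive, conjugation invariant and
  accessible to continuity arguments.\<close>

lemma rank_idempotent:
  assumes P: "(P::complex^'n^'n) ** P = P"
  shows "of_nat (rank P) = trace P"
proof -
  obtain B where B: "B \<subseteq> rows P" "vec.independent B" "rows P \<subseteq> vec.span B" "card B = vec.dim (rows P)"
    using vec.basis_exists by blast
  have fin: "finite B" using B(2) vec.independent_bound_general[of B] vec.finiteI_independent by blast
  have row: "row i P \<in> vec.span B" for i using B(3) by (auto simp: rows_def)
  define c where "c i = vec.representation B (row i P)" for i
  have rowsum: "row i P = (\<Sum>s\<in>B. c i s *s s)" for i
    unfolding c_def using vec.sum_representation_eq[OF B(2) row fin subset_refl] by simp
  have fix_rows: "s = (\<Sum>i\<in>UNIV. s $ i *s row i P)" if "s \<in> B" for s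
  proof -
    obtain k where k: "s = row k P" using \<open>s \<in> B\<close> B(1) by (auto simp: rows_def)
    show ?thesis
      using arg_cong[OF P, of "\<lambda>M. row k M"] unfolding k
      by (simp add: vec_eq_iff row_def matrix_matrix_mult_def)
  qed
  have delta: "(\<Sum>i\<in>UNIV. s $ i * c i s) = 1" if "s \<in> B" for s
  proof -
    have "1 = vec.representation B s s"
      using vec.representation_basis[OF B(2) that] by simp
    also have "\<dots> = vec.representation B (\<Sum>i\<in>UNIV. s $ i *s row i P) s"
      using fix_rows[OF that] by simp
    also have "\<dots> = (\<Sum>i\<in>UNIV. s $ i * c i s)"
      by (simp add: vec.representation_sum[OF B(2)] vec.representation_scale[OF B(2)] vec.span_scale row c_def)
    finally show ?thesis by simp
  qed
  have "trace P = (\<Sum>i\<in>UNIV. row i P $ i)" by (simp add: trace_def row_def)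
  also have "\<dots> = (\<Sum>i\<in>UNIV. \<Sum>s\<in>B. c i s * s $ i)"
    by (subst rowsum) simp
  also have "\<dots> = (\<Sum>s\<in>B. \<Sum>i\<in>UNIV. s $ i * c i s)"
    by (subst sum.swap) (simp add: mult.commute)
  also have "\<dots> = of_nat (card B)" by (simp add: delta)
  finally show ?thesis by (simp add: row_rank_def_gen B(4))
qed

lemma rank_conj:
  assumes "(P::complex^'n^'n) ** P = P" "invertible (g::complex^'n^'n)"
  shows "rank (g ** P ** matrix_inv g) = rank P"
proof -
  have "of_nat (rank (g ** P ** matrix_inv g)) = (of_nat (rank P) :: complex)"
    by (subst (1 2) rank_idempotent) (simp_all only: assms conj_mult trace_conj)
  then show ?thesis by simp
qed

lemma rank_munit: "rank (munit j) = 1"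
proof -
  have "of_nat (rank (munit j)) = (1::complex)"
    by (simp add: rank_idempotent munit_mult_munit trace_munit)
  then show ?thesis by simp
qed

text \<open>Ranks of mutually orthogonal idempotents add up because traces do.\<close>

lemma rank_sum_idempotents:
  fixes p :: "'k::finite \<Rightarrow> complex^'n^'n"
  assumes p: "\<And>s t. p s ** p t = (if s = t then p s else 0)" and "\<And>s. rank (p s) = 1"
  shows "(\<Sum>s\<in>UNIV. p s) ** (\<Sum>s\<in>UNIV. p s) = (\<Sum>s\<in>UNIV. p s)"
    and "rank (\<Sum>s\<in>UNIV. p s) = CARD('k)"
proof -
  show idem: "(\<Sum>s\<in>UNIV. p s) ** (\<Sum>s\<in>UNIV. p s) = (\<Sum>s\<in>UNIV. p s)"
    by (simp add: mat_sum_left mat_sum_right p)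
  have "of_nat (rank (\<Sum>s\<in>UNIV. p s)) = (\<Sum>s\<in>UNIV. trace (p s))"
    by (simp add: rank_idempotent idem trace_sum)
  also have "\<dots> = (\<Sum>s\<in>(UNIV::'k set). 1)"
  proof (rule sum.cong)
    fix s
    show "trace (p s) = 1" using rank_idempotent[of "p s"] assms by simp
  qed simp
  finally have "of_nat (rank (\<Sum>s\<in>UNIV. p s)) = (of_nat CARD('k) :: complex)" by simp
  then show "rank (\<Sum>s\<in>UNIV. p s) = CARD('k)" by (simp only: of_nat_eq_iff)
qed

text \<open>A nonzero vector in the image of each \<open>q j\<close> gives as many vectors as the
  dimension; orthogonality of the idempotents makes them independent, hence a basis. The matrix
  \<open>S\<close> with these columns intertwines \<open>q j\<close> with \<open>munit j\<close>,
  and its inverse is the required conjugator.\<close>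

lemma idempotents_diagonalizable:
  fixes q :: "'n::finite \<Rightarrow> complex^'n^'n"
  assumes q: "\<And>i j. q i ** q j = (if i = j then q j else 0)" and nz: "\<And>j. q j \<noteq> 0"
  obtains g where "invertible g" "\<And>j. g ** q j ** matrix_inv g = munit j"
proof -
  have "\<exists>v. q j *v v = v \<and> v \<noteq> 0" for j
  proof -
    obtain x where x: "q j *v x \<noteq> 0"
      using nz[of j] by (metis matrix_eq matrix_vector_mult_0)
    have "q j *v (q j *v x) = q j *v x" by (simp add: matrix_vector_mul_assoc q)
    then show ?thesis using x by blast
  qed
  then obtain v where v: "\<And>j. q j *v v j = v j" "\<And>j. v j \<noteq> 0" by metis
  define S where "S = (\<chi> a j. v j $ a)"
  have qv: "q i *v v j = (if i = j then v j else 0)" for i j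
    by (metis matrix_vector_mult_0 matrix_vector_mul_assoc q v(1))
  have qS: "q i ** S = S ** munit i" for i
  proof -
    have "(q i ** S) $ a $ b = (q i *v v b) $ a" for a b
      by (simp add: S_def matrix_matrix_mult_def matrix_vector_mult_def)
    then show ?thesis
      by (auto simp: vec_eq_iff qv mult_munit_nth) (auto simp: S_def)
  qed
  have "x = 0" if x: "S *v x = 0" for x
  proof -
    \<comment> \<open>Applying \<open>q i\<close> to \<open>S *v x = 0\<close> isolates the single
      term \<open>x $ i *s v i\<close>.\<close>
    have "x $ i = 0" for i
    proof -
      have "munit i *v x = x $ i *s axis i 1"
        by (auto simp: vec_eq_iff munit_def matrix_vector_mult_def axis_def if_distrib[of "\<lambda>t. t * _"] cong: if_cong)
      moreover have "S *v (munit i *v x) = q i *v (S *v x)"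
        by (simp add: matrix_vector_mul_assoc qS)
      ultimately have "0 = S *v (x $ i *s axis i 1)" using x by simp
      also have "\<dots> = x $ i *s v i"
        by (simp add: vec_eq_iff S_def matrix_vector_mult_def axis_def if_distrib[of "\<lambda>t. _ * t"] cong: if_cong)
      finally show ?thesis using v(2)[of i] by (auto simp: vec_eq_iff)
    qed
    then show ?thesis by (simp add: vec_eq_iff)
  qed
  then obtain T where T: "T ** S = mat 1"
    using matrix_left_invertible_ker[of S] by blast
  have inv: "invertible T" using T invertible_right_inverse by blast
  have "T ** q i ** matrix_inv T = munit i" for i
  proof -
    have "T ** q i ** matrix_inv T = T ** (q i ** S)"
      using matrix_inv_eqI[OF T] by (simp add: matrix_mul_assoc)
    also have "\<dots> = munit i" using T by (simp add: qS matrix_mul_assoc)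
    finally show ?thesis .
  qed
  with inv that show thesis by blast
qed

text \<open>The definite description in \<open>kks\<close> is legitimate because the trace depends
  on \<open>U\<close> and \<open>V\<close> alone. Written as a trace of \<open>U\<close> against
  \<open>Y'\<close> it allows \<open>X'\<close> to be exchanged for \<open>X\<close>; written as a
  trace of \<open>V\<close> against \<open>X\<close> it then allows \<open>Y'\<close> to be
  exchanged for \<open>Y\<close>.\<close>

lemma kks_commutator:
  fixes P :: "complex^'n^'n"
  assumes "U = X ** P - P ** X" "V = Y ** P - P ** Y"
  shows "kks P U V = trace (P ** (X ** Y - Y ** X))"
proof -
  have eq: "trace (P ** (X' ** Y' - Y' ** X')) = trace (P ** (X ** Y - Y ** X))"
    if "U = X' ** P - P ** X'" "V = Y' ** P - P ** Y'" for X' Y'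
  proof -
    have *: "trace (P ** (A ** B - B ** A)) = - trace ((A ** P - P ** A) ** B)" for A B :: "complex^'n^'n"
      by (simp add: trace_commutator_left mat_diff_rdistrib trace_sub)
    have **: "trace (P ** (A ** B - B ** A)) = trace ((B ** P - P ** B) ** A)" for A B :: "complex^'n^'n"
      using *[of B A] unfolding mat_diff_ldistrib trace_sub by (metis minus_diff_eq minus_minus)
    have "trace (P ** (X' ** Y' - Y' ** X')) = - trace (U ** Y')" by (simp add: * that)
    also have "\<dots> = trace (P ** (X ** Y' - Y' ** X))" by (simp add: * assms)
    also have "\<dots> = trace (V ** X)" by (simp add: ** that)
    also have "\<dots> = trace (P ** (X ** Y - Y ** X))" by (simp add: ** assms)
    finally show ?thesis .
  qed
  show ?thesis
    unfolding kks_def using assms eq by (intro the_equality) blast+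
qed

text \<open>Adjoin the complementary idempotent, 1 minus the sum of all \<open>Q s\<close>, together
  with its deformation, minus the sum of all \<open>V s\<close>. The formula is then the sum of the
  products (deformation times idempotent) over this complete system.\<close>

definition frame_potential :: "('k::finite \<Rightarrow> complex^'n^'n) \<Rightarrow> ('k \<Rightarrow> complex^'n^'n) \<Rightarrow> complex^'n^'n" where
  "frame_potential Q V = (\<Sum>s\<in>UNIV. V s ** Q s) - (\<Sum>s\<in>UNIV. V s) ** (mat 1 - (\<Sum>s\<in>UNIV. Q s))"

text \<open>A first-order deformation of orthogonal idempotents is infinitesimal conjugation by one
  matrix that serves all of them. The linearized relations turn \<open>Q t ** V s\<close> into terms
  with \<open>V t\<close> on the left, which gives \<open>V t ** Q t\<close> and
  \<open>V t ** Q t - V t\<close> for the two products with the potential.\<close>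

lemma commutator_frame_potential:
  fixes Q V :: "'k::finite \<Rightarrow> complex^'n^'n"
  assumes QQ: "\<And>s t. Q s ** Q t = (if s = t then Q s else 0)"
    and lin: "\<And>s t. V s ** Q t + Q s ** V t = (if s = t then V s else 0)"
  shows "frame_potential Q V ** Q t - Q t ** frame_potential Q V = V t"
proof -
  define N W where "N = (\<Sum>s\<in>UNIV. Q s)" and "W = (\<Sum>s\<in>UNIV. V s)"
  have NQ: "N ** Q t = Q t" "Q t ** N = Q t" by (simp_all add: N_def mat_sum_left mat_sum_right QQ)
  have NN: "N ** N = N" unfolding N_def by (simp add: mat_sum_left mat_sum_right QQ)
  have QV: "Q t ** V s = (if t = s then V t else 0) - V t ** Q s" for s
    using lin[of t s] unfolding eq_diff_eq by (simp only: add.commute)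
  have QW: "Q t ** W = V t - V t ** N"
    by (simp add: W_def N_def mat_sum_right QV sum_subtractf)
  have 1: "frame_potential Q V ** Q t = V t ** Q t"
  proof -
    have "(\<Sum>s\<in>UNIV. V s ** Q s) ** Q t = (\<Sum>s\<in>UNIV. if s = t then V s ** Q s else 0)"
      unfolding mat_sum_left by (rule sum.cong) (auto simp: matrix_mul_assoc[symmetric] QQ mat_zero_right)
    moreover have "W ** (mat 1 - N) ** Q t = 0"
      by (simp add: matrix_mul_assoc[symmetric] mat_diff_rdistrib NQ mat_zero_right)
    ultimately show ?thesis
      by (simp add: frame_potential_def mat_diff_rdistrib flip: N_def W_def)
  qed
  have 2: "Q t ** frame_potential Q V = V t ** Q t - V t"
  proof -
    have "Q t ** (V s ** Q s) = (if t = s then V t ** Q s else 0) - V t ** Q s" for s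
      by (simp add: matrix_mul_assoc QV mat_diff_rdistrib mat_zero_left)
        (simp add: matrix_mul_assoc[symmetric] QQ mat_diff_rdistrib mat_zero_left)
    then have "Q t ** (\<Sum>s\<in>UNIV. V s ** Q s) = V t ** Q t - V t ** N"
      by (simp add: mat_sum_right sum_subtractf N_def)
    moreover have "Q t ** (W ** (mat 1 - N)) = V t - V t ** N"
      by (simp add: matrix_mul_assoc QW mat_diff_ldistrib mat_diff_rdistrib)
        (simp add: matrix_mul_assoc[symmetric] NN)
    ultimately show ?thesis
      by (simp add: frame_potential_def mat_diff_ldistrib flip: N_def W_def)
  qed
  show ?thesis using 1 2 by simp
qed

text \<open>The contribution of each \<open>Q s\<close> vanishes separately. Dividing
  \<open>coc\<close> by \<open>mlt\<close> shows that the entrywise quotients of \<open>U s\<close>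
  by \<open>Q s\<close> are an additive cocycle in the two indices, hence a coboundary, so
  \<open>U s\<close> is also a commutator of \<open>Q s\<close> with a diagonal matrix.\<close>

lemma trace_frame_potentials:
  fixes Q U V :: "'k::finite \<Rightarrow> complex^'n^'n"
  assumes QQ: "\<And>s t. Q s ** Q t = (if s = t then Q s else 0)"
    and linU: "\<And>s t. U s ** Q t + Q s ** U t = (if s = t then U s else 0)"
    and linV: "\<And>s t. V s ** Q t + Q s ** V t = (if s = t then V s else 0)"
    and nz: "\<And>s a b. Q s $ a $ b \<noteq> 0"
    and coc: "\<And>s a j b. U s $ a $ j * Q s $ j $ b + Q s $ a $ j * U s $ j $ b = Q s $ j $ j * U s $ a $ b"
    and mlt: "\<And>s a j b. Q s $ a $ j * Q s $ j $ b = Q s $ j $ j * Q s $ a $ b"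
    and diagV: "\<And>s a. V s $ a $ a = 0"
  shows "trace ((\<Sum>s\<in>UNIV. Q s) ** (frame_potential Q U ** frame_potential Q V
           - frame_potential Q V ** frame_potential Q U)) = 0"
proof -
  define X Y where "X = frame_potential Q U" and "Y = frame_potential Q V"
  have X: "X ** Q t - Q t ** X = U t" and Y: "Y ** Q t - Q t ** Y = V t" for t
    using commutator_frame_potential[OF QQ linU] commutator_frame_potential[OF QQ linV]
    by (simp_all add: X_def Y_def)
  obtain o' :: 'n where True by simp
  \<comment> \<open>The primitive of the cocycle is its value against the arbitrary base index
    \<open>o'\<close>.\<close>
  define c where "c s a = U s $ a $ o' / Q s $ a $ o'" for s a
  have U: "U s = dmat (c s) ** Q s - Q s ** dmat (c s)" for s
  proof -
    have "U s $ a $ b = c s a * Q s $ a $ b - Q s $ a $ b * c s b" for a b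
    proof -
      have 1: "U s $ a $ b * Q s $ b $ o' + Q s $ a $ b * U s $ b $ o' = Q s $ b $ b * U s $ a $ o'"
        and 2: "Q s $ a $ b * Q s $ b $ o' = Q s $ b $ b * Q s $ a $ o'"
        using coc mlt by blast+
      have "U s $ a $ b * Q s $ b $ o' = Q s $ b $ b * U s $ a $ o' - Q s $ a $ b * U s $ b $ o'"
        using 1 by (simp add: algebra_simps)
      also have "\<dots> = (c s a * Q s $ a $ b - Q s $ a $ b * c s b) * Q s $ b $ o'"
        using nz[of s a o'] nz[of s b o'] 2 by (simp add: c_def field_simps)
      finally show ?thesis using nz[of s b o'] by simp
    qed
    then show ?thesis by (simp add: vec_eq_iff dmat_mult_nth mult_dmat_nth)
  qed
  \<comment> \<open>The generator \<open>X\<close> of \<open>U s\<close> is replaced by the diagonal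
    \<open>dmat (c s)\<close>; moving the commutator onto \<open>Y\<close> then produces
    \<open>V s\<close>, whose zero diagonal kills the trace.\<close>
  have tr0: "trace (Q s ** (X ** Y - Y ** X)) = 0" for s
  proof -
    have "trace (Q s ** (X ** Y - Y ** X)) = - trace (U s ** Y)"
      by (simp add: trace_commutator_left mat_diff_rdistrib trace_sub flip: X)
    also have "\<dots> = trace (Q s ** (dmat (c s) ** Y - Y ** dmat (c s)))"
      by (simp add: trace_commutator_left U mat_diff_rdistrib trace_sub)
    also have "\<dots> = trace (V s ** dmat (c s))"
      using trace_commutator_left[of "Q s" Y "dmat (c s)"]
      unfolding Y[symmetric] mat_diff_rdistrib mat_diff_ldistrib trace_sub by (metis minus_diff_eq)
    also have "\<dots> = 0" by (simp add: trace_def mult_dmat_nth diagV)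
    finally show ?thesis .
  qed
  have "trace ((\<Sum>s\<in>UNIV. Q s) ** (X ** Y - Y ** X)) = 0"
    by (simp add: mat_sum_left trace_sum tr0)
  then show ?thesis by (simp add: X_def Y_def)
qed

section \<open>Irreducibility of stable matrices and gauge fixing\<close>

lemma trace_munit_mult: "trace (munit j ** A) = A $ j $ j"
  by (simp add: trace_def munit_mult_nth)

lemma munit_middle: "(A ** munit a ** B) $ i $ j = A $ i $ a * B $ a $ j"
proof -
  have "(A ** munit a ** B) $ i $ j = (\<Sum>c\<in>UNIV. if c = a then A $ i $ a * B $ a $ j else 0)"
    unfolding matrix_matrix_mult_def[of "A ** munit a"] vec_lambda_beta mult_munit_nth
    by (rule sum.cong) auto
  then show ?thesis by simp
qed

lemma torus_iff: "t \<in> torus \<longleftrightarrow> (\<exists>c. (\<forall>i. c i \<noteq> 0) \<and> t = dmat c)"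
proof
  assume t: "t \<in> torus"
  then have eq: "t = dmat (\<lambda>i. t $ i $ i)"
    by (auto simp: torus_def dmat_def vec_eq_iff)
  moreover have "t $ i $ i \<noteq> 0" for i
  proof
    assume "t $ i $ i = 0"
    then have "(t ** matrix_inv t) $ i $ i = 0" by (subst eq) (simp add: dmat_mult_nth)
    then show False using t by (simp add: torus_def matrix_inv_mult mat_def)
  qed
  ultimately show "\<exists>c. (\<forall>i. c i \<noteq> 0) \<and> t = dmat c" by (intro exI[of _ "\<lambda>i. t $ i $ i"]) simp
next
  assume "\<exists>c. (\<forall>i. c i \<noteq> 0) \<and> t = dmat c"
  then obtain c where c: "\<And>i. c i \<noteq> 0" "t = dmat c" by blast
  then show "t \<in> torus" using matrix_inv_dmat(2)[of c] by (simp add: torus_def dmat_def)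
qed

text \<open>A reducible matrix degenerates under a one-parameter subgroup of the torus to one with a
  larger stabilizer.\<close>

lemma stable_irreducible:
  assumes M: "M \<in> stable_set k l" and S: "S \<noteq> {}" "S \<noteq> UNIV"
  shows "\<exists>a\<in>S. \<exists>b. b \<notin> S \<and> M $ a $ b \<noteq> 0"
proof (rule ccontr)
  assume "\<not> ?thesis"
  then have zero: "M $ a $ b = 0" if "a \<in> S" "b \<notin> S" for a b using that by blast
  have level: "M \<in> level_set k l" and idem: "M ** M = M" and rk: "rank M = k" and diag: "moment_map M = l"
    using M by (auto simp: stable_set_def level_set_def projector_orbit_def)
  \<comment> \<open>The torus orbit of \<open>M\<close> under scaling the coordinates outside
    \<open>S\<close> by \<open>z\<close>, extended to the limit \<open>z = 0\<close>. The block with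
    rows in \<open>S\<close> and columns outside it is zero, so no negative power of
    \<open>z\<close> occurs.\<close>
  define Mz where "Mz z = (\<chi> a b. if a \<notin> S \<and> b \<in> S then z * M $ a $ b else M $ a $ b)" for z :: complex
  define c where "c z a = (if a \<in> S then 1 else z)" for z :: complex and a
  have conj: "Mz z = torus_act (dmat (c z)) M" and inv: "invertible (dmat (c z))" if "z \<noteq> 0" for z
  proof -
    have "c z i \<noteq> 0" for i using that by (simp add: c_def)
    then show "Mz z = torus_act (dmat (c z)) M" "invertible (dmat (c z))"
      by (simp_all add: torus_act_def vec_eq_iff dmat_conj_nth matrix_inv_dmat(2))
        (auto simp: Mz_def c_def zero that)
  qed
  have cont: "continuous_on UNIV (\<lambda>z. Mz z $ a $ b)" for a b
    by (cases "a \<notin> S \<and> b \<in> S") (auto simp: Mz_def intro!: continuous_intros)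
  \<comment> \<open>Continuity in \<open>z\<close> alone carries an equation from nonzero
    \<open>z\<close> to the limit; this is how Zariski closedness of the orbit is exploited.\<close>
  have extend: "f 0 = r" if "continuous_on UNIV f" "\<And>z. z \<noteq> 0 \<Longrightarrow> f z = r" for f :: "complex \<Rightarrow> complex" and r
  proof -
    have cl: "closure (- {0::complex}) = UNIV" by (simp add: closure_complement)
    show ?thesis
      by (rule continuous_constant_on_closure[of "- {0}" f r]) (use that cl in auto)
  qed
  have tr: "trace (Mz z) = trace M" for z
    by (simp add: trace_def Mz_def)
  have idem_z: "Mz z ** Mz z = Mz z" if "z \<noteq> 0" for z
    using conj_mult[OF inv[OF that], of M M] by (simp add: conj[OF that] torus_act_def idem)
  have idem_0: "Mz 0 ** Mz 0 = Mz 0"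
  proof -
    have "(Mz 0 ** Mz 0 - Mz 0) $ a $ b = 0" for a b
    proof (rule extend[where f = "\<lambda>z. (Mz z ** Mz z - Mz z) $ a $ b"])
      show "continuous_on UNIV (\<lambda>z. (Mz z ** Mz z - Mz z) $ a $ b)"
        by (auto simp: matrix_matrix_mult_def intro!: continuous_intros cont)
    qed (simp add: idem_z)
    then have "Mz 0 ** Mz 0 - Mz 0 = 0" by (simp add: vec_eq_iff)
    then show ?thesis by simp
  qed
  \<comment> \<open>The scaled block avoids the diagonal, so the trace, and with it the rank of the
    idempotent, survives in the limit.\<close>
  have "of_nat (rank (Mz z)) = (of_nat k :: complex)" for z
    using rank_idempotent[of "Mz z"] rank_idempotent[OF idem] idem_0 idem_z[of z] tr[of z] rk
    by (cases "z = 0") auto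
  then have Mz_level: "Mz z \<in> level_set k l" for z
    using idem_0 idem_z[of z] diag
    by (cases "z = 0") (auto simp: level_set_def projector_orbit_def moment_map_def Mz_def)
  have cont_f: "continuous_on UNIV (\<lambda>z. f (Mz z))" if "f \<in> carrier (level_alg k l)" for f
  proof -
    have "f \<in> polyfuns (level_set k l) {s. \<exists>i j. s = (\<lambda>M. M $ i $ j)}"
      using that by (simp add: level_alg_def fun_alg_def)
    then show ?thesis
      by induction (auto simp: Mz_level intro!: continuous_intros cont)
  qed
  obtain F where F: "F \<subseteq> carrier (level_alg k l)"
    and orbit: "{torus_act t M | t. t \<in> torus} = {N \<in> level_set k l. \<forall>f\<in>F. f N = 0}"
    using M by (auto simp: stable_set_def)
  have "f (Mz 0) = 0" if "f \<in> F" for f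
  proof (rule extend[where f = "\<lambda>z. f (Mz z)"])
    show "continuous_on UNIV (\<lambda>z. f (Mz z))" using cont_f F that by blast
  next
    fix z :: complex assume z: "z \<noteq> 0"
    have "dmat (c z) \<in> torus" using z unfolding torus_iff by (intro exI[of _ "c z"]) (simp add: c_def)
    then have "Mz z \<in> {torus_act t M | t. t \<in> torus}" using conj[OF z] by blast
    then show "f (Mz z) = 0" using orbit that by blast
  qed
  then have "Mz 0 \<in> {torus_act t M | t. t \<in> torus}" using orbit Mz_level by blast
  then obtain d where d: "\<And>i. d i \<noteq> 0" and Md: "Mz 0 = torus_act (dmat d) M"
    unfolding torus_iff by blast
  \<comment> \<open>Torus conjugation cannot change which entries vanish. As the limit lies in the
    orbit of \<open>M\<close>, the second off-diagonal block of \<open>M\<close> is zero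
    too.\<close>
  have block: "M $ a $ b = 0" if "a \<notin> S" "b \<in> S" for a b
  proof -
    have "Mz 0 $ a $ b = d a * M $ a $ b / d b" using d by (simp add: Md torus_act_def dmat_conj_nth)
    then show ?thesis using that d[of a] d[of b] by (simp add: Mz_def)
  qed
  \<comment> \<open>Now \<open>M\<close> is block diagonal and commutes with a diagonal matrix that
    is 1 on \<open>S\<close> and 2 off \<open>S\<close>, which is not scalar.\<close>
  have "dmat (c 2) \<in> torus" unfolding torus_iff by (intro exI[of _ "c 2"]) (simp add: c_def)
  moreover have "torus_act (dmat (c 2)) M = M"
    unfolding conj[of 2, OF zero_neq_numeral[symmetric], symmetric] by (simp add: Mz_def vec_eq_iff block)
  moreover have "{t \<in> torus. torus_act t M = M} = {mat c | c. c \<noteq> 0}"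
    using M by (simp add: stable_set_def)
  ultimately obtain e where e: "dmat (c 2) = mat e" by blast
  obtain a b where "a \<in> S" "b \<notin> S" using S by blast
  then show False
    using arg_cong[OF e, of "\<lambda>m. m $ a $ a"] arg_cong[OF e, of "\<lambda>m. m $ b $ b"]
    by (simp add: dmat_def mat_def c_def)
qed

section \<open>Words in the generators evaluated at matrices\<close>

definition word_mat :: "('n \<Rightarrow> complex^'n^'n) \<Rightarrow> complex^'n^'n \<Rightarrow> 'n gen_A list \<Rightarrow> complex^'n^'n" where
  "word_mat q P ws = foldr (\<lambda>g m. (case g of Aq j \<Rightarrow> q j | AP \<Rightarrow> P) ** m) ws (mat 1)"

lemma word_mat_simps [simp]:
  "word_mat q P [] = mat 1"
  "word_mat q P (Aq j # ws) = q j ** word_mat q P ws"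
  "word_mat q P (AP # ws) = P ** word_mat q P ws"
  by (simp_all add: word_mat_def)

lemma word_mat_append: "word_mat q P (vs @ ws) = word_mat q P vs ** word_mat q P ws"
proof (induction vs)
  case (Cons g vs)
  then show ?case by (cases g) (simp_all add: matrix_mul_assoc)
qed simp

lemma word_mat_conj:
  assumes "invertible g"
  shows "word_mat (\<lambda>j. g ** q j ** matrix_inv g) (g ** P ** matrix_inv g) ws
    = g ** word_mat q P ws ** matrix_inv g"
proof (induction ws)
  case Nil
  then show ?case by (simp add: matrix_inv_mult assms)
next
  case (Cons x ws)
  then show ?case by (cases x) (simp_all add: conj_mult assms)
qed

text \<open>Reachability in the graph of nonzero entries of \<open>M\<close>. If the indices reached
  from \<open>o'\<close> were not all indices, irreducibility would supply an edge leaving that set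
  and a longer word; for words ending at \<open>o'\<close> the same argument applies to the set
  \<open>T\<close> of indices not reached.\<close>

lemma stable_connected:
  assumes M: "M \<in> stable_set k l"
  shows "\<exists>ws. word_mat munit M ws $ o' $ a \<noteq> 0" and "\<exists>ws. word_mat munit M ws $ a $ o' \<noteq> 0"
proof -
  define S where "S = {a. \<exists>ws. word_mat munit M ws $ o' $ a \<noteq> 0}"
  define T where "T = {a. \<forall>ws. word_mat munit M ws $ a $ o' = 0}"
  have nil: "word_mat munit M [] $ o' $ o' \<noteq> 0" by (simp add: mat_def)
  have "S = UNIV"
  proof (rule ccontr)
    assume "S \<noteq> UNIV"
    moreover have "S \<noteq> {}" using nil unfolding S_def by blast
    ultimately obtain a b where "a \<in> S" and ab: "b \<notin> S" "M $ a $ b \<noteq> 0"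
      using stable_irreducible[OF M, of S] by blast
    then obtain ws where ws: "word_mat munit M ws $ o' $ a \<noteq> 0" by (auto simp: S_def)
    \<comment> \<open>The inserted \<open>munit a\<close> forces all paths through the index
      \<open>a\<close>: the new entry is one product of two nonzero numbers, with no sum in which
      terms could cancel.\<close>
    have "word_mat munit M (ws @ [Aq a, AP]) = word_mat munit M ws ** munit a ** M"
      by (simp add: word_mat_append matrix_mul_assoc)
    then have "word_mat munit M (ws @ [Aq a, AP]) $ o' $ b \<noteq> 0" using ab ws by (simp add: munit_middle del: word_mat_simps)
    then show False using ab(1) unfolding S_def by blast
  qed
  then show "\<exists>ws. word_mat munit M ws $ o' $ a \<noteq> 0" by (auto simp: S_def)
  have "T = {}"
  proof (rule ccontr)
    assume "T \<noteq> {}"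
    moreover have "T \<noteq> UNIV" using nil unfolding T_def by blast
    ultimately obtain a b where ab: "a \<in> T" "M $ a $ b \<noteq> 0" and "b \<notin> T"
      using stable_irreducible[OF M, of T] by blast
    then obtain ws where ws: "word_mat munit M ws $ b $ o' \<noteq> 0" by (auto simp: T_def)
    have "word_mat munit M (AP # Aq b # ws) = M ** munit b ** word_mat munit M ws"
      by (simp add: matrix_mul_assoc)
    then have "word_mat munit M (AP # Aq b # ws) $ a $ o' \<noteq> 0" using ab ws by (simp add: munit_middle del: word_mat_simps)
    then show False using ab(1) unfolding T_def by blast
  qed
  then show "\<exists>ws. word_mat munit M ws $ a $ o' \<noteq> 0" by (auto simp: T_def)
qed

text \<open>With the \<open>q\<^sub>j\<close> diagonal, conjugation by the diagonal matrix of the \<open>wt M a\<close> normalizes \<open>M\<close>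
  within its torus orbit; the entries of the result are the ratios \<open>gnum / gden\<close> of invariants.\<close>

locale gauge =
  fixes o' :: "'n::finite" and W V :: "'n \<Rightarrow> 'n gen_A list"
begin

text \<open>The trace of a closed walk: from \<open>o'\<close> along \<open>W a\<close>, through the
  entry of \<open>p\<close> at \<open>a\<close>, \<open>b\<close>, and back along
  \<open>V b\<close>. Keeping \<open>p\<close> apart from \<open>P\<close> allows the individual
  idempotents to be gauge-fixed by words in their sum.\<close>

definition num :: "('n \<Rightarrow> complex^'n^'n) \<Rightarrow> complex^'n^'n \<Rightarrow> complex^'n^'n \<Rightarrow> 'n \<Rightarrow> 'n \<Rightarrow> complex" where
  "num q P p a b = trace (q o' ** word_mat q P (W a) ** q a ** p ** q b ** word_mat q P (V b))"

definition den :: "('n \<Rightarrow> complex^'n^'n) \<Rightarrow> complex^'n^'n \<Rightarrow> 'n \<Rightarrow> complex" where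
  "den q P a = trace (q o' ** word_mat q P (W a) ** q a ** word_mat q P (V a))"

text \<open>The fraction of \<open>num\<close> at \<open>a\<close>, \<open>b\<close> by
  \<open>den\<close> at \<open>b\<close>, brought to the common denominator \<open>gden\<close>, so
  that a single invariant has to be nonzero.\<close>

definition gnum :: "('n \<Rightarrow> complex^'n^'n) \<Rightarrow> complex^'n^'n \<Rightarrow> complex^'n^'n \<Rightarrow> 'n \<Rightarrow> 'n \<Rightarrow> complex" where
  "gnum q P p a b = num q P p a b * (\<Prod>c\<in>UNIV - {b}. den q P c)"

definition gden :: "('n \<Rightarrow> complex^'n^'n) \<Rightarrow> complex^'n^'n \<Rightarrow> complex" where
  "gden q P = (\<Prod>c\<in>UNIV. den q P c)"

definition wt :: "complex^'n^'n \<Rightarrow> 'n \<Rightarrow> complex" where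
  "wt M a = word_mat munit M (W a) $ o' $ a"

lemma num_conj:
  assumes g: "invertible g"
  shows "num (\<lambda>j. g ** q j ** matrix_inv g) (g ** P ** matrix_inv g) (g ** p ** matrix_inv g) a b = num q P p a b"
  by (simp add: num_def word_mat_conj g conj_mult trace_conj)

lemma den_conj:
  assumes g: "invertible g"
  shows "den (\<lambda>j. g ** q j ** matrix_inv g) (g ** P ** matrix_inv g) a = den q P a"
  by (simp add: den_def word_mat_conj g conj_mult trace_conj)

lemma gnum_conj:
  assumes g: "invertible g"
  shows "gnum (\<lambda>j. g ** q j ** matrix_inv g) (g ** P ** matrix_inv g) (g ** p ** matrix_inv g) a b = gnum q P p a b"
  by (simp add: gnum_def num_conj den_conj g)

lemma gden_conj:
  assumes g: "invertible g"
  shows "gden (\<lambda>j. g ** q j ** matrix_inv g) (g ** P ** matrix_inv g) = gden q P"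
  by (simp add: gden_def den_conj g)

lemma gnum_sum: "gnum q P (\<Sum>s\<in>S. p s) a b = (\<Sum>s\<in>S. gnum q P (p s) a b)"
  by (simp add: gnum_def num_def mat_sum_left mat_sum_right trace_sum sum_distrib_right)

lemma num_munit: "num munit M p a b = wt M a * p $ a $ b * word_mat munit M (V b) $ b $ o'"
proof -
  have "num munit M p a b = (word_mat munit M (W a) ** munit a ** p ** munit b ** word_mat munit M (V b)) $ o' $ o'"
    unfolding num_def using trace_munit_mult by (metis matrix_mul_assoc)
  then show ?thesis by (simp add: munit_middle wt_def)
qed

lemma den_munit: "den munit M a = wt M a * word_mat munit M (V a) $ a $ o'"
proof -
  have "den munit M a = (word_mat munit M (W a) ** munit a ** word_mat munit M (V a)) $ o' $ o'"
    unfolding den_def using trace_munit_mult by (metis matrix_mul_assoc)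
  then show ?thesis by (simp add: munit_middle wt_def)
qed

text \<open>The return factors along \<open>V b\<close> cancel between numerator and denominator,
  which leaves the entries of \<open>p\<close> conjugated by the diagonal matrix of the weights. The
  form without division holds for every \<open>M\<close> and can therefore be differentiated on the
  level set.\<close>

lemma gnum_munit: "gnum munit M p a b * wt M b = wt M a * p $ a $ b * gden munit M"
  unfolding gnum_def gden_def num_munit
  by (subst prod.remove[of UNIV b]) (simp_all add: den_munit)

lemma wt_nonzero: "gden munit M \<noteq> 0 \<Longrightarrow> wt M a \<noteq> 0"
  by (auto simp: gden_def den_munit)

lemma gnum_munit_div:
  assumes "gden munit M \<noteq> 0"
  shows "gnum munit M p a b = (dmat (wt M) ** p ** matrix_inv (dmat (wt M))) $ a $ b * gden munit M"
  using gnum_munit[of M p a b] wt_nonzero[OF assms] by (simp add: dmat_conj_nth field_simps)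

end

lemma stable_gauge:
  assumes "M \<in> stable_set k l"
  obtains W V where "gauge.gden o' W V munit M \<noteq> 0"
proof -
  have "\<forall>a. \<exists>ws. word_mat munit M ws $ o' $ a \<noteq> 0" "\<forall>a. \<exists>ws. word_mat munit M ws $ a $ o' \<noteq> 0"
    using stable_connected[OF assms] by blast+
  then obtain W V where "\<And>a. word_mat munit M (W a) $ o' $ a \<noteq> 0" "\<And>a. word_mat munit M (V a) $ a $ o' \<noteq> 0"
    unfolding choice_iff by blast
  then have "gauge.gden o' W V munit M \<noteq> 0"
    by (simp add: gauge.gden_def gauge.den_munit gauge.wt_def)
  then show thesis by (rule that)
qed

section \<open>Presented algebras\<close>

lemma scal_add: "scal (c + d) = scal c + scal d"
  by (simp add: scal_def single_add)

lemma scal_mult: "scal (c * d) = scal c * scal d"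
  by (simp add: scal_def mult_single plus_list_def)

lemma scal_1: "scal 1 = 1"
  unfolding scal_def zero_list_def[symmetric] by simp

lemma single_Cons: "Poly_Mapping.single (g # w) c = gen g * Poly_Mapping.single w c"
  by (simp add: gen_def mult_single plus_list_def)

lemma ncpoly_induct:
  fixes x :: "'g ncpoly"
  assumes single: "\<And>w c. P (Poly_Mapping.single w c)" and add: "\<And>x y. P x \<Longrightarrow> P y \<Longrightarrow> P (x + y)"
  shows "P x"
proof (induction x rule: Poly_Mapping.update_induct)
  case const
  show ?case using single[of "[]" 0] by simp
next
  case (update f a b)
  then have "Poly_Mapping.update a b f = f + Poly_Mapping.single a b"
    by (intro poly_mapping_eqI) (auto simp: lookup_update lookup_add lookup_single in_keys_iff when_def)
  then show ?case using update single add by simp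
qed

lemma scal_commute: "x * scal c = scal c * x"
  by (induction x rule: ncpoly_induct) (simp_all add: scal_def mult_single plus_list_def algebra_simps)

lemma ring_free_alg: "ring (free_alg :: (complex, 'g ncpoly) module)"
proof (rule ringI)
  show "abelian_group (free_alg :: (complex, 'g ncpoly) module)"
  proof (rule abelian_groupI)
    fix x :: "'g ncpoly"
    show "\<exists>y\<in>carrier free_alg. y \<oplus>\<^bsub>free_alg\<^esub> x = \<zero>\<^bsub>free_alg\<^esub>"
      by (intro bexI[of _ "- x"]) (auto simp: free_alg_def)
  qed (auto simp: free_alg_def algebra_simps)
  show "Group.monoid (free_alg :: (complex, 'g ncpoly) module)"
    by (rule monoidI) (auto simp: free_alg_def algebra_simps)
qed (auto simp: free_alg_def algebra_simps)

lemma ideal_free_algI: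
  fixes J :: "'g ncpoly set"
  assumes zero: "0 \<in> J" and minus: "\<And>x y. x \<in> J \<Longrightarrow> y \<in> J \<Longrightarrow> x - y \<in> J"
    and left: "\<And>x y. y \<in> J \<Longrightarrow> x * y \<in> J" and right: "\<And>x y. x \<in> J \<Longrightarrow> x * y \<in> J"
  shows "ideal J free_alg"
proof (rule idealI[OF ring_free_alg])
  interpret F: ring "free_alg :: (complex, 'g ncpoly) module" by (rule ring_free_alg)
  have inv: "\<ominus>\<^bsub>free_alg\<^esub> x = - x" for x :: "'g ncpoly"
    by (rule F.minus_equality) (auto simp: free_alg_def)
  have neg: "- x \<in> J" if "x \<in> J" for x using minus[OF zero that] by simp
  show "subgroup J (add_monoid free_alg)"
  proof (rule F.add.subgroupI)
    show "a \<oplus>\<^bsub>free_alg\<^esub> b \<in> J" if "a \<in> J" "b \<in> J" for a b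
      using minus[OF that(1) neg[OF that(2)]] by (simp add: free_alg_def)
    show "J \<subseteq> carrier free_alg" by (simp add: free_alg_def)
  qed (use zero neg in \<open>auto simp: inv\<close>)
qed (use left right in \<open>auto simp: free_alg_def\<close>)

section \<open>The relation ideal and the operations of the quotient on representatives\<close>

definition relideal :: "'g ncpoly set \<Rightarrow> 'g ncpoly set" where
  "relideal R = genideal free_alg R"

definition cls :: "'g ncpoly set \<Rightarrow> 'g ncpoly \<Rightarrow> 'g ncpoly set" where
  "cls R x = genideal free_alg R +>\<^bsub>free_alg\<^esub> x"

lemma ideal_relideal: "ideal (relideal R) free_alg"
  unfolding relideal_def by (rule ring.genideal_ideal[OF ring_free_alg]) (simp add: free_alg_def)

lemma relideal_minimal: "ideal J free_alg \<Longrightarrow> R \<subseteq> J \<Longrightarrow> relideal R \<subseteq> J"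
  unfolding relideal_def by (rule ring.genideal_minimal[OF ring_free_alg])

lemma relideal_subset: "R \<subseteq> relideal R"
  unfolding relideal_def by (rule ring.genideal_self[OF ring_free_alg]) (simp add: free_alg_def)

lemma relideal_closed:
  "0 \<in> relideal R"
  "x \<in> relideal R \<Longrightarrow> y \<in> relideal R \<Longrightarrow> x + y \<in> relideal R"
  "y \<in> relideal R \<Longrightarrow> x * y \<in> relideal R"
  "x \<in> relideal R \<Longrightarrow> x * y \<in> relideal R"
proof -
  interpret I: ideal "relideal R" free_alg by (rule ideal_relideal)
  have "\<zero>\<^bsub>free_alg\<^esub> \<in> relideal R" by (rule additive_subgroup.zero_closed[OF I.additive_subgroup_axioms])
  then show "0 \<in> relideal R" unfolding free_alg_def by (simp only: ring.simps)
  show "x \<in> relideal R \<Longrightarrow> y \<in> relideal R \<Longrightarrow> x + y \<in> relideal R"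
    using additive_subgroup.a_closed[OF I.additive_subgroup_axioms, of x y] by (simp add: free_alg_def)
  show "y \<in> relideal R \<Longrightarrow> x * y \<in> relideal R"
    using I.I_l_closed[of y x] by (simp add: free_alg_def)
  show "x \<in> relideal R \<Longrightarrow> x * y \<in> relideal R"
    using I.I_r_closed[of x y] by (simp add: free_alg_def)
qed

lemma relideal_minus: "x \<in> relideal R \<Longrightarrow> y \<in> relideal R \<Longrightarrow> x - y \<in> relideal R"
  using relideal_closed(2)[of x R "- y"] relideal_closed(3)[of y R "- 1"] by simp

lemma cls_eq: "cls R x = {i + x | i. i \<in> relideal R}"
  by (auto simp: cls_def relideal_def a_r_coset_def' free_alg_def)

lemma cls_eq_iff: "cls R x = cls R y \<longleftrightarrow> x - y \<in> relideal R"
proof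
  assume "cls R x = cls R y"
  moreover have "x \<in> cls R x" unfolding cls_eq using relideal_closed(1) by force
  ultimately show "x - y \<in> relideal R" by (auto simp: cls_eq)
next
  have sub: "cls R x \<subseteq> cls R y" if "x - y \<in> relideal R" for x y
  proof
    fix z assume "z \<in> cls R x"
    then obtain i where i: "i \<in> relideal R" "z = i + x" by (auto simp: cls_eq)
    have "z = (i + (x - y)) + y" by (simp add: i)
    then show "z \<in> cls R y" unfolding cls_eq using relideal_closed(2)[OF i(1) that] by blast
  qed
  assume xy: "x - y \<in> relideal R"
  then have "y - x \<in> relideal R" using relideal_minus[OF relideal_closed(1) xy] by simp
  then show "cls R x = cls R y" using sub xy by blast
qed

lemma pgen_cls: "pgen R g = cls R (gen g)"
  by (simp add: pgen_def cls_def)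

lemma cls_relation: "r \<in> R \<Longrightarrow> cls R r = cls R 0"
  using relideal_subset[of R] by (auto simp: cls_eq_iff)

lemma carrier_presented: "carrier (presented R) = range (cls R)"
  by (auto simp: presented_def quot_alg_def FactRing_def A_RCOSETS_def' cls_def free_alg_def)

lemma mult_presented: "cls R x \<otimes>\<^bsub>presented R\<^esub> cls R y = cls R (x * y)"
  using ideal.rcoset_mult_add[OF ideal_relideal, of x y]
  by (simp add: presented_def quot_alg_def FactRing_def cls_def relideal_def)
    (simp add: free_alg_def)

lemma add_presented: "cls R x \<oplus>\<^bsub>presented R\<^esub> cls R y = cls R (x + y)"
proof -
  have "ideal (genideal free_alg R) free_alg" using ideal_relideal by (simp add: relideal_def)
  then interpret I: ideal "genideal free_alg R" free_alg .
  show ?thesis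
    using I.a_rcos_sum[of x y]
    by (simp add: presented_def quot_alg_def FactRing_def cls_def) (simp add: free_alg_def)
qed

lemma one_presented: "\<one>\<^bsub>presented R\<^esub> = cls R 1"
  by (simp add: presented_def quot_alg_def FactRing_def cls_def) (simp add: free_alg_def)

lemma zero_presented: "\<zero>\<^bsub>presented R\<^esub> = cls R 0"
  unfolding cls_eq by (simp add: presented_def quot_alg_def FactRing_def relideal_def)

text \<open>Scalar multiplication in \<open>quot_alg\<close> is a union of cosets over all
  representatives. The ideal absorbs \<open>scal c\<close>, so these cosets coincide and the union
  is a single coset.\<close>

lemma smult_presented: "c \<odot>\<^bsub>presented R\<^esub> cls R x = cls R (scal c * x)"
proof -
  have "cls R (scal c * y) = cls R (scal c * x)" if "y \<in> cls R x" for y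
    using that relideal_closed(3)[of _ R "scal c"]
    by (auto simp: cls_eq[of R x] cls_eq_iff simp flip: right_diff_distrib)
  moreover have "x \<in> cls R x" unfolding cls_eq using relideal_closed(1) by force
  ultimately have "(\<Union>y\<in>cls R x. cls R (scal c * y)) = cls R (scal c * x)" by blast
  then show ?thesis
    by (simp add: presented_def quot_alg_def) (simp add: cls_def free_alg_def)
qed

lemma abelian_monoid_presented: "abelian_monoid (presented R)"
  by (rule abelian_monoidI)
    (auto simp: carrier_presented add_presented zero_presented algebra_simps)

lemma finsum_presented:
  assumes "finite S"
  shows "(\<Oplus>\<^bsub>presented R\<^esub>i\<in>S. cls R (f i)) = cls R (\<Sum>i\<in>S. f i)"
proof -
  interpret abelian_monoid "presented R" by (rule abelian_monoid_presented)
  show ?thesis using assms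
    by (induction S rule: finite_induct) (auto simp: zero_presented add_presented carrier_presented)
qed

section \<open>The universal property of a presented algebra\<close>

lemma alg_hom_presented:
  assumes "h \<in> alg_hom (presented R) T"
  shows "h (cls R x) \<in> carrier T"
    "h (cls R (x * y)) = h (cls R x) \<otimes>\<^bsub>T\<^esub> h (cls R y)"
    "h (cls R (x + y)) = h (cls R x) \<oplus>\<^bsub>T\<^esub> h (cls R y)"
    "h (cls R 1) = \<one>\<^bsub>T\<^esub>"
    "h (cls R (scal c * x)) = c \<odot>\<^bsub>T\<^esub> h (cls R x)"
proof -
  show "h (cls R (scal c * x)) = c \<odot>\<^bsub>T\<^esub> h (cls R x)"
    using assms unfolding alg_hom_def smult_presented[symmetric] by (auto simp: carrier_presented)
qed (use assms in \<open>auto simp: alg_hom_def ring_hom_def carrier_presented mult_presented[symmetric]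
      add_presented[symmetric] one_presented[symmetric]\<close>)

lemma alg_hom_presentedI:
  assumes "h \<in> extensional (range (cls R))"
    and "\<And>x. h (cls R x) \<in> carrier T"
    "\<And>x y. h (cls R (x * y)) = h (cls R x) \<otimes>\<^bsub>T\<^esub> h (cls R y)"
    "\<And>x y. h (cls R (x + y)) = h (cls R x) \<oplus>\<^bsub>T\<^esub> h (cls R y)"
    "h (cls R 1) = \<one>\<^bsub>T\<^esub>"
    "\<And>c x. h (cls R (scal c * x)) = c \<odot>\<^bsub>T\<^esub> h (cls R x)"
  shows "h \<in> alg_hom (presented R) T"
  unfolding alg_hom_def ring_hom_def using assms
  by (auto simp: PiE_def carrier_presented mult_presented add_presented smult_presented one_presented)

text \<open>The classes of the generators generate the algebra: words are treated by induction on
  their length, and sums by \<open>ncpoly_induct\<close>. Extensionality settles the arguments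
  outside the carrier.\<close>

lemma alg_hom_presented_eqI:
  fixes R :: "'g ncpoly set"
  assumes h: "h \<in> alg_hom (presented R) T" and h': "h' \<in> alg_hom (presented R) T"
    and gen: "\<And>g. h (pgen R g) = h' (pgen R g)"
  shows "h = h'"
proof -
  have single: "h (cls R (Poly_Mapping.single w c)) = h' (cls R (Poly_Mapping.single w c))" for w c
  proof (induction w)
    case Nil
    have "(Poly_Mapping.single [] c :: 'g ncpoly) = scal c * 1" by (simp add: scal_def)
    then show ?case
      by (simp only: alg_hom_presented(5)[OF h] alg_hom_presented(5)[OF h'])
        (simp only: alg_hom_presented(4)[OF h] alg_hom_presented(4)[OF h'])
  next
    case (Cons g w)
    then show ?case
      by (simp add: single_Cons alg_hom_presented[OF h] alg_hom_presented[OF h'] gen flip: pgen_cls)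
  qed
  have "h (cls R x) = h' (cls R x)" for x
    by (induction x rule: ncpoly_induct)
      (simp_all add: single alg_hom_presented[OF h] alg_hom_presented[OF h'])
  moreover have "h \<in> extensional (range (cls R))" "h' \<in> extensional (range (cls R))"
    using h h' by (auto simp: alg_hom_def PiE_def carrier_presented)
  ultimately show ?thesis by (auto intro: extensionalityI)
qed

text \<open>A map on the free algebra that is constant modulo an ideal \<open>J\<close> containing
  the relations descends, since the relation ideal lies in \<open>J\<close>; \<open>h\<close>
  evaluates it at a chosen representative.\<close>

lemma alg_hom_presented_exists:
  assumes J: "ideal J free_alg" "R \<subseteq> J" and eq: "\<And>x y. x - y \<in> J \<Longrightarrow> \<phi> x = \<phi> y"
    and \<phi>: "\<And>x. \<phi> x \<in> carrier T"
    "\<And>x y. \<phi> (x * y) = \<phi> x \<otimes>\<^bsub>T\<^esub> \<phi> y" "\<And>x y. \<phi> (x + y) = \<phi> x \<oplus>\<^bsub>T\<^esub> \<phi> y"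
    "\<phi> 1 = \<one>\<^bsub>T\<^esub>" "\<And>c x. \<phi> (scal c * x) = c \<odot>\<^bsub>T\<^esub> \<phi> x"
  shows "\<exists>h \<in> alg_hom (presented R) T. \<forall>x. h (cls R x) = \<phi> x"
proof -
  define h where "h = (\<lambda>X\<in>range (cls R). \<phi> (SOME x. X = cls R x))"
  have h: "h (cls R x) = \<phi> x" for x
  proof -
    have "cls R x = cls R (SOME y. cls R x = cls R y)" by (rule someI) simp
    then have "x - (SOME y. cls R x = cls R y) \<in> J"
      using relideal_minimal[OF J] by (auto simp: cls_eq_iff)
    then show ?thesis using eq by (simp add: h_def)
  qed
  have "h \<in> alg_hom (presented R) T"
  proof (rule alg_hom_presentedI)
    show "h (cls R (scal c * x)) = c \<odot>\<^bsub>T\<^esub> h (cls R x)" for c x by (simp only: h \<phi>(5))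
  qed (simp_all add: h \<phi>, simp add: h_def)
  then show ?thesis using h by blast
qed

lemma presented_hom_eq:
  assumes "h \<in> alg_hom (presented R) T" "\<And>g. h (pgen R g) = v g"
  shows "presented_hom R T v = h"
  unfolding presented_hom_def
proof (rule the_equality)
  fix h' assume "h' \<in> alg_hom (presented R) T \<and> (\<forall>g. h' (pgen R g) = v g)"
  then show "h' = h" using assms by (intro alg_hom_presented_eqI[of h' R T h]) simp_all
qed (use assms in simp)

text \<open>One evaluation theory for two targets: matrices, where it yields representations, and
  the free algebra itself, where evaluation is substitution and yields maps between presented
  algebras.\<close>

locale calg =
  fixes mul :: "'b::ab_group_add \<Rightarrow> 'b \<Rightarrow> 'b" and e :: 'b and sm :: "complex \<Rightarrow> 'b \<Rightarrow> 'b"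
  assumes mul_assoc: "mul (mul x y) z = mul x (mul y z)"
    and mul_left: "mul e x = x" and mul_right: "mul x e = x"
    and mul_add_left: "mul (x + y) z = mul x z + mul y z"
    and mul_add_right: "mul x (y + z) = mul x y + mul x z"
    and sm_add_right: "sm c (x + y) = sm c x + sm c y" and sm_add_left: "sm (c + d) x = sm c x + sm d x"
    and sm_mult: "sm (c * d) x = sm c (sm d x)" and sm_1: "sm 1 x = x"
    and sm_mul_left: "mul (sm c x) y = sm c (mul x y)" and sm_mul_right: "mul x (sm c y) = sm c (mul x y)"
begin

definition mon :: "('g \<Rightarrow> 'b) \<Rightarrow> 'g list \<Rightarrow> 'b" where
  "mon v w = foldr (\<lambda>g m. mul (v g) m) w e"

definition evl :: "('g \<Rightarrow> 'b) \<Rightarrow> 'g ncpoly \<Rightarrow> 'b" where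
  "evl v x = (\<Sum>w\<in>Poly_Mapping.keys x. sm (Poly_Mapping.lookup x w) (mon v w))"

lemma sm_0: "sm 0 x = 0" "sm c 0 = 0"
  using sm_add_left[of 0 0 x] sm_add_right[of c 0 0] by simp_all

lemma sm_commute: "sm c (sm d x) = sm d (sm c x)"
  by (metis mult.commute sm_mult)

lemma mul_0: "mul 0 x = 0" "mul x 0 = 0"
  using mul_add_left[of 0 0 x] mul_add_right[of x 0 0] by simp_all

lemma mon_append: "mon v (w @ w') = mul (mon v w) (mon v w')"
  by (induction w) (auto simp: mon_def mul_left mul_assoc)

lemma evl_superset:
  assumes "finite A" "Poly_Mapping.keys x \<subseteq> A"
  shows "evl v x = (\<Sum>w\<in>A. sm (Poly_Mapping.lookup x w) (mon v w))"
  unfolding evl_def by (rule sum.mono_neutral_left) (use assms in \<open>auto simp: in_keys_iff sm_0\<close>)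

lemma evl_single: "evl v (Poly_Mapping.single w c) = sm c (mon v w)"
  by (subst evl_superset[of "{w}"]) auto

lemma evl_add: "evl v (x + y) = evl v x + evl v y"
proof -
  let ?A = "Poly_Mapping.keys x \<union> Poly_Mapping.keys y"
  have "evl v (x + y) = (\<Sum>w\<in>?A. sm (Poly_Mapping.lookup (x + y) w) (mon v w))"
    by (rule evl_superset) (use Poly_Mapping.keys_add[of x y] in auto)
  then show ?thesis
    by (simp add: evl_superset[of ?A x] evl_superset[of ?A y] lookup_add sm_add_left sum.distrib)
qed

lemma evl_mult: "evl v (x * y) = mul (evl v x) (evl v y)"
proof (induction x rule: ncpoly_induct)
  case (1 w c)
  show ?case
    by (induction y rule: ncpoly_induct)
      (simp_all add: mult_single evl_single plus_list_def mon_append sm_mult sm_mul_left sm_mul_right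
        sm_commute distrib_left evl_add mul_add_right)
next
  case (2 x y)
  then show ?case by (simp add: distrib_right evl_add mul_add_left)
qed

lemma evl_1: "evl v 1 = e"
proof -
  have "evl v 1 = evl v (scal 1)" by (simp add: scal_1)
  then show ?thesis by (simp only: scal_def evl_single) (simp add: mon_def sm_1)
qed

lemma evl_gen: "evl v (gen g) = v g"
  by (simp add: gen_def evl_single mon_def sm_1 mul_right)

lemma evl_scal_const: "evl v (scal c) = sm c e"
  by (simp add: scal_def evl_single mon_def)

lemma evl_diff: "evl v (x - y) = evl v x - evl v y"
  using evl_add[of v "x - y" y] by (simp add: eq_diff_eq)

lemma evl_0: "evl v 0 = 0"
  using evl_diff[of v 0 0] by simp

lemma evl_sum: "evl v (sum f S) = (\<Sum>i\<in>S. evl v (f i))"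
  by (induction S rule: infinite_finite_induct) (auto simp: evl_add evl_0)

end

section \<open>Matrices and the free algebra as targets of evaluation\<close>

definition smat :: "complex \<Rightarrow> complex^'n^'m \<Rightarrow> complex^'n^'m" where
  "smat c M = (\<chi> i j. c * M $ i $ j)"

lemma smat_nth [simp]: "smat c M $ i $ j = c * M $ i $ j"
  by (simp add: smat_def)

lemma smat_mult: "smat c A ** B = smat c (A ** B)" "A ** smat c B = smat c (A ** B)"
  by (simp_all add: vec_eq_iff matrix_matrix_mult_def sum_distrib_left algebra_simps)

interpretation mat: calg "(**)" "mat 1 :: complex^'n^'n" smat
proof
  show "smat c (x + y) = smat c x + smat c y" "smat (c + d) x = smat c x + smat d x"
    "smat (c * d) x = smat c (smat d x)" "smat 1 x = x" for c d and x y :: "complex^'n^'n"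
    by (simp_all add: vec_eq_iff distrib_left distrib_right mult.assoc)
qed (simp_all only: smat_mult matrix_mul_assoc matrix_add_ldistrib mat_add_rdistrib matrix_mul_lid matrix_mul_rid)

interpretation free: calg "(*)" "1 :: 'g ncpoly" "\<lambda>c x. scal c * x"
proof
  show "x * (scal c * y) = scal c * (x * y)" for c and x y :: "'g ncpoly"
    by (metis mult.assoc scal_commute)
qed (simp_all add: distrib_left distrib_right mult.assoc scal_add scal_mult scal_1)

lemma mat_alg_simps:
  "carrier mat_alg = UNIV" "A \<otimes>\<^bsub>mat_alg\<^esub> B = A ** B" "\<one>\<^bsub>mat_alg\<^esub> = mat 1"
  "A \<oplus>\<^bsub>mat_alg\<^esub> B = A + B" "c \<odot>\<^bsub>mat_alg\<^esub> A = smat c A"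
  by (simp_all add: mat_alg_def smat_def)

text \<open>The kernel of the evaluation serves as the ideal \<open>J\<close> of
  \<open>alg_hom_presented_exists\<close>. The definite description \<open>presented_hom\<close>
  thus denotes the induced homomorphism.\<close>

lemma presented_hom_mat:
  fixes v :: "'g \<Rightarrow> complex^'n^'n"
  assumes "\<And>r. r \<in> R \<Longrightarrow> mat.evl v r = 0"
  shows "presented_hom R mat_alg v \<in> alg_hom (presented R) mat_alg"
    and "presented_hom R mat_alg v (cls R x) = mat.evl v x"
proof -
  have "ideal {x. mat.evl v x = 0} free_alg"
    by (rule ideal_free_algI) (auto simp: mat.evl_0 mat.evl_diff mat.evl_mult mat.mul_0)
  then have "\<exists>h \<in> alg_hom (presented R) mat_alg. \<forall>x. h (cls R x) = mat.evl v x"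
    by (rule alg_hom_presented_exists)
      (use assms in \<open>auto simp: mat.evl_diff mat_alg_simps mat.evl_mult mat.evl_add mat.evl_1 mat.evl_scal_const smat_mult\<close>)
  then obtain h where h: "h \<in> alg_hom (presented R) mat_alg" "\<And>x. h (cls R x) = mat.evl v x" by blast
  moreover have "presented_hom R mat_alg v = h"
    using h by (intro presented_hom_eq) (auto simp: pgen_cls mat.evl_gen)
  ultimately show "presented_hom R mat_alg v \<in> alg_hom (presented R) mat_alg"
    "presented_hom R mat_alg v (cls R x) = mat.evl v x" by auto
qed

text \<open>Here the ideal \<open>J\<close> is the preimage of the target's relation ideal under
  substitution.\<close>

lemma presented_hom_presented:
  fixes v :: "'g \<Rightarrow> 'h ncpoly"
  assumes "\<And>r. r \<in> R \<Longrightarrow> cls R' (free.evl v r) = cls R' 0"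
  shows "presented_hom R (presented R') (\<lambda>g. cls R' (v g)) \<in> alg_hom (presented R) (presented R')"
    and "presented_hom R (presented R') (\<lambda>g. cls R' (v g)) (cls R x) = cls R' (free.evl v x)"
proof -
  have "ideal {x. free.evl v x \<in> relideal R'} free_alg"
    by (rule ideal_free_algI) (auto simp: free.evl_0 free.evl_diff free.evl_mult relideal_closed relideal_minus)
  then have "\<exists>h \<in> alg_hom (presented R) (presented R'). \<forall>x. h (cls R x) = cls R' (free.evl v x)"
    by (rule alg_hom_presented_exists)
      (use assms in \<open>auto simp: cls_eq_iff free.evl_diff carrier_presented mult_presented add_presented
        one_presented smult_presented free.evl_mult free.evl_add free.evl_1 free.evl_scal_const relideal_closed(1)\<close>)
  then obtain h where h: "h \<in> alg_hom (presented R) (presented R')" "\<And>x. h (cls R x) = cls R' (free.evl v x)" by blast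
  moreover have "presented_hom R (presented R') (\<lambda>g. cls R' (v g)) = h"
    using h by (intro presented_hom_eq) (auto simp: pgen_cls free.evl_gen)
  ultimately show "presented_hom R (presented R') (\<lambda>g. cls R' (v g)) \<in> alg_hom (presented R) (presented R')"
    "presented_hom R (presented R') (\<lambda>g. cls R' (v g)) (cls R x) = cls R' (free.evl v x)" by auto
qed

section \<open>Matrix representations of the two algebras\<close>

lemma rep_cls:
  assumes "\<rho> \<in> alg_hom (presented R) mat_alg"
  shows "\<rho> (cls R (x * y)) = \<rho> (cls R x) ** \<rho> (cls R y)"
    "\<rho> (cls R (x + y)) = \<rho> (cls R x) + \<rho> (cls R y)"
    "\<rho> (cls R (x - y)) = \<rho> (cls R x) - \<rho> (cls R y)"
    "\<rho> (cls R 0) = 0"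
    "\<rho> (cls R (scal c * x)) = smat c (\<rho> (cls R x))"
    "\<rho> (cls R (sum f S)) = (\<Sum>i\<in>S. \<rho> (cls R (f i)))"
proof -
  note h = alg_hom_presented[OF assms, unfolded mat_alg_simps]
  show "\<rho> (cls R (x * y)) = \<rho> (cls R x) ** \<rho> (cls R y)"
    "\<rho> (cls R (x + y)) = \<rho> (cls R x) + \<rho> (cls R y)"
    "\<rho> (cls R (scal c * x)) = smat c (\<rho> (cls R x))"
    by (rule h)+
  show diff: "\<rho> (cls R (x - y)) = \<rho> (cls R x) - \<rho> (cls R y)" for x y
    using h(3)[of "x - y" y] by simp
  show zero: "\<rho> (cls R 0) = 0" using diff[of 0 0] by simp
  show "\<rho> (cls R (sum f S)) = (\<Sum>i\<in>S. \<rho> (cls R (f i)))"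
    by (induction S rule: infinite_finite_induct) (simp_all add: h(3) zero)
qed

lemma rep_relation:
  assumes "\<rho> \<in> alg_hom (presented R) mat_alg" "r \<in> R"
  shows "\<rho> (cls R r) = 0"
  by (simp add: cls_relation[OF assms(2)] rep_cls(4)[OF assms(1)])

lemma conj_rep_cls: "conj_rep (presented R) g \<rho> (cls R x) = g ** \<rho> (cls R x) ** matrix_inv g"
  by (simp add: conj_rep_def carrier_presented)

lemma conj_rep_pgen: "conj_rep (presented R) g \<rho> (pgen R x) = g ** \<rho> (pgen R x) ** matrix_inv g"
  by (simp add: pgen_cls conj_rep_cls)

lemma conj_rep_hom:
  assumes \<rho>: "\<rho> \<in> alg_hom (presented R) mat_alg" and g: "invertible g"
  shows "conj_rep (presented R) g \<rho> \<in> alg_hom (presented R) mat_alg"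
proof (rule alg_hom_presentedI)
  show "conj_rep (presented R) g \<rho> \<in> extensional (range (cls R))"
    by (simp add: conj_rep_def carrier_presented)
  show "conj_rep (presented R) g \<rho> (cls R (scal c * x)) = c \<odot>\<^bsub>mat_alg\<^esub> conj_rep (presented R) g \<rho> (cls R x)" for c x
    by (simp only: mat_alg_simps conj_rep_cls rep_cls(5)[OF \<rho>] smat_mult)
qed (simp_all only: mat_alg_simps conj_rep_cls rep_cls[OF \<rho>] conj_mult[OF g] matrix_add_ldistrib mat_add_rdistrib
      smat_mult UNIV_I alg_hom_presented(4)[OF \<rho>, unfolded mat_alg_simps] matrix_mul_rid matrix_inv_mult[OF g])

lemma rels_A_mem:
  "gen (Aq j) * gen (Aq j) - gen (Aq j) \<in> rels_A l" "gen AP * gen AP - gen AP \<in> rels_A l"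
  "i \<noteq> j \<Longrightarrow> gen (Aq i) * gen (Aq j) \<in> rels_A l"
  "gen (Aq j) * gen AP * gen (Aq j) - scal (l j) * gen (Aq j) \<in> rels_A l"
  by (auto simp: rels_A_def)

lemma rels_B_mem:
  "gen (Bp s) * gen (Bp s) - gen (Bp s) \<in> rels_B lam" "gen (Bq j) * gen (Bq j) - gen (Bq j) \<in> rels_B lam"
  "s \<noteq> t \<Longrightarrow> gen (Bp s) * gen (Bp t) \<in> rels_B lam" "i \<noteq> j \<Longrightarrow> gen (Bq i) * gen (Bq j) \<in> rels_B lam"
  "gen (Bp s) * gen (Bq j) * gen (Bp s) - scal (lam s j) * gen (Bp s) \<in> rels_B lam"
  "gen (Bq j) * gen (Bp s) * gen (Bq j) - scal (lam s j) * gen (Bq j) \<in> rels_B lam"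
  by (auto simp: rels_B_def)

definition rel_A :: "('n \<Rightarrow> complex) \<Rightarrow> ('n \<Rightarrow> complex^'n^'n) \<Rightarrow> complex^'n^'n \<Rightarrow> bool" where
  "rel_A l q P \<longleftrightarrow> (\<forall>i j. q i ** q j = (if i = j then q j else 0)) \<and> P ** P = P \<and>
    (\<forall>j. q j ** P ** q j = smat (l j) (q j))"

definition rel_B :: "('k \<Rightarrow> 'n \<Rightarrow> complex) \<Rightarrow> ('n \<Rightarrow> complex^'n^'n) \<Rightarrow> ('k \<Rightarrow> complex^'n^'n) \<Rightarrow> bool" where
  "rel_B lam q p \<longleftrightarrow> (\<forall>i j. q i ** q j = (if i = j then q j else 0)) \<and>
    (\<forall>s t. p s ** p t = (if s = t then p s else 0)) \<and>
    (\<forall>s j. q j ** p s ** q j = smat (lam s j) (q j)) \<and> (\<forall>s j. p s ** q j ** p s = smat (lam s j) (p s))"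

lemma hom_A_rel:
  assumes "\<rho> \<in> alg_hom (alg_A l) mat_alg"
  shows "rel_A l (\<lambda>j. \<rho> (pgen (rels_A l) (Aq j))) (\<rho> (pgen (rels_A l) AP))"
proof -
  have \<rho>: "\<rho> \<in> alg_hom (presented (rels_A l)) mat_alg" using assms by (simp add: alg_A_def)
  note z = rep_relation[OF \<rho>] and r = rep_cls[OF \<rho>]
  have "\<rho> (cls (rels_A l) (gen (Aq i) * gen (Aq j)))
      = (if i = j then \<rho> (cls (rels_A l) (gen (Aq j))) else 0)" for i j
  proof (cases "i = j")
    case True
    then show ?thesis using z[OF rels_A_mem(1)[of j]] by (simp add: r)
  next
    case False
    then show ?thesis using z[OF rels_A_mem(3)] by simp
  qed
  moreover have "\<rho> (cls (rels_A l) (gen AP * gen AP)) = \<rho> (cls (rels_A l) (gen AP))"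
    using z[OF rels_A_mem(2)] by (simp only: r(3) right_minus_eq)
  moreover have "\<rho> (cls (rels_A l) (gen (Aq j) * gen AP * gen (Aq j)))
      = smat (l j) (\<rho> (cls (rels_A l) (gen (Aq j))))" for j
    using z[OF rels_A_mem(4)] by (simp only: r(3) r(5) right_minus_eq)
  ultimately show ?thesis
    unfolding rel_A_def pgen_cls r(1)[symmetric] by auto
qed

lemma hom_B_rel:
  assumes "\<rho> \<in> alg_hom (alg_B lam) mat_alg"
  shows "rel_B lam (\<lambda>j. \<rho> (pgen (rels_B lam) (Bq j))) (\<lambda>s. \<rho> (pgen (rels_B lam) (Bp s)))"
proof -
  have \<rho>: "\<rho> \<in> alg_hom (presented (rels_B lam)) mat_alg" using assms by (simp add: alg_B_def)
  note z = rep_relation[OF \<rho>] and r = rep_cls[OF \<rho>]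
  have "\<rho> (cls (rels_B lam) (gen (Bq i) * gen (Bq j)))
      = (if i = j then \<rho> (cls (rels_B lam) (gen (Bq j))) else 0)" for i j
  proof (cases "i = j")
    case True
    then show ?thesis using z[OF rels_B_mem(2)[of j]] by (simp add: r)
  next
    case False
    then show ?thesis using z[OF rels_B_mem(4)] by simp
  qed
  moreover have "\<rho> (cls (rels_B lam) (gen (Bp s) * gen (Bp t)))
      = (if s = t then \<rho> (cls (rels_B lam) (gen (Bp s))) else 0)" for s t
  proof (cases "s = t")
    case True
    then show ?thesis using z[OF rels_B_mem(1)[of s]] by (simp add: r)
  next
    case False
    then show ?thesis using z[OF rels_B_mem(3)] by simp
  qed
  moreover have "\<rho> (cls (rels_B lam) (gen (Bq j) * gen (Bp s) * gen (Bq j)))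
      = smat (lam s j) (\<rho> (cls (rels_B lam) (gen (Bq j))))" for j s
    using z[OF rels_B_mem(6)] by (simp only: r(3) r(5) right_minus_eq)
  moreover have "\<rho> (cls (rels_B lam) (gen (Bp s) * gen (Bq j) * gen (Bp s)))
      = smat (lam s j) (\<rho> (cls (rels_B lam) (gen (Bp s))))" for j s
    using z[OF rels_B_mem(5)] by (simp only: r(3) r(5) right_minus_eq)
  ultimately show ?thesis
    unfolding rel_B_def pgen_cls r(1)[symmetric] by auto
qed

lemma rel_A_hom:
  fixes q :: "'n::finite \<Rightarrow> complex^'n^'n"
  assumes "rel_A l q P"
  defines "\<rho> \<equiv> presented_hom (rels_A l) mat_alg (\<lambda>g. case g of Aq j \<Rightarrow> q j | AP \<Rightarrow> P)"
  shows "\<rho> \<in> alg_hom (alg_A l) mat_alg" "\<rho> (pgen (rels_A l) (Aq j)) = q j" "\<rho> (pgen (rels_A l) AP) = P"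
proof -
  let ?v = "\<lambda>g. case g of Aq j \<Rightarrow> q j | AP \<Rightarrow> P"
  have "mat.evl ?v r = 0" if "r \<in> rels_A l" for r
    using that assms(1) unfolding rels_A_def rel_A_def
    by (elim UnE) (auto simp: mat.evl_diff mat.evl_mult mat.evl_gen mat.evl_scal_const smat_mult)
  note * = presented_hom_mat[of "rels_A l" ?v, OF this]
  show "\<rho> \<in> alg_hom (alg_A l) mat_alg" using *(1) by (simp add: \<rho>_def alg_A_def)
  show "\<rho> (pgen (rels_A l) (Aq j)) = q j" "\<rho> (pgen (rels_A l) AP) = P"
    by (simp_all add: \<rho>_def pgen_cls *(2) mat.evl_gen)
qed

lemma rank_eq_one_nonzero: "rank (A :: complex^'n^'n) = 1 \<Longrightarrow> A \<noteq> 0"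
proof
  assume "rank A = 1" "A = 0"
  then have "of_nat (rank (0 :: complex^'n^'n)) = (1::complex)" by simp
  then show False using rank_idempotent[of "0 :: complex^'n^'n"] by (simp add: mat_zero_left trace_def)
qed

section \<open>Conjugation, normal forms and restriction of representations\<close>

lemma reps_A_D:
  assumes "\<rho> \<in> reps_A k l"
  shows "\<rho> \<in> alg_hom (presented (rels_A l)) mat_alg"
    "rel_A l (\<lambda>j. \<rho> (pgen (rels_A l) (Aq j))) (\<rho> (pgen (rels_A l) AP))"
    "rank (\<rho> (pgen (rels_A l) (Aq j))) = 1" "rank (\<rho> (pgen (rels_A l) AP)) = k"
  using assms hom_A_rel[of \<rho> l] by (auto simp: reps_A_def alg_A_def)

lemma reps_B_D:
  assumes "\<rho> \<in> reps_B lam"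
  shows "\<rho> \<in> alg_hom (presented (rels_B lam)) mat_alg"
    "rel_B lam (\<lambda>j. \<rho> (pgen (rels_B lam) (Bq j))) (\<lambda>s. \<rho> (pgen (rels_B lam) (Bp s)))"
    "rank (\<rho> (pgen (rels_B lam) g)) = 1"
  using assms hom_B_rel[of \<rho> lam] by (auto simp: reps_B_def alg_B_def)

lemma conj_reps_A:
  assumes \<rho>: "\<rho> \<in> reps_A k l" and g: "invertible g"
  shows "conj_rep (presented (rels_A l)) g \<rho> \<in> reps_A k l"
proof -
  note D = reps_A_D[OF \<rho>]
  have "rank (g ** \<rho> (pgen (rels_A l) (Aq j)) ** matrix_inv g) = 1" for j
    using D(2) D(3)[of j] by (subst rank_conj[OF _ g]) (auto simp: rel_A_def)
  moreover have "rank (g ** \<rho> (pgen (rels_A l) AP) ** matrix_inv g) = k"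
    using D(2) D(4) by (subst rank_conj[OF _ g]) (auto simp: rel_A_def)
  ultimately show ?thesis
    using conj_rep_hom[OF D(1) g] by (simp add: reps_A_def alg_A_def conj_rep_pgen)
qed

lemma conj_reps_B:
  assumes \<rho>: "\<rho> \<in> reps_B lam" and g: "invertible g"
  shows "conj_rep (presented (rels_B lam)) g \<rho> \<in> reps_B lam"
proof -
  note D = reps_B_D[OF \<rho>]
  have "\<rho> (pgen (rels_B lam) x) ** \<rho> (pgen (rels_B lam) x) = \<rho> (pgen (rels_B lam) x)" for x
    using D(2) by (cases x) (auto simp: rel_B_def)
  then have "rank (g ** \<rho> (pgen (rels_B lam) x) ** matrix_inv g) = 1" for x
    using D(3)[of x] by (subst rank_conj[OF _ g]) auto
  then show ?thesis
    using conj_rep_hom[OF D(1) g] by (simp add: reps_B_def alg_B_def conj_rep_pgen)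
qed

lemma level_rep:
  fixes M :: "complex^'n^'n"
  assumes M: "M \<in> level_set k l"
  shows "level_rep l M \<in> reps_A k l" "level_rep l M (pgen (rels_A l) (Aq j)) = munit j"
    "level_rep l M (pgen (rels_A l) AP) = M"
proof -
  have idem: "M ** M = M" and rk: "rank M = k" and diag: "M $ j $ j = l j" for j
    using M by (auto simp: level_set_def projector_orbit_def moment_map_def)
  have "munit j ** M ** munit j = smat (l j) (munit j)" for j
    by (simp add: vec_eq_iff munit_mult_nth mult_munit_nth) (auto simp: munit_def diag)
  then have rel: "rel_A l munit M" by (simp add: rel_A_def munit_mult_munit idem)
  have eq: "level_rep l M = presented_hom (rels_A l) mat_alg (\<lambda>g. case g of Aq j \<Rightarrow> munit j | AP \<Rightarrow> M)"
    unfolding level_rep_def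
    by (rule arg_cong[where f = "presented_hom _ _"]) (auto simp: munit_def fun_eq_iff split: gen_A.split)
  note * = rel_A_hom[OF rel, folded eq]
  show "level_rep l M (pgen (rels_A l) (Aq j)) = munit j" "level_rep l M (pgen (rels_A l) AP) = M"
    by (rule *)+
  show "level_rep l M \<in> reps_A k l" using *(1) by (simp add: reps_A_def * rank_munit rk)
qed

text \<open>Once the \<open>q j\<close> are matrix units, the relation for \<open>q j\<close>,
  \<open>P\<close>, \<open>q j\<close> prescribes exactly the diagonal of \<open>P\<close>. This
  identifies conjugacy classes of admissible representations with torus classes in the moment
  level.\<close>

lemma conj_rep_level:
  assumes \<rho>: "\<rho> \<in> reps_A k l" and g: "invertible g"
    and diag: "\<And>j. g ** \<rho> (pgen (rels_A l) (Aq j)) ** matrix_inv g = munit j"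
  defines "M \<equiv> g ** \<rho> (pgen (rels_A l) AP) ** matrix_inv g"
  shows "M \<in> level_set k l" "conj_rep (presented (rels_A l)) g \<rho> = level_rep l M"
proof -
  let ?c = "conj_rep (presented (rels_A l)) g \<rho>"
  note c = conj_reps_A[OF \<rho> g]
  have M: "?c (pgen (rels_A l) AP) = M" and q: "?c (pgen (rels_A l) (Aq j)) = munit j" for j
    by (simp_all add: conj_rep_pgen M_def diag)
  have rel: "rel_A l munit M" using reps_A_D(2)[OF c] by (simp add: M q)
  have "M $ j $ j = l j" for j
  proof -
    have "(munit j ** M ** munit j) $ j $ j = smat (l j) (munit j) $ j $ j"
      using rel by (simp add: rel_A_def)
    then show ?thesis by (simp add: munit_mult_nth mult_munit_nth) (simp add: munit_def)
  qed
  then show lev: "M \<in> level_set k l"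
    using rel reps_A_D(4)[OF c] by (auto simp: level_set_def projector_orbit_def moment_map_def M rel_A_def)
  show "?c = level_rep l M"
  proof (rule alg_hom_presented_eqI)
    show "?c \<in> alg_hom (presented (rels_A l)) mat_alg" by (rule reps_A_D(1)[OF c])
    show "level_rep l M \<in> alg_hom (presented (rels_A l)) mat_alg"
      by (rule reps_A_D(1)[OF level_rep(1)[OF lev]])
    show "?c (pgen (rels_A l) x) = level_rep l M (pgen (rels_A l) x)" for x
      by (cases x) (simp_all add: M q level_rep[OF lev])
  qed
qed

lemma dmat_conj_munit:
  assumes "\<And>i. c i \<noteq> 0"
  shows "dmat c ** munit j ** matrix_inv (dmat c) = munit j"
  using assms by (auto simp: vec_eq_iff dmat_conj_nth munit_def)

lemma reps_A_diagonalizable: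
  assumes \<rho>: "\<rho> \<in> reps_A k l"
  obtains g where "invertible g" "\<And>j. g ** \<rho> (pgen (rels_A l) (Aq j)) ** matrix_inv g = munit j"
proof (rule idempotents_diagonalizable)
  show "\<rho> (pgen (rels_A l) (Aq i)) ** \<rho> (pgen (rels_A l) (Aq j))
      = (if i = j then \<rho> (pgen (rels_A l) (Aq j)) else 0)" for i j
    using reps_A_D(2)[OF \<rho>] by (simp add: rel_A_def)
  show "\<rho> (pgen (rels_A l) (Aq j)) \<noteq> 0" for j
    using rank_eq_one_nonzero reps_A_D(3)[OF \<rho>] by blast
qed (rule that)

lemma relideal_sum: "(\<And>i. i \<in> S \<Longrightarrow> f i \<in> relideal R) \<Longrightarrow> sum f S \<in> relideal R"
  by (induction S rule: infinite_finite_induct) (auto simp: relideal_closed)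

text \<open>This certifies that the definite description \<open>psi\<close> denotes a homomorphism.
  That \<open>l\<close> consists of the column sums of \<open>lam\<close> is what makes the relation
  between \<open>q j\<close> and \<open>P\<close> hold in the target.\<close>

lemma psi_cls:
  fixes lam :: "'k::finite \<Rightarrow> 'n::finite \<Rightarrow> complex"
  assumes l: "\<And>j. l j = (\<Sum>i\<in>UNIV. lam i j)"
  shows "psi lam l \<in> alg_hom (presented (rels_A l)) (presented (rels_B lam))"
    "psi lam l (pgen (rels_A l) (Aq j)) = pgen (rels_B lam) (Bq j)"
    "psi lam l (pgen (rels_A l) AP) = cls (rels_B lam) (\<Sum>i\<in>UNIV. gen (Bp i))"
proof -
  define v :: "'n gen_A \<Rightarrow> ('k, 'n) gen_B ncpoly"
    where "v g = (case g of Aq j \<Rightarrow> gen (Bq j) | AP \<Rightarrow> \<Sum>i\<in>UNIV. gen (Bp i))" for g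
  have psi: "psi lam l = presented_hom (rels_A l) (presented (rels_B lam)) (\<lambda>g. cls (rels_B lam) (v g))"
    unfolding psi_def alg_B_def
    by (rule arg_cong[where f = "presented_hom _ _"])
      (auto simp: v_def pgen_cls finsum_presented fun_eq_iff split: gen_A.split)
  have scal_sum: "scal (sum f S) = (\<Sum>i\<in>S. scal (f i))" for f :: "'k \<Rightarrow> complex" and S
    by (induction S rule: infinite_finite_induct) (simp_all add: scal_add, simp_all add: scal_def)
  have rel: "free.evl v r \<in> relideal (rels_B lam)" if "r \<in> rels_A l" for r
  proof -
    consider j where "r = gen (Aq j) * gen (Aq j) - gen (Aq j)" | "r = gen AP * gen AP - gen AP"
      | i j where "i \<noteq> j" "r = gen (Aq i) * gen (Aq j)"
      | j where "r = gen (Aq j) * gen AP * gen (Aq j) - scal (l j) * gen (Aq j)"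
      using \<open>r \<in> rels_A l\<close> unfolding rels_A_def by (elim UnE CollectE exE conjE singletonE)
    then show ?thesis
    proof cases
      case 1
      then have "free.evl v r \<in> rels_B lam"
        using rels_B_mem by (simp add: free.evl_diff free.evl_mult free.evl_gen v_def)
      then show ?thesis using relideal_subset by blast
    next
      case 2
      \<comment> \<open>The idempotency relation of the sum is written as a double sum of
        idempotency and orthogonality relations.\<close>
      have "free.evl v r = (\<Sum>i\<in>UNIV. \<Sum>j\<in>UNIV. gen (Bp i) * gen (Bp j) - (if i = j then gen (Bp i) else 0))"
        by (simp add: 2 free.evl_diff free.evl_mult free.evl_gen v_def sum_distrib_left sum_distrib_right sum_subtractf)
          (rule sum.swap)
      moreover have "gen (Bp i) * gen (Bp j) - (if i = j then gen (Bp i) else 0) \<in> relideal (rels_B lam)" for i j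
        by (rule subsetD[OF relideal_subset]) (simp add: rels_B_mem)
      ultimately show ?thesis by (simp add: relideal_sum)
    next
      case 3
      then have "free.evl v r \<in> rels_B lam"
        using rels_B_mem by (simp add: free.evl_mult free.evl_gen v_def)
      then show ?thesis using relideal_subset by blast
    next
      case 4
      have "free.evl v r = (\<Sum>i\<in>UNIV. gen (Bq j) * gen (Bp i) * gen (Bq j) - scal (lam i j) * gen (Bq j))"
        by (simp add: 4 free.evl_diff free.evl_mult free.evl_gen free.evl_sum free.evl_scal_const v_def l scal_sum
            sum_distrib_left sum_distrib_right sum_subtractf)
      moreover have "gen (Bq j) * gen (Bp i) * gen (Bq j) - scal (lam i j) * gen (Bq j) \<in> relideal (rels_B lam)" for i
        by (rule subsetD[OF relideal_subset]) (simp add: rels_B_mem)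
      ultimately show ?thesis by (simp add: relideal_sum)
    qed
  qed
  have "cls (rels_B lam) (free.evl v r) = cls (rels_B lam) 0" if "r \<in> rels_A l" for r
    using rel[OF that] by (simp add: cls_eq_iff)
  note * = presented_hom_presented[of "rels_A l" "rels_B lam" v, OF this, folded psi]
  show "psi lam l \<in> alg_hom (presented (rels_A l)) (presented (rels_B lam))" by (rule *(1))
  show "psi lam l (pgen (rels_A l) (Aq j)) = pgen (rels_B lam) (Bq j)"
    "psi lam l (pgen (rels_A l) AP) = cls (rels_B lam) (\<Sum>i\<in>UNIV. gen (Bp i))"
    by (simp_all add: pgen_cls *(2) free.evl_gen v_def)
qed

text \<open>The rank condition on \<open>P\<close> holds because the \<open>p i\<close> are
  orthogonal of rank 1. The last claim, equivariance under conjugation, makes restriction descend to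
  the GIT quotients.\<close>

lemma restrict_rep:
  fixes lam :: "'k::finite \<Rightarrow> 'n::finite \<Rightarrow> complex"
  assumes l: "\<And>j. l j = (\<Sum>i\<in>UNIV. lam i j)" and \<rho>: "\<rho> \<in> reps_B lam"
  defines "\<sigma> \<equiv> compose (carrier (alg_A l)) \<rho> (psi lam l)"
  shows "\<sigma> \<in> reps_A CARD('k) l"
    "\<sigma> (pgen (rels_A l) (Aq j)) = \<rho> (pgen (rels_B lam) (Bq j))"
    "\<sigma> (pgen (rels_A l) AP) = (\<Sum>i\<in>UNIV. \<rho> (pgen (rels_B lam) (Bp i)))"
    "invertible g \<Longrightarrow> compose (carrier (alg_A l)) (conj_rep (presented (rels_B lam)) g \<rho>) (psi lam l)
      = conj_rep (presented (rels_A l)) g \<sigma>"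
proof -
  note D = reps_B_D[OF \<rho>] and psi = psi_cls[of l lam, OF l]
  note P = alg_hom_presented[OF psi(1)] and r = alg_hom_presented[OF D(1), unfolded mat_alg_simps]
  have \<sigma>: "\<sigma> (cls (rels_A l) x) = \<rho> (psi lam l (cls (rels_A l) x))" for x
    by (simp add: \<sigma>_def compose_def alg_A_def carrier_presented)
  have psi_range: "\<exists>z. psi lam l (cls (rels_A l) x) = cls (rels_B lam) z" for x
    using P(1)[of x] by (auto simp: carrier_presented)
  have hom: "\<sigma> \<in> alg_hom (presented (rels_A l)) mat_alg"
  proof (rule alg_hom_presentedI)
    show "\<sigma> \<in> extensional (range (cls (rels_A l)))"
      by (simp add: \<sigma>_def alg_A_def carrier_presented compose_def)
  next
    fix x y c
    obtain z w where zw: "psi lam l (cls (rels_A l) x) = cls (rels_B lam) z" "psi lam l (cls (rels_A l) y) = cls (rels_B lam) w"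
      using psi_range by blast
    show "\<sigma> (cls (rels_A l) (x * y)) = \<sigma> (cls (rels_A l) x) \<otimes>\<^bsub>mat_alg\<^esub> \<sigma> (cls (rels_A l) y)"
      by (simp only: \<sigma> P zw mult_presented r mat_alg_simps)
    show "\<sigma> (cls (rels_A l) (x + y)) = \<sigma> (cls (rels_A l) x) \<oplus>\<^bsub>mat_alg\<^esub> \<sigma> (cls (rels_A l) y)"
      by (simp only: \<sigma> P zw add_presented r mat_alg_simps)
    show "\<sigma> (cls (rels_A l) (scal c * x)) = c \<odot>\<^bsub>mat_alg\<^esub> \<sigma> (cls (rels_A l) x)"
      by (simp only: \<sigma> P(5) zw smult_presented r(5) mat_alg_simps)
  qed (simp_all only: \<sigma> P one_presented r mat_alg_simps UNIV_I)
  show q: "\<sigma> (pgen (rels_A l) (Aq j)) = \<rho> (pgen (rels_B lam) (Bq j))" for j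
    using psi(2)[of j] by (simp add: \<sigma> pgen_cls)
  show p: "\<sigma> (pgen (rels_A l) AP) = (\<Sum>i\<in>UNIV. \<rho> (pgen (rels_B lam) (Bp i)))"
    using psi(3) by (simp add: \<sigma> pgen_cls rep_cls(6)[OF D(1)])
  have "rank (\<Sum>i\<in>UNIV. \<rho> (pgen (rels_B lam) (Bp i))) = CARD('k)"
    by (rule rank_sum_idempotents(2)) (use D(2,3) in \<open>auto simp: rel_B_def\<close>)
  then show "\<sigma> \<in> reps_A CARD('k) l"
    using hom D(3) by (simp add: reps_A_def alg_A_def q p)
  show "compose (carrier (alg_A l)) (conj_rep (presented (rels_B lam)) g \<rho>) (psi lam l)
      = conj_rep (presented (rels_A l)) g \<sigma>" if "invertible g"
  proof
    fix X
    show "compose (carrier (alg_A l)) (conj_rep (presented (rels_B lam)) g \<rho>) (psi lam l) X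
      = conj_rep (presented (rels_A l)) g \<sigma> X"
      using P(1) by (auto simp: compose_def alg_A_def conj_rep_def carrier_presented \<sigma>)
  qed
qed

section \<open>Points and tangent vectors of function algebras\<close>

locale fun_subalgebra =
  fixes X :: "'x set" and F :: "('x \<Rightarrow> complex) set"
  assumes const_mem: "(\<lambda>x\<in>X. c) \<in> F"
    and add_mem: "f \<in> F \<Longrightarrow> g \<in> F \<Longrightarrow> (\<lambda>x\<in>X. f x + g x) \<in> F"
    and mult_mem: "f \<in> F \<Longrightarrow> g \<in> F \<Longrightarrow> (\<lambda>x\<in>X. f x * g x) \<in> F"
begin

text \<open>Regularity of a function that may take any values off \<open>X\<close>. Formulas can
  then be written without restrictions, which are applied only when a point or a derivation is
  evaluated.\<close>

definition reg :: "('x \<Rightarrow> complex) \<Rightarrow> bool" where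
  "reg f \<longleftrightarrow> restrict f X \<in> F"

lemma reg_const: "reg (\<lambda>x. c)"
  by (simp add: reg_def const_mem)

lemma reg_add: "reg f \<Longrightarrow> reg g \<Longrightarrow> reg (\<lambda>x. f x + g x)"
  unfolding reg_def by (drule (1) add_mem) (simp cong: restrict_cong)

lemma reg_mult: "reg f \<Longrightarrow> reg g \<Longrightarrow> reg (\<lambda>x. f x * g x)"
  unfolding reg_def by (drule (1) mult_mem) (simp cong: restrict_cong)

lemma reg_diff: "reg f \<Longrightarrow> reg g \<Longrightarrow> reg (\<lambda>x. f x - g x)"
  using reg_add[OF _ reg_mult[OF reg_const[of "-1"]], of f g] by simp

lemma reg_sum: "(\<And>i. i \<in> S \<Longrightarrow> reg (f i)) \<Longrightarrow> reg (\<lambda>x. \<Sum>i\<in>S. f i x)"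
  by (induction S rule: infinite_finite_induct) (simp_all add: reg_const reg_add)

lemma reg_prod: "(\<And>i. i \<in> S \<Longrightarrow> reg (f i)) \<Longrightarrow> reg (\<lambda>x. \<Prod>i\<in>S. f i x)"
  by (induction S rule: infinite_finite_induct) (simp_all add: reg_const reg_mult)

lemmas reg_intros = reg_const reg_add reg_mult reg_diff reg_sum reg_prod

end

text \<open>A point with a tangent vector, in effect a homomorphism to the dual numbers with
  components \<open>val\<close> and \<open>der\<close>. The point is an arbitrary character and need
  not be evaluation at an element of \<open>X\<close>.\<close>

locale jet = fun_subalgebra X F for X :: "'x set" and F +
  fixes x D
  assumes x: "x \<in> points (fun_alg X F)" and D: "D \<in> tangent (fun_alg X F) x"
begin

definition val :: "('x \<Rightarrow> complex) \<Rightarrow> complex" where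
  "val f = x (restrict f X)"

definition der :: "('x \<Rightarrow> complex) \<Rightarrow> complex" where
  "der f = D (restrict f X)"

lemma val_cong: "(\<And>p. p \<in> X \<Longrightarrow> f p = g p) \<Longrightarrow> val f = val g"
  and der_cong: "(\<And>p. p \<in> X \<Longrightarrow> f p = g p) \<Longrightarrow> der f = der g"
  by (simp_all add: val_def der_def cong: restrict_cong)

lemma x_hom:
  assumes "f \<in> F" "g \<in> F"
  shows "x (\<lambda>p\<in>X. f p + g p) = x f + x g" "x (\<lambda>p\<in>X. f p * g p) = x f * x g"
    "x (\<lambda>p\<in>X. c * f p) = c * x f" "x (\<lambda>p\<in>X. 1) = 1"
  using x assms by (auto simp: points_def alg_hom_def ring_hom_def fun_alg_def complex_alg_def)

lemma D_hom:
  assumes "f \<in> F" "g \<in> F"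
  shows "D (\<lambda>p\<in>X. f p + g p) = D f + D g" "D (\<lambda>p\<in>X. f p * g p) = x f * D g + x g * D f"
    "D (\<lambda>p\<in>X. c * f p) = c * D f"
  using D assms by (auto simp: tangent_def fun_alg_def)

lemma val_add: "reg f \<Longrightarrow> reg g \<Longrightarrow> val (\<lambda>p. f p + g p) = val f + val g"
  using x_hom(1)[of "restrict f X" "restrict g X"] by (simp add: reg_def val_def cong: restrict_cong)

lemma val_mult: "reg f \<Longrightarrow> reg g \<Longrightarrow> val (\<lambda>p. f p * g p) = val f * val g"
  using x_hom(2)[of "restrict f X" "restrict g X"] by (simp add: reg_def val_def cong: restrict_cong)

lemma val_cmult: "reg f \<Longrightarrow> val (\<lambda>p. c * f p) = c * val f"
  using x_hom(3)[of "restrict f X" "restrict f X" c] by (simp add: reg_def val_def cong: restrict_cong)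

lemma val_const: "val (\<lambda>p. c) = c"
  using val_cmult[of "\<lambda>p. 1" c] x_hom(4)[OF const_mem const_mem] by (simp add: reg_const val_def)

lemma val_sum: "(\<And>i. i \<in> S \<Longrightarrow> reg (f i)) \<Longrightarrow> val (\<lambda>p. \<Sum>i\<in>S. f i p) = (\<Sum>i\<in>S. val (f i))"
  by (induction S rule: infinite_finite_induct) (simp_all add: val_const val_add reg_sum)

lemma der_add: "reg f \<Longrightarrow> reg g \<Longrightarrow> der (\<lambda>p. f p + g p) = der f + der g"
  using D_hom(1)[of "restrict f X" "restrict g X"] by (simp add: reg_def der_def cong: restrict_cong)

lemma der_mult: "reg f \<Longrightarrow> reg g \<Longrightarrow> der (\<lambda>p. f p * g p) = val f * der g + val g * der f"
  using D_hom(2)[of "restrict f X" "restrict g X"] by (simp add: reg_def der_def val_def cong: restrict_cong)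

lemma der_cmult: "reg f \<Longrightarrow> der (\<lambda>p. c * f p) = c * der f"
  using D_hom(3)[of "restrict f X" "restrict f X" c] by (simp add: reg_def der_def cong: restrict_cong)

lemma der_const: "der (\<lambda>p. c) = 0"
  using der_mult[OF reg_const reg_const, of 1 1] der_cmult[OF reg_const, of c 1] by (simp add: val_const)

lemma val_diff: "reg f \<Longrightarrow> reg g \<Longrightarrow> val (\<lambda>p. f p - g p) = val f - val g"
  using val_add[OF _ reg_mult[OF reg_const[of "-1"]], of f g] val_cmult[of g "-1"] by simp

lemma der_diff: "reg f \<Longrightarrow> reg g \<Longrightarrow> der (\<lambda>p. f p - g p) = der f - der g"
  using der_add[OF _ reg_mult[OF reg_const[of "-1"]], of f g] der_cmult[of g "-1"] by simp

lemma der_sum: "(\<And>i. i \<in> S \<Longrightarrow> reg (f i)) \<Longrightarrow> der (\<lambda>p. \<Sum>i\<in>S. f i p) = (\<Sum>i\<in>S. der (f i))"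
  by (induction S rule: infinite_finite_induct) (simp_all add: der_const der_add reg_sum)

text \<open>The product of \<open>h\<close> and \<open>f\<close> is zero on all of \<open>X\<close>.
  Applying the character and then the Leibniz rule to it, one can divide by the nonzero number
  \<open>val h\<close>.\<close>

lemma vanishing:
  assumes "reg h" "val h \<noteq> 0" "reg f" "\<And>p. p \<in> X \<Longrightarrow> h p \<noteq> 0 \<Longrightarrow> f p = 0"
  shows "val f = 0" "der f = 0"
proof -
  have hf: "h p * f p = 0" if "p \<in> X" for p using assms(4)[OF that] by auto
  show f: "val f = 0"
    using val_cong[OF hf] val_mult[OF assms(1,3)] assms(2) by (simp add: val_const)
  show "der f = 0"
    using der_cong[OF hf] der_mult[OF assms(1,3)] assms(2) f by (simp add: der_const)
qed

text \<open>An identity that holds only on the open set where \<open>h\<close> is nonzero may be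
  evaluated and differentiated at any character with \<open>val h\<close> nonzero. This replaces
  lifting the point to an element of \<open>X\<close>.\<close>

lemma localize:
  assumes "reg h" "val h \<noteq> 0" "reg f" "reg g" "\<And>p. p \<in> X \<Longrightarrow> h p \<noteq> 0 \<Longrightarrow> f p = g p"
  shows "val f = val g" "der f = der g"
  using vanishing[OF assms(1,2) reg_diff[OF assms(3,4)]] assms(5)
  by (simp_all add: val_diff der_diff assms)

end

section \<open>Invariant regular functions on spaces of representations\<close>

lemma fun_subalgebra_polyfuns: "fun_subalgebra X (polyfuns X S)"
  by unfold_locales (auto intro: polyfuns.intros)

lemma fun_subalgebra_invariants:
  assumes "fun_subalgebra X F" "\<And>g x. g \<in> G \<Longrightarrow> x \<in> X \<Longrightarrow> act g x \<in> X"
  shows "fun_subalgebra X {f \<in> F. \<forall>g\<in>G. \<forall>x\<in>X. f (act g x) = f x}"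
proof -
  interpret fun_subalgebra X F by fact
  show ?thesis by unfold_locales (auto simp: assms(2) const_mem add_mem mult_mem)
qed

definition inv_funs :: "'g ncpoly set \<Rightarrow> ('g ncpoly set \<Rightarrow> complex^'n^'n) set
    \<Rightarrow> (('g ncpoly set \<Rightarrow> complex^'n^'n) \<Rightarrow> complex) set" where
  "inv_funs R X = {f \<in> rep_funs R X. \<forall>g\<in>{h. invertible h}. \<forall>\<rho>\<in>X. f (conj_rep (presented R) g \<rho>) = f \<rho>}"

lemma moduli_eq: "moduli R X = fun_alg X (inv_funs R X)"
  by (simp add: moduli_def git_quotient_def inv_funs_def)

locale rep_space =
  fixes R :: "'g ncpoly set" and X :: "('g ncpoly set \<Rightarrow> complex^'n^'n) set"
  assumes closed: "\<rho> \<in> X \<Longrightarrow> invertible g \<Longrightarrow> conj_rep (presented R) g \<rho> \<in> X"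
begin

sublocale rf: fun_subalgebra X "rep_funs R X"
  unfolding rep_funs_def by (rule fun_subalgebra_polyfuns)

sublocale fun_subalgebra X "inv_funs R X"
  unfolding inv_funs_def
  by (rule fun_subalgebra_invariants[OF rf.fun_subalgebra_axioms]) (simp add: closed)

text \<open>Equivariant polynomial maps to matrices. They are closed under products and sums and
  contain the generators, and their traces supply the invariants needed here.\<close>

definition cov :: "(('g ncpoly set \<Rightarrow> complex^'n^'n) \<Rightarrow> complex^'n^'n) \<Rightarrow> bool" where
  "cov Z \<longleftrightarrow> (\<forall>a b. rf.reg (\<lambda>\<rho>. Z \<rho> $ a $ b)) \<and>
    (\<forall>g \<rho>. invertible g \<longrightarrow> \<rho> \<in> X \<longrightarrow> Z (conj_rep (presented R) g \<rho>) = g ** Z \<rho> ** matrix_inv g)"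

lemma cov_gen: "cov (\<lambda>\<rho>. \<rho> (pgen R x))"
  unfolding cov_def rf.reg_def
  by (auto simp: conj_rep_pgen rep_funs_def intro!: polyfuns.coord)

lemma cov_mat_1: "cov (\<lambda>\<rho>. mat 1)"
  by (simp add: cov_def rf.reg_const matrix_inv_mult)

lemma cov_mult: "cov Y \<Longrightarrow> cov Z \<Longrightarrow> cov (\<lambda>\<rho>. Y \<rho> ** Z \<rho>)"
  unfolding cov_def by (auto simp: conj_mult matrix_matrix_mult_def[of "Y _"] intro!: rf.reg_intros)

lemma cov_sum:
  assumes "\<And>i. i \<in> S \<Longrightarrow> cov (Z i)"
  shows "cov (\<lambda>\<rho>. \<Sum>i\<in>S. Z i \<rho>)"
  using assms unfolding cov_def by (auto simp: mat_sum_left mat_sum_right intro!: rf.reg_sum)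

lemma cov_word:
  assumes "\<And>j. cov (Q j)" "cov P"
  shows "cov (\<lambda>\<rho>. word_mat (\<lambda>j. Q j \<rho>) (P \<rho>) ws)"
proof (induction ws)
  case Nil
  then show ?case by (simp add: cov_mat_1)
next
  case (Cons x ws)
  then show ?case using assms by (cases x) (simp_all add: cov_mult)
qed

lemma reg_trace: "cov Z \<Longrightarrow> reg (\<lambda>\<rho>. trace (Z \<rho>))"
proof -
  assume Z: "cov Z"
  have "rf.reg (\<lambda>\<rho>. trace (Z \<rho>))"
    using Z unfolding cov_def trace_def by (intro rf.reg_sum) auto
  then show ?thesis
    using Z unfolding reg_def rf.reg_def cov_def by (auto simp: inv_funs_def closed trace_conj)
qed

end

context gauge
begin

lemma reg_gauge:
  assumes "rep_space R X" "\<And>j. rep_space.cov R X (Q j)" "rep_space.cov R X P" "rep_space.cov R X p"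
  shows "fun_subalgebra.reg X (inv_funs R X) (\<lambda>\<rho>. gnum (\<lambda>j. Q j \<rho>) (P \<rho>) (p \<rho>) a b)"
    and "fun_subalgebra.reg X (inv_funs R X) (\<lambda>\<rho>. gden (\<lambda>j. Q j \<rho>) (P \<rho>))"
proof -
  interpret rep_space R X by fact
  show "reg (\<lambda>\<rho>. gnum (\<lambda>j. Q j \<rho>) (P \<rho>) (p \<rho>) a b)" "reg (\<lambda>\<rho>. gden (\<lambda>j. Q j \<rho>) (P \<rho>))"
    unfolding gnum_def gden_def num_def den_def
    by (intro reg_intros reg_trace cov_mult cov_word assms)+
qed

end

section \<open>Gauge-fixing invariants on the moduli spaces\<close>

lemma polyfuns_extensional: "f \<in> polyfuns X S \<Longrightarrow> f \<in> extensional X"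
  by (induction rule: polyfuns.induct) (auto simp: extensional_def)

lemma inv_funs_extensional: "f \<in> inv_funs R X \<Longrightarrow> f \<in> extensional X"
  by (auto simp: inv_funs_def rep_funs_def dest: polyfuns_extensional)

lemma inv_funs_conj:
  "f \<in> inv_funs R X \<Longrightarrow> invertible g \<Longrightarrow> \<rho> \<in> X \<Longrightarrow> f (conj_rep (presented R) g \<rho>) = f \<rho>"
  by (simp add: inv_funs_def)

interpretation repA: rep_space "rels_A l" "reps_A k l" for k and l :: "'n::finite \<Rightarrow> complex"
  by unfold_locales (rule conj_reps_A)

interpretation repB: rep_space "rels_B lam" "reps_B lam" for lam :: "'k::finite \<Rightarrow> 'n::finite \<Rightarrow> complex"
  by unfold_locales (rule conj_reps_B)

definition level_funs :: "nat \<Rightarrow> ('n \<Rightarrow> complex) \<Rightarrow> (complex^'n^'n \<Rightarrow> complex) set" where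
  "level_funs k l = polyfuns (level_set k l) {s. \<exists>i j. s = (\<lambda>M. M $ i $ j)}"

lemma level_alg_eq: "level_alg k l = fun_alg (level_set k l) (level_funs k l)"
  by (simp add: level_alg_def level_funs_def)

lemma carrier_level_alg: "carrier (level_alg k l) = level_funs k l"
  by (simp add: level_alg_eq fun_alg_def)

interpretation lev: fun_subalgebra "level_set k l" "level_funs k l" for k and l :: "'n::finite \<Rightarrow> complex"
  unfolding level_funs_def by (rule fun_subalgebra_polyfuns)

lemma reg_level_coord: "lev.reg k l (\<lambda>M. M $ i $ j)"
  unfolding lev.reg_def by (simp only: level_funs_def) (rule polyfuns.coord, auto)

text \<open>The weights are not torus invariant, so they do not live on the moduli space, but they
  are polynomials on the level set and derivations there apply to them.\<close>

lemma reg_level_word: "lev.reg k l (\<lambda>M. word_mat munit M ws $ a $ b)"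
proof (induction ws arbitrary: a)
  case Nil
  then show ?case by (simp add: lev.reg_const)
next
  case (Cons x ws)
  show ?case
  proof (cases x)
    case (Aq j)
    then show ?thesis using Cons by (cases "a = j") (simp_all add: munit_mult_nth lev.reg_const)
  next
    case AP
    then have "word_mat munit M (x # ws) $ a $ b = (\<Sum>c\<in>UNIV. M $ a $ c * word_mat munit M ws $ c $ b)" for M
      by (simp add: matrix_matrix_mult_def)
    then show ?thesis by (simp only:) (intro lev.reg_intros reg_level_coord Cons)
  qed
qed

text \<open>On the representations \<open>level_rep l M\<close> each coordinate function is either a
  constant or an entry of \<open>M\<close>; the rest is induction over polynomials.\<close>

lemma level_comorphism_mem:
  assumes "f \<in> inv_funs (rels_A l) (reps_A k l)"
  shows "(\<lambda>M\<in>level_set k l. f (level_rep l M)) \<in> level_funs k l"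
proof -
  have "f \<in> rep_funs (rels_A l) (reps_A k l)" using assms by (simp add: inv_funs_def)
  then have "lev.reg k l (\<lambda>M. f (level_rep l M))"
    unfolding rep_funs_def
  proof induction
    case (const c)
    have "(\<lambda>M\<in>level_set k l. (\<lambda>\<rho>\<in>reps_A k l. c) (level_rep l M)) = (\<lambda>M\<in>level_set k l. c)"
      by (rule restrict_ext) (simp add: level_rep(1))
    then show ?case by (simp only: lev.reg_def lev.const_mem)
  next
    case (coord s)
    then obtain g i j where s: "s = (\<lambda>\<rho>. \<rho> (pgen (rels_A l) g) $ i $ j)" by blast
    have "\<exists>t. lev.reg k l t \<and> (\<forall>M\<in>level_set k l. s (level_rep l M) = t M)"
    proof (cases g)
      case (Aq a)
      then show ?thesis
        by (intro exI[of _ "\<lambda>M. munit a $ i $ j"]) (simp add: s level_rep lev.reg_const)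
    next
      case AP
      then show ?thesis
        by (intro exI[of _ "\<lambda>M. M $ i $ j"]) (simp add: s level_rep reg_level_coord)
    qed
    then obtain t where t: "lev.reg k l t" "\<And>M. M \<in> level_set k l \<Longrightarrow> s (level_rep l M) = t M" by blast
    have "(\<lambda>M\<in>level_set k l. (\<lambda>\<rho>\<in>reps_A k l. s \<rho>) (level_rep l M)) = restrict t (level_set k l)"
      by (rule restrict_ext) (simp add: level_rep(1) t(2))
    then show ?case using t(1) by (simp only: lev.reg_def)
  next
    case (add f g)
    have "(\<lambda>M\<in>level_set k l. (\<lambda>\<rho>\<in>reps_A k l. f \<rho> + g \<rho>) (level_rep l M))
        = (\<lambda>M\<in>level_set k l. f (level_rep l M) + g (level_rep l M))"
      by (rule restrict_ext) (simp add: level_rep(1))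
    then show ?case using lev.reg_add[OF add.IH] by (simp only: lev.reg_def)
  next
    case (mult f g)
    have "(\<lambda>M\<in>level_set k l. (\<lambda>\<rho>\<in>reps_A k l. f \<rho> * g \<rho>) (level_rep l M))
        = (\<lambda>M\<in>level_set k l. f (level_rep l M) * g (level_rep l M))"
      by (rule restrict_ext) (simp add: level_rep(1))
    then show ?case using lev.reg_mult[OF mult.IH] by (simp only: lev.reg_def)
  qed
  then show ?thesis by (simp only: lev.reg_def)
qed

definition restr :: "('k::finite \<Rightarrow> 'n::finite \<Rightarrow> complex) \<Rightarrow> ('n \<Rightarrow> complex)
    \<Rightarrow> (('k, 'n) gen_B ncpoly set \<Rightarrow> complex^'n^'n) \<Rightarrow> ('n gen_A ncpoly set \<Rightarrow> complex^'n^'n)" where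
  "restr lam l \<rho> = compose (carrier (alg_A l)) \<rho> (psi lam l)"

text \<open>Polynomiality follows by induction because the restricted \<open>P\<close> is a sum of
  generators; invariance follows from the equivariance of restriction.\<close>

lemma Psi_mem:
  fixes lam :: "'k::finite \<Rightarrow> 'n::finite \<Rightarrow> complex"
  assumes l: "\<And>j. l j = (\<Sum>i\<in>UNIV. lam i j)"
    and f: "f \<in> inv_funs (rels_A l) (reps_A CARD('k) l)"
  shows "(\<lambda>\<rho>\<in>reps_B lam. f (restr lam l \<rho>)) \<in> inv_funs (rels_B lam) (reps_B lam)"
proof -
  note res = restrict_rep[of l lam, OF l, folded restr_def]
  have "f \<in> rep_funs (rels_A l) (reps_A CARD('k) l)" using f by (simp add: inv_funs_def)
  then have "repB.rf.reg lam (\<lambda>\<rho>. f (restr lam l \<rho>))"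
    unfolding rep_funs_def[of "rels_A l"]
  proof induction
    case (const c)
    have "(\<lambda>\<rho>\<in>reps_B lam. (\<lambda>\<sigma>\<in>reps_A CARD('k) l. c) (restr lam l \<rho>)) = (\<lambda>\<rho>\<in>reps_B lam. c)"
      by (rule restrict_ext) (simp add: res(1))
    then show ?case by (simp only: repB.rf.reg_def repB.rf.const_mem)
  next
    case (coord s)
    then obtain g i j where s: "s = (\<lambda>\<rho>. \<rho> (pgen (rels_A l) g) $ i $ j)" by blast
    have gen: "repB.rf.reg lam (\<lambda>\<rho>. \<rho> (pgen (rels_B lam) x) $ i $ j)" for x
      using repB.cov_gen[of lam x] by (simp add: repB.cov_def)
    have "\<exists>t. repB.rf.reg lam t \<and> (\<forall>\<rho>\<in>reps_B lam. s (restr lam l \<rho>) = t \<rho>)"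
    proof (cases g)
      case (Aq a)
      then show ?thesis
        by (intro exI[of _ "\<lambda>\<rho>. \<rho> (pgen (rels_B lam) (Bq a)) $ i $ j"]) (simp add: s res gen)
    next
      case AP
      then show ?thesis
        by (intro exI[of _ "\<lambda>\<rho>. \<Sum>t\<in>UNIV. \<rho> (pgen (rels_B lam) (Bp t)) $ i $ j"])
          (simp add: s res gen repB.rf.reg_sum)
    qed
    then obtain t where t: "repB.rf.reg lam t" "\<And>\<rho>. \<rho> \<in> reps_B lam \<Longrightarrow> s (restr lam l \<rho>) = t \<rho>" by blast
    have "(\<lambda>\<rho>\<in>reps_B lam. (\<lambda>\<rho>\<in>reps_A CARD('k) l. s \<rho>) (restr lam l \<rho>)) = restrict t (reps_B lam)"
      by (rule restrict_ext) (simp add: res(1) t(2))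
    then show ?case using t(1) by (simp only: repB.rf.reg_def)
  next
    case (add f g)
    have "(\<lambda>\<rho>\<in>reps_B lam. (\<lambda>\<rho>\<in>reps_A CARD('k) l. f \<rho> + g \<rho>) (restr lam l \<rho>))
        = (\<lambda>\<rho>\<in>reps_B lam. f (restr lam l \<rho>) + g (restr lam l \<rho>))"
      by (rule restrict_ext) (simp add: res(1))
    then show ?case using repB.rf.reg_add[OF add.IH] by (simp only: repB.rf.reg_def)
  next
    case (mult f g)
    have "(\<lambda>\<rho>\<in>reps_B lam. (\<lambda>\<rho>\<in>reps_A CARD('k) l. f \<rho> * g \<rho>) (restr lam l \<rho>))
        = (\<lambda>\<rho>\<in>reps_B lam. f (restr lam l \<rho>) * g (restr lam l \<rho>))"
      by (rule restrict_ext) (simp add: res(1))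
    then show ?case using repB.rf.reg_mult[OF mult.IH] by (simp only: repB.rf.reg_def)
  qed
  moreover have "f (restr lam l (conj_rep (presented (rels_B lam)) g \<rho>)) = f (restr lam l \<rho>)"
    if "invertible g" "\<rho> \<in> reps_B lam" for g \<rho>
    using res(4)[OF that(2,1)] inv_funs_conj[OF f that(1) res(1)[OF that(2)]] by (simp add: restr_def)
  ultimately show ?thesis
    unfolding repB.rf.reg_def by (auto simp: inv_funs_def[of "rels_B lam"] conj_reps_B)
qed

context gauge
begin

definition GA :: "('n \<Rightarrow> complex) \<Rightarrow> 'n \<Rightarrow> 'n \<Rightarrow> ('n gen_A ncpoly set \<Rightarrow> complex^'n^'n) \<Rightarrow> complex" where
  "GA l a b \<rho> = gnum (\<lambda>j. \<rho> (pgen (rels_A l) (Aq j))) (\<rho> (pgen (rels_A l) AP)) (\<rho> (pgen (rels_A l) AP)) a b"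

definition HA :: "('n \<Rightarrow> complex) \<Rightarrow> ('n gen_A ncpoly set \<Rightarrow> complex^'n^'n) \<Rightarrow> complex" where
  "HA l \<rho> = gden (\<lambda>j. \<rho> (pgen (rels_A l) (Aq j))) (\<rho> (pgen (rels_A l) AP))"

text \<open>The words are evaluated at the sum of all \<open>p t\<close>, as for the restricted
  representation, while the entry is that of a single \<open>p s\<close>. Summing over
  \<open>s\<close> recovers the pull-back of \<open>GA\<close>.\<close>

definition GB :: "('k::finite \<Rightarrow> 'n \<Rightarrow> complex) \<Rightarrow> 'k \<Rightarrow> 'n \<Rightarrow> 'n
    \<Rightarrow> (('k, 'n) gen_B ncpoly set \<Rightarrow> complex^'n^'n) \<Rightarrow> complex" where
  "GB lam s a b \<rho> = gnum (\<lambda>j. \<rho> (pgen (rels_B lam) (Bq j)))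
     (\<Sum>t\<in>UNIV. \<rho> (pgen (rels_B lam) (Bp t))) (\<rho> (pgen (rels_B lam) (Bp s))) a b"

definition HB :: "('k::finite \<Rightarrow> 'n \<Rightarrow> complex) \<Rightarrow> (('k, 'n) gen_B ncpoly set \<Rightarrow> complex^'n^'n) \<Rightarrow> complex" where
  "HB lam \<rho> = gden (\<lambda>j. \<rho> (pgen (rels_B lam) (Bq j))) (\<Sum>t\<in>UNIV. \<rho> (pgen (rels_B lam) (Bp t)))"

lemma reg_GA: "repA.reg k l (GA l a b)" and reg_HA: "repA.reg k l (HA l)"
  using reg_gauge[OF repA.rep_space_axioms[of l k] repA.cov_gen repA.cov_gen repA.cov_gen]
  by (simp_all add: GA_def[abs_def] HA_def[abs_def])

lemma reg_GB: "repB.reg lam (GB lam s a b)" and reg_HB: "repB.reg lam (HB lam)"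
  using reg_gauge[OF repB.rep_space_axioms[of lam] repB.cov_gen repB.cov_sum[OF repB.cov_gen] repB.cov_gen]
  by (simp_all add: GB_def[abs_def] HB_def[abs_def])

lemma level_GA: "M \<in> level_set k l \<Longrightarrow> GA l a b (level_rep l M) = gnum munit M M a b"
  and level_HA: "M \<in> level_set k l \<Longrightarrow> HA l (level_rep l M) = gden munit M"
  by (simp_all add: GA_def HA_def level_rep)

lemma restr_GA_HA:
  fixes lam :: "'k::finite \<Rightarrow> 'n::finite \<Rightarrow> complex"
  assumes l: "\<And>j. l j = (\<Sum>i\<in>UNIV. lam i j)" and \<rho>: "\<rho> \<in> reps_B lam"
  shows "GA l a b (restr lam l \<rho>) = (\<Sum>s\<in>UNIV. GB lam s a b \<rho>)" "HA l (restr lam l \<rho>) = HB lam \<rho>"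
  using restrict_rep(2,3)[of l lam, OF l \<rho>]
  by (simp_all add: GA_def GB_def HA_def HB_def gnum_sum restr_def)

text \<open>The invariants of a representation determine a matrix in its own class wherever
  \<open>HA\<close> is nonzero. The free weights \<open>c\<close> undo the normalization up to a
  torus element, so that this section can be made to pass through a prescribed matrix.\<close>

lemma GA_normal_form:
  assumes \<rho>: "\<rho> \<in> reps_A k l" and h: "HA l \<rho> \<noteq> 0" and c: "\<And>a. c a \<noteq> 0"
  defines "N \<equiv> \<chi> a b. GA l a b \<rho> * c b / (c a * HA l \<rho>)"
  shows "N \<in> level_set k l" "\<exists>g. invertible g \<and> conj_rep (presented (rels_A l)) g \<rho> = level_rep l N"
proof -
  obtain g where g: "invertible g" "\<And>j. g ** \<rho> (pgen (rels_A l) (Aq j)) ** matrix_inv g = munit j"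
    using reps_A_diagonalizable[OF \<rho>] by blast
  define M where "M = g ** \<rho> (pgen (rels_A l) AP) ** matrix_inv g"
  have hM: "HA l \<rho> = gden munit M"
    unfolding HA_def by (subst gden_conj[OF g(1), symmetric]) (simp only: g(2) M_def[symmetric])
  have gM: "GA l a b \<rho> = gnum munit M M a b" for a b
    unfolding GA_def by (subst gnum_conj[OF g(1), symmetric]) (simp only: g(2) M_def[symmetric])
  define d where "d a = wt M a / c a" for a
  have d: "d a \<noteq> 0" for a using wt_nonzero[of M a] h c by (simp add: hM d_def)
  have wt: "wt M a \<noteq> 0" for a using wt_nonzero h by (simp add: hM)
  define T where "T = dmat d ** g"
  have T: "invertible T" unfolding T_def by (rule invertible_mult[OF matrix_inv_dmat(2)[OF d] g(1)])
  have conjT: "T ** A ** matrix_inv T = dmat d ** (g ** A ** matrix_inv g) ** matrix_inv (dmat d)" for A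
    unfolding T_def matrix_inv_prod[OF matrix_inv_dmat(2)[OF d] g(1)] by (simp add: matrix_mul_assoc)
  have diag: "T ** \<rho> (pgen (rels_A l) (Aq j)) ** matrix_inv T = munit j" for j
    unfolding conjT g(2) by (rule dmat_conj_munit[OF d])
  have "T ** \<rho> (pgen (rels_A l) AP) ** matrix_inv T = N"
  proof -
    have "d a * M $ a $ b / d b = GA l a b \<rho> * c b / (c a * HA l \<rho>)" for a b
      using gnum_munit[of M M a b] wt[of a] wt[of b] c[of a] c[of b] h
      by (simp add: gM hM d_def field_simps)
    then show ?thesis unfolding conjT M_def[symmetric] by (simp add: vec_eq_iff dmat_conj_nth d N_def)
  qed
  then show "N \<in> level_set k l" "\<exists>g. invertible g \<and> conj_rep (presented (rels_A l)) g \<rho> = level_rep l N"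
    using conj_rep_level[OF \<rho> T diag] T by auto
qed

text \<open>The same diagonal gauge is applied to all \<open>p s\<close> at once, so the ratios of
  \<open>GB\<close> by \<open>HB\<close> form matrices that satisfy the relations with
  \<open>q j\<close> equal to \<open>munit j\<close>.\<close>

lemma GB_normal_form:
  assumes \<rho>: "\<rho> \<in> reps_B lam" and h: "HB lam \<rho> \<noteq> 0"
  obtains N where "rel_B lam munit N" "\<And>s a b. GB lam s a b \<rho> = N s $ a $ b * HB lam \<rho>"
proof -
  let ?q = "\<lambda>j. \<rho> (pgen (rels_B lam) (Bq j))" and ?p = "\<lambda>s. \<rho> (pgen (rels_B lam) (Bp s))"
  have rel: "rel_B lam ?q ?p" by (rule reps_B_D(2)[OF \<rho>])
  have qq: "?q i ** ?q j = (if i = j then ?q j else 0)" for i j using rel by (simp add: rel_B_def)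
  have q0: "?q j \<noteq> 0" for j using rank_eq_one_nonzero reps_B_D(3)[OF \<rho>] by blast
  obtain g where g: "invertible g" "\<And>j. g ** ?q j ** matrix_inv g = munit j"
    using idempotents_diagonalizable[of ?q, OF qq q0] by blast
  define M where "M = g ** (\<Sum>t\<in>UNIV. ?p t) ** matrix_inv g"
  have hM: "HB lam \<rho> = gden munit M"
    unfolding HB_def by (subst gden_conj[OF g(1), symmetric]) (simp only: g(2) M_def[symmetric])
  have gM: "GB lam s a b \<rho> = gnum munit M (g ** ?p s ** matrix_inv g) a b" for s a b
    unfolding GB_def by (subst gnum_conj[OF g(1), symmetric]) (simp only: g(2) M_def[symmetric])
  have d: "wt M a \<noteq> 0" for a using wt_nonzero h by (simp add: hM)
  define T where "T = dmat (wt M) ** g"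
  have T: "invertible T" unfolding T_def by (rule invertible_mult[OF matrix_inv_dmat(2)[OF d] g(1)])
  have conjT: "T ** A ** matrix_inv T = dmat (wt M) ** (g ** A ** matrix_inv g) ** matrix_inv (dmat (wt M))" for A
    unfolding T_def matrix_inv_prod[OF matrix_inv_dmat(2)[OF d] g(1)] by (simp add: matrix_mul_assoc)
  have diag: "T ** ?q j ** matrix_inv T = munit j" for j
    unfolding conjT g(2) by (rule dmat_conj_munit[OF d])
  have "rel_B lam (\<lambda>j. T ** ?q j ** matrix_inv T) (\<lambda>s. T ** ?p s ** matrix_inv T)"
    using rel unfolding rel_B_def conj_mult[OF T] by (auto simp: mat_zero_left mat_zero_right smat_mult)
  then have "rel_B lam munit (\<lambda>s. T ** ?p s ** matrix_inv T)" unfolding diag .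
  moreover have "GB lam s a b \<rho> = (T ** ?p s ** matrix_inv T) $ a $ b * HB lam \<rho>" for s a b
    unfolding conjT gM hM using h by (intro gnum_munit_div) (simp add: hM)
  ultimately show thesis by (rule that)
qed

end

section \<open>Lifts of tangent vectors\<close>

lemma (in fun_subalgebra) cmult_mem: "f \<in> F \<Longrightarrow> (\<lambda>x\<in>X. c * f x) \<in> F"
  using mult_mem[OF const_mem[of c]] by (simp cong: restrict_cong)

lemma (in fun_subalgebra) eval_at_points:
  assumes "p \<in> X"
  shows "eval_at (fun_alg X F) p \<in> points (fun_alg X F)"
  using assms const_mem add_mem mult_mem cmult_mem
  by (auto simp: points_def alg_hom_def ring_hom_def fun_alg_def complex_alg_def eval_at_def)

lemma (in fun_subalgebra) eval_at_restrict:
  "p \<in> X \<Longrightarrow> reg f \<Longrightarrow> eval_at (fun_alg X F) p (restrict f X) = f p"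
  by (simp add: eval_at_def reg_def fun_alg_def)

lemma moduli_A_eq: "moduli_A k l = fun_alg (reps_A k l) (inv_funs (rels_A l) (reps_A k l))"
  by (simp add: moduli_A_def moduli_eq)

lemma moduli_B_eq: "moduli_B lam = fun_alg (reps_B lam) (inv_funs (rels_B lam) (reps_B lam))"
  by (simp add: moduli_B_def moduli_eq)

text \<open>Moment map property: a torus direction pairs with a tangent vector through the diagonal
  of the latter, which is zero along the level set.\<close>

lemma trace_commutator_dmat:
  assumes "\<And>i. (Y ** M - M ** Y) $ i $ i = 0"
  shows "trace (M ** (dmat c ** Y - Y ** dmat c)) = 0" "trace (M ** (Y ** dmat c - dmat c ** Y)) = 0"
proof -
  have "(M ** Y - Y ** M) $ i $ i = 0" for i using assms[of i] by simp
  then have "trace ((M ** Y - Y ** M) ** dmat c) = 0"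
    by (simp only: trace_def mult_dmat_nth) simp
  then show "trace (M ** (Y ** dmat c - dmat c ** Y)) = 0" by (simp only: trace_commutator_left)
  then show "trace (M ** (dmat c ** Y - Y ** dmat c)) = 0"
    by (simp add: mat_diff_ldistrib trace_sub)
qed

lemma dmat_commute: "dmat c ** dmat d = dmat d ** dmat c"
  by (simp add: vec_eq_iff dmat_mult_nth) (auto simp: dmat_def)

text \<open>Torus directions added to both generators do not change the form: the mixed terms vanish
  by the moment map property, and diagonal matrices commute.\<close>

lemma kks_eq_0:
  assumes A: "A = (X + dmat c) ** M - M ** (X + dmat c)" and B: "B = (Y + dmat d) ** M - M ** (Y + dmat d)"
    and dX: "\<And>i. (X ** M - M ** X) $ i $ i = 0" and dY: "\<And>i. (Y ** M - M ** Y) $ i $ i = 0"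
    and XY: "trace (M ** (X ** Y - Y ** X)) = 0"
  shows "kks M A B = 0"
proof -
  have "(X + dmat c) ** (Y + dmat d) - (Y + dmat d) ** (X + dmat c)
      = (X ** Y - Y ** X) + (X ** dmat d - dmat d ** X) + (dmat c ** Y - Y ** dmat c)"
    by (simp add: matrix_add_ldistrib mat_add_rdistrib dmat_commute[of c d])
  then show ?thesis
    using trace_commutator_dmat[OF dX] trace_commutator_dmat[OF dY] XY
    by (simp add: kks_commutator[OF A B] matrix_add_ldistrib trace_add)
qed

text \<open>This carries the vanishing from the gauge-fixed matrix \<open>N\<close> to any torus
  conjugate \<open>M\<close> and to tangent vectors known only up to torus directions.\<close>

lemma kks_gauge:
  assumes w: "\<And>i. w i \<noteq> 0" and M: "M = dmat w ** N ** matrix_inv (dmat w)"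
    and U: "U = X ** N - N ** X" and V: "V = Y ** N - N ** Y"
    and dU: "\<And>i. U $ i $ i = 0" and dV: "\<And>i. V $ i $ i = 0"
    and XY: "trace (N ** (X ** Y - Y ** X)) = 0"
    and A: "A = dmat w ** U ** matrix_inv (dmat w) + (dmat c ** M - M ** dmat c)"
    and B: "B = dmat w ** V ** matrix_inv (dmat w) + (dmat d ** M - M ** dmat d)"
  shows "kks M A B = 0"
proof -
  define cj where "cj Z = dmat w ** Z ** matrix_inv (dmat w)" for Z
  have g: "invertible (dmat w)" by (rule matrix_inv_dmat(2)[OF w])
  have cj_mult: "cj Z ** cj Z' = cj (Z ** Z')" for Z Z' by (simp add: cj_def conj_mult[OF g])
  have cj_diff: "cj Z - cj Z' = cj (Z - Z')" for Z Z'
    by (simp add: cj_def mat_diff_ldistrib mat_diff_rdistrib)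
  have cj_diag: "cj Z $ i $ i = Z $ i $ i" for Z i using w[of i] by (simp add: cj_def dmat_conj_nth[OF w])
  have M': "M = cj N" by (simp add: M cj_def)
  show ?thesis
  proof (rule kks_eq_0)
    show "A = (cj X + dmat c) ** M - M ** (cj X + dmat c)"
      unfolding A U cj_def[symmetric] M'
      by (simp add: matrix_add_ldistrib mat_add_rdistrib cj_mult flip: cj_diff)
    show "B = (cj Y + dmat d) ** M - M ** (cj Y + dmat d)"
      unfolding B V cj_def[symmetric] M'
      by (simp add: matrix_add_ldistrib mat_add_rdistrib cj_mult flip: cj_diff)
    show "(cj X ** M - M ** cj X) $ i $ i = 0" for i
      using dU[of i] by (simp only: M' cj_mult cj_diff cj_diag U)
    show "(cj Y ** M - M ** cj Y) $ i $ i = 0" for i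
      using dV[of i] by (simp only: M' cj_mult cj_diff cj_diag V)
    show "trace (M ** (cj X ** cj Y - cj Y ** cj X)) = 0"
      using XY trace_conj[OF g] by (simp only: M' cj_mult cj_diff) (simp add: cj_def)
  qed
qed

context gauge
begin

text \<open>The ratios \<open>GA / HA\<close> form a local section of the quotient by the torus, so a derivation of the
  invariants extends to the level set by differentiating \<open>F \<circ> N\<close>; written as a fraction
  \<open>G / H\<close> of invariants, it is differentiated by the quotient rule.\<close>

lemma lift_exists:
  fixes M :: "complex^'n^'n"
  assumes M: "M \<in> level_set k l" and h: "gden munit M \<noteq> 0"
    and D: "D \<in> tangent (moduli_A k l) (eval_at (moduli_A k l) (level_rep l M))"
  shows "\<exists>a \<in> tangent (level_alg k l) (eval_at (level_alg k l) M).
    push (moduli_A k l) (level_comorphism k l) a = D"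
proof -
  define L where "L = level_rep l M"
  have L: "L \<in> reps_A k l" by (simp add: L_def level_rep(1)[OF M])
  interpret J: jet "reps_A k l" "inv_funs (rels_A l) (reps_A k l)" "eval_at (moduli_A k l) L" D
    by unfold_locales (use D repA.eval_at_points[OF L] in \<open>simp_all add: moduli_A_eq L_def\<close>)
  have val: "J.val f = f L" if "repA.reg k l f" for f
    using repA.eval_at_restrict[OF L that] unfolding J.val_def unfolding moduli_A_eq .
  \<comment> \<open>With these weights the section \<open>N\<close> takes the value \<open>M\<close>
    at the representation \<open>L\<close> of \<open>M\<close>.\<close>
  define c where "c = wt M"
  have c: "c a \<noteq> 0" for a using wt_nonzero[OF h] by (simp add: c_def)
  have HL: "HA l L \<noteq> 0" using h by (simp add: L_def level_HA[OF M])
  define N where "N \<rho> = (\<chi> a b. GA l a b \<rho> * c b / (c a * HA l \<rho>))" for \<rho>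
  have N: "N \<rho> \<in> level_set k l" "\<exists>g. invertible g \<and> conj_rep (presented (rels_A l)) g \<rho> = level_rep l (N \<rho>)"
    if "\<rho> \<in> reps_A k l" "HA l \<rho> \<noteq> 0" for \<rho>
    using GA_normal_form[OF that c] by (simp_all add: N_def)
  have NL: "N L = M"
  proof -
    have "GA l a b L * c b / (c a * HA l L) = M $ a $ b" for a b
      using gnum_munit[of M M a b] c[of a] h by (simp add: L_def level_GA[OF M] level_HA[OF M] c_def field_simps)
    then show ?thesis by (simp add: vec_eq_iff N_def)
  qed
  \<comment> \<open>\<open>rp f G H\<close> says that \<open>f\<close> composed with the section is
    the fraction of the invariants \<open>G\<close> and \<open>H\<close> wherever \<open>HA\<close>
    is nonzero, with \<open>H\<close> invertible at \<open>L\<close>.\<close>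
  define rp where "rp f G H \<longleftrightarrow> repA.reg k l G \<and> repA.reg k l H \<and> H L \<noteq> 0 \<and>
    (\<forall>\<rho>\<in>reps_A k l. HA l \<rho> \<noteq> 0 \<longrightarrow> G \<rho> = H \<rho> * f (N \<rho>))" for f G H
  \<comment> \<open>The quotient rule at \<open>L\<close>, where the fraction itself has the value
    \<open>f M\<close>.\<close>
  define dv where "dv f G H = (J.der G - f M * J.der H) / H L" for f :: "complex^'n^'n \<Rightarrow> complex" and G H
  have GL: "G L = H L * f M" if "rp f G H" for f G H
    using that L HL NL by (auto simp: rp_def)
  \<comment> \<open>Two fractions for the same function agree after cross-multiplication on the set
    where \<open>HA\<close> is nonzero, and \<open>J.localize\<close> differentiates that
    equation.\<close>
  have dv_unique: "dv f G H = dv f G' H'" if r: "rp f G H" "rp f G' H'" for f G H G' H'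
  proof -
    note reg = r[unfolded rp_def]
    have "J.der (\<lambda>\<rho>. G \<rho> * H' \<rho>) = J.der (\<lambda>\<rho>. G' \<rho> * H \<rho>)"
      by (rule J.localize(2)[OF reg_HA]) (use reg HL in \<open>auto simp: val[OF reg_HA] intro!: repA.reg_mult\<close>)
    then have "G L * J.der H' + H' L * J.der G = G' L * J.der H + H L * J.der G'"
      using reg by (simp add: J.der_mult val)
    then show ?thesis
      using reg by (simp add: GL[OF r(1)] GL[OF r(2)] dv_def field_simps)
  qed
  have rp_add: "rp (\<lambda>x\<in>level_set k l. f x + f' x) (\<lambda>\<rho>. G \<rho> * H' \<rho> + G' \<rho> * H \<rho>) (\<lambda>\<rho>. H \<rho> * H' \<rho>)"
    and rp_mult: "rp (\<lambda>x\<in>level_set k l. f x * f' x) (\<lambda>\<rho>. G \<rho> * G' \<rho>) (\<lambda>\<rho>. H \<rho> * H' \<rho>)"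
    if "rp f G H" "rp f' G' H'" for f G H f' G' H'
    using that N(1) by (auto simp: rp_def algebra_simps intro!: repA.reg_intros)
  have rp_const: "rp (\<lambda>x\<in>level_set k l. z) (\<lambda>\<rho>. z) (\<lambda>\<rho>. 1)" for z
    using N(1) by (auto simp: rp_def intro!: repA.reg_intros)
  have ex: "\<exists>G H. rp f G H" if "f \<in> level_funs k l" for f
    using that unfolding level_funs_def
  proof induction
    case (coord s)
    then obtain i j where s: "s = (\<lambda>M. M $ i $ j)" by blast
    have "rp (\<lambda>x\<in>level_set k l. s x) (\<lambda>\<rho>. GA l i j \<rho> * c j) (\<lambda>\<rho>. c i * HA l \<rho>)"
      using N(1) HL c[of i] unfolding rp_def
      by (auto simp: s N_def intro!: repA.reg_mult repA.reg_const reg_GA reg_HA)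
    then show ?case by blast
  qed (use rp_const rp_add rp_mult in blast)+
  define a where "a = (\<lambda>f\<in>level_funs k l. SOME r. \<exists>G H. rp f G H \<and> r = dv f G H)"
  have a_eq: "a f = dv f G H" if "f \<in> level_funs k l" "rp f G H" for f G H
  proof -
    have "\<exists>G H. rp f G H \<and> (SOME r. \<exists>G H. rp f G H \<and> r = dv f G H) = dv f G H"
      by (rule someI_ex) (use that(2) in blast)
    then show ?thesis using dv_unique[OF that(2)] that(1) by (auto simp: a_def)
  qed
  have evM: "eval_at (level_alg k l) M f = f M" if "f \<in> level_funs k l" for f
    using that by (simp add: eval_at_def carrier_level_alg)
  have hom: "a (\<lambda>x\<in>level_set k l. f x + g x) = a f + a g" "a (\<lambda>x\<in>level_set k l. f x * g x) = f M * a g + g M * a f"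
    "a (\<lambda>x\<in>level_set k l. z * f x) = z * a f"
    if f: "f \<in> level_funs k l" and g: "g \<in> level_funs k l" for f g z
  proof -
    obtain G H G' H' where r: "rp f G H" "rp g G' H'" using ex[OF f] ex[OF g] by blast
    note reg = r[unfolded rp_def]
    have af: "a f = dv f G H" and ag: "a g = dv g G' H'" using a_eq f g r by blast+
    show "a (\<lambda>x\<in>level_set k l. f x + g x) = a f + a g"
      using reg M unfolding a_eq[OF lev.add_mem[OF f g] rp_add[OF r]] af ag
      by (simp add: dv_def J.der_add J.der_mult val repA.reg_mult GL[OF r(1)] GL[OF r(2)] field_simps)
    show "a (\<lambda>x\<in>level_set k l. f x * g x) = f M * a g + g M * a f"
      using reg M unfolding a_eq[OF lev.mult_mem[OF f g] rp_mult[OF r]] af ag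
      by (simp add: dv_def J.der_mult val repA.reg_mult GL[OF r(1)] GL[OF r(2)] field_simps)
    have "rp (\<lambda>x\<in>level_set k l. z * f x) (\<lambda>\<rho>. z * G \<rho>) H"
      using r(1) N(1) by (auto simp: rp_def algebra_simps intro!: repA.reg_mult repA.reg_const)
    from a_eq[OF lev.cmult_mem[OF f] this] show "a (\<lambda>x\<in>level_set k l. z * f x) = z * a f"
      using reg M unfolding af by (simp add: dv_def J.der_cmult algebra_simps diff_divide_distrib)
  qed
  have ops: "f \<oplus>\<^bsub>level_alg k l\<^esub> g = (\<lambda>x\<in>level_set k l. f x + g x)"
    "f \<otimes>\<^bsub>level_alg k l\<^esub> g = (\<lambda>x\<in>level_set k l. f x * g x)"
    "z \<odot>\<^bsub>level_alg k l\<^esub> f = (\<lambda>x\<in>level_set k l. z * f x)" for f g z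
    by (simp_all add: level_alg_eq fun_alg_def)
  have "a \<in> extensional (level_funs k l)" by (simp add: a_def)
  then have "a \<in> tangent (level_alg k l) (eval_at (level_alg k l) M)"
    by (auto simp: tangent_def carrier_level_alg ops hom evM PiE_def)
  moreover have "push (moduli_A k l) (level_comorphism k l) a = D"
  proof
    fix f
    show "push (moduli_A k l) (level_comorphism k l) a f = D f"
    proof (cases "f \<in> inv_funs (rels_A l) (reps_A k l)")
      case True
      have rf: "restrict f (reps_A k l) = f" using inv_funs_extensional[OF True] by (rule extensional_restrict)
      have regf: "repA.reg k l f" using True by (simp add: repA.reg_def rf)
      let ?F = "\<lambda>M\<in>level_set k l. f (level_rep l M)"
      have F: "?F \<in> level_funs k l" by (rule level_comorphism_mem[OF True])
      have "f \<rho> = f (level_rep l (N \<rho>))" if "\<rho> \<in> reps_A k l" "HA l \<rho> \<noteq> 0" for \<rho>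
        using N(2)[OF that] inv_funs_conj[OF True _ that(1)] by metis
      \<comment> \<open>An invariant is unchanged along the section, so its pull-back has the
        fraction with numerator \<open>f\<close> and denominator 1; the derivative of this fraction
        is that of \<open>f\<close>.\<close>
      then have "rp ?F f (\<lambda>\<rho>. 1)"
        using N(1) regf by (auto simp: rp_def repA.reg_const)
      then have "a ?F = J.der f" using a_eq[OF F] by (simp add: dv_def J.der_const)
      then show ?thesis
        using True by (simp add: push_def compose_def level_comorphism_def moduli_A_eq fun_alg_def J.der_def rf)
    next
      case False
      then show ?thesis using D
        by (auto simp: push_def compose_def moduli_A_eq fun_alg_def tangent_def)
    qed
  qed
  ultimately show ?thesis by blast
qed

text \<open>A lift is determined by its push-forward up to a torus direction. Differentiating
  \<open>gnum_munit\<close> along the level set expresses each entry through derivatives of the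
  invariants and of the weights; the weights enter only through their logarithmic derivatives
  \<open>c\<close>.\<close>

lemma lift_formula:
  fixes M :: "complex^'n^'n"
  assumes M: "M \<in> level_set k l" and h: "gden munit M \<noteq> 0"
    and a: "a \<in> tangent (level_alg k l) (eval_at (level_alg k l) M)"
  defines "\<delta> \<equiv> \<lambda>f. push (moduli_A k l) (level_comorphism k l) a (restrict f (reps_A k l))"
  shows "\<exists>c. \<forall>i j. tangent_matrix k l a $ i $ j =
    (\<delta> (GA l i j) - gnum munit M M i j / gden munit M * \<delta> (HA l)) / gden munit M * wt M j / wt M i
      + (c i - c j) * M $ i $ j"
proof -
  interpret J: jet "level_set k l" "level_funs k l" "eval_at (level_alg k l) M" a
    by unfold_locales (use a lev.eval_at_points[OF M] in \<open>simp_all add: level_alg_eq\<close>)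
  have val: "J.val f = f M" if "lev.reg k l f" for f
    using lev.eval_at_restrict[OF M that] unfolding J.val_def unfolding level_alg_eq .
  have reg: "lev.reg k l (\<lambda>M. f (level_rep l M))" and \<delta>: "\<delta> f = J.der (\<lambda>M. f (level_rep l M))"
    if "repA.reg k l f" for f
  proof -
    let ?f = "restrict f (reps_A k l)"
    have f: "?f \<in> inv_funs (rels_A l) (reps_A k l)" using that by (simp add: repA.reg_def)
    have eq: "(\<lambda>M\<in>level_set k l. ?f (level_rep l M)) = (\<lambda>M\<in>level_set k l. f (level_rep l M))"
      by (rule restrict_ext) (simp add: level_rep(1))
    show "lev.reg k l (\<lambda>M. f (level_rep l M))"
      using level_comorphism_mem[OF f] unfolding eq lev.reg_def .
    show "\<delta> f = J.der (\<lambda>M. f (level_rep l M))"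
      using f eq by (simp add: \<delta>_def push_def compose_def level_comorphism_def moduli_A_eq fun_alg_def J.der_def)
  qed
  have reg_wt: "lev.reg k l (\<lambda>M. wt M i)" for i
    unfolding wt_def by (rule reg_level_word)
  define c where "c i = - (J.der (\<lambda>M. wt M i) / wt M i)" for i
  have "tangent_matrix k l a $ i $ j =
    (\<delta> (GA l i j) - gnum munit M M i j / gden munit M * \<delta> (HA l)) / gden munit M * wt M j / wt M i
      + (c i - c j) * M $ i $ j" for i j
  proof -
    define A g' h' where "A = tangent_matrix k l a $ i $ j" and "g' = \<delta> (GA l i j)" and "h' = \<delta> (HA l)"
    define wi wj wi' wj' where "wi = wt M i" and "wj = wt M j"
      and "wi' = J.der (\<lambda>M. wt M i)" and "wj' = J.der (\<lambda>M. wt M j)"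
    define g0 h0 m where "g0 = gnum munit M M i j" and "h0 = gden munit M" and "m = M $ i $ j"
    have A: "A = J.der (\<lambda>M. M $ i $ j)" by (simp add: A_def tangent_matrix_def J.der_def)
    have nz: "wi \<noteq> 0" "wj \<noteq> 0" "h0 \<noteq> 0" using wt_nonzero[OF h] h by (simp_all add: wi_def wj_def h0_def)
    have g0: "g0 * wj = wi * m * h0" unfolding g0_def wj_def wi_def m_def h0_def by (rule gnum_munit)
    have "J.der (\<lambda>M. GA l i j (level_rep l M) * wt M j)
        = J.der (\<lambda>M. wt M i * M $ i $ j * HA l (level_rep l M))"
      by (rule J.der_cong) (simp add: level_GA level_HA gnum_munit)
    then have "g0 * wj' + wj * g' = wi * m * h' + h0 * (wi * A + m * wi')"
      by (simp add: J.der_mult val reg reg_wt reg_level_coord reg_GA reg_HA lev.reg_mult \<delta> A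
          level_GA[OF M] level_HA[OF M] g0_def h0_def wi_def wj_def wi'_def wj'_def m_def g'_def h'_def)
    then have "A = (g0 * wj' + wj * g' - wi * m * h' - h0 * m * wi') / (h0 * wi)"
      \<comment> \<open>The differentiated identity is linear in \<open>A\<close> with the
        invertible coefficient \<open>h0 * wi\<close>.\<close>
      using nz by (simp add: field_simps)
    also have "\<dots> = (g' - g0 / h0 * h') / h0 * wj / wi + (wj' / wj - wi' / wi) * m"
    proof -
      have "g0 = wi * m * h0 / wj" using g0 nz by (simp add: field_simps)
      then show ?thesis using nz by (simp only:) (simp add: field_simps)
    qed
    finally have "A = (g' - g0 / h0 * h') / h0 * wj / wi + (wj' / wj - wi' / wi) * m" .
    then show ?thesis
      by (simp add: A_def g'_def g0_def h0_def h'_def wj_def wi_def m_def c_def wi'_def wj'_def)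
  qed
  then show ?thesis by blast
qed

text \<open>The relations for the ratios of \<open>GB\<close> by \<open>HB\<close>, cleared of
  denominators, are identities between invariants where \<open>HB\<close> is nonzero.
  \<open>J.localize\<close> gives their values and derivatives at the point \<open>x\<close>, and
  dividing by powers of \<open>H\<close> yields the relations and their linearization.\<close>

lemma frame_jet:
  fixes lam :: "'k::finite \<Rightarrow> 'n \<Rightarrow> complex"
  assumes nz: "\<And>i j. lam i j \<noteq> 0"
    and jet: "jet (reps_B lam) (inv_funs (rels_B lam) (reps_B lam)) x D"
  defines "v \<equiv> \<lambda>f. x (restrict f (reps_B lam))" and "d \<equiv> \<lambda>f. D (restrict f (reps_B lam))"
  assumes h: "v (HB lam) \<noteq> 0"
  defines "Q \<equiv> \<lambda>s. \<chi> a b. v (GB lam s a b) / v (HB lam)"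
  defines "U \<equiv> \<lambda>s. \<chi> a b. (d (GB lam s a b) - v (GB lam s a b) / v (HB lam) * d (HB lam)) / v (HB lam)"
  shows "Q s ** Q t = (if s = t then Q s else 0)"
    and "U s ** Q t + Q s ** U t = (if s = t then U s else 0)"
    and "Q s $ a $ b \<noteq> 0"
    and "Q s $ a $ j * Q s $ j $ b = Q s $ j $ j * Q s $ a $ b"
    and "U s $ a $ j * Q s $ j $ b + Q s $ a $ j * U s $ j $ b = Q s $ j $ j * U s $ a $ b"
    and "U s $ a $ a = 0"
proof -
  interpret J: jet "reps_B lam" "inv_funs (rels_B lam) (reps_B lam)" x D by (rule jet)
  have v: "v = J.val" and d: "d = J.der" by (simp_all add: v_def d_def J.val_def[abs_def] J.der_def[abs_def])
  note loc = J.localize[OF reg_HB h[unfolded v]] and reg = reg_GB reg_HB repB.reg_mult repB.reg_sum repB.reg_const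
  define G G' H H' where "G s a b = v (GB lam s a b)" and "G' s a b = d (GB lam s a b)"
    and "H = v (HB lam)" and "H' = d (HB lam)" for s a b
  have Q: "Q s $ a $ b = G s a b / H" and U: "U s $ a $ b = (G' s a b - G s a b / H * H') / H" for s a b
    by (simp_all add: Q_def U_def G_def G'_def H_def H'_def)
  have H: "H \<noteq> 0" using h by (simp add: H_def)
  let ?e = "\<lambda>s t. if s = t then 1 else 0 :: complex"
  \<comment> \<open>Orthogonality and idempotency of the \<open>p s\<close>, as values and as first
    derivatives.\<close>
  have prod: "(\<Sum>j\<in>UNIV. G s a j * G t j b) = ?e s t * (H * G s a b)"
    "(\<Sum>j\<in>UNIV. G s a j * G' t j b + G t j b * G' s a j) = ?e s t * (H * G' s a b + G s a b * H')" for s t a b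
  proof -
    have id: "(\<Sum>j\<in>UNIV. GB lam s a j \<rho> * GB lam t j b \<rho>) = ?e s t * (HB lam \<rho> * GB lam s a b \<rho>)"
      if \<rho>: "\<rho> \<in> reps_B lam" "HB lam \<rho> \<noteq> 0" for \<rho>
    proof -
      obtain N where N: "rel_B lam munit N" "\<And>s a b. GB lam s a b \<rho> = N s $ a $ b * HB lam \<rho>"
        using GB_normal_form[OF \<rho>] by blast
      have "(\<Sum>j\<in>UNIV. GB lam s a j \<rho> * GB lam t j b \<rho>) = (N s ** N t) $ a $ b * HB lam \<rho> * HB lam \<rho>"
        by (simp add: N(2) matrix_matrix_mult_def sum_distrib_left sum_distrib_right algebra_simps)
      then show ?thesis using N by (auto simp: rel_B_def)
    qed
    have "J.val (\<lambda>\<rho>. \<Sum>j\<in>UNIV. GB lam s a j \<rho> * GB lam t j b \<rho>) = J.val (\<lambda>\<rho>. ?e s t * (HB lam \<rho> * GB lam s a b \<rho>))"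
      "J.der (\<lambda>\<rho>. \<Sum>j\<in>UNIV. GB lam s a j \<rho> * GB lam t j b \<rho>) = J.der (\<lambda>\<rho>. ?e s t * (HB lam \<rho> * GB lam s a b \<rho>))"
      by (rule loc; use id in \<open>simp add: reg\<close>)+
    then show "(\<Sum>j\<in>UNIV. G s a j * G t j b) = ?e s t * (H * G s a b)"
      "(\<Sum>j\<in>UNIV. G s a j * G' t j b + G t j b * G' s a j) = ?e s t * (H * G' s a b + G s a b * H')"
      by (simp_all add: J.val_sum J.der_sum J.val_mult J.der_mult J.val_const J.der_const reg G_def G'_def H_def H'_def v d
          del: mult_cancel_left mult_cancel_right)
  qed
  \<comment> \<open>From the relation for \<open>q j\<close>, \<open>p s\<close>,
    \<open>q j\<close>: diagonal entries are the constants \<open>lam s j\<close>, which later makes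
    the diagonal of \<open>U\<close> vanish.\<close>
  have diag: "G s j j = lam s j * H" "G' s j j = lam s j * H'" for s j
  proof -
    have id: "GB lam s j j \<rho> = lam s j * HB lam \<rho>" if \<rho>: "\<rho> \<in> reps_B lam" "HB lam \<rho> \<noteq> 0" for \<rho>
    proof -
      obtain N where N: "rel_B lam munit N" "\<And>s a b. GB lam s a b \<rho> = N s $ a $ b * HB lam \<rho>"
        using GB_normal_form[OF \<rho>] by blast
      have "(munit j ** N s ** munit j) $ j $ j = smat (lam s j) (munit j) $ j $ j"
        using N(1) by (simp add: rel_B_def)
      then show ?thesis by (simp add: N(2) munit_mult_nth mult_munit_nth) (simp add: munit_def)
    qed
    have "J.val (GB lam s j j) = J.val (\<lambda>\<rho>. lam s j * HB lam \<rho>)"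
      "J.der (GB lam s j j) = J.der (\<lambda>\<rho>. lam s j * HB lam \<rho>)"
      by (rule loc; use id in \<open>simp add: reg\<close>)+
    then show "G s j j = lam s j * H" "G' s j j = lam s j * H'"
      by (simp_all add: J.val_cmult J.der_cmult reg G_def G'_def H_def H'_def v d)
  qed
  \<comment> \<open>From the relation for \<open>p s\<close>, \<open>q j\<close>,
    \<open>p s\<close>, where the matrix unit in the middle turns the matrix product into a product
    of two entries.\<close>
  have coc: "G s a j * G s j b = lam s j * (H * G s a b)"
    "G s a j * G' s j b + G s j b * G' s a j = lam s j * (H * G' s a b + G s a b * H')" for s a j b
  proof -
    have id: "GB lam s a j \<rho> * GB lam s j b \<rho> = lam s j * (HB lam \<rho> * GB lam s a b \<rho>)"
      if \<rho>: "\<rho> \<in> reps_B lam" "HB lam \<rho> \<noteq> 0" for \<rho>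
    proof -
      obtain N where N: "rel_B lam munit N" "\<And>s a b. GB lam s a b \<rho> = N s $ a $ b * HB lam \<rho>"
        using GB_normal_form[OF \<rho>] by blast
      have "(N s ** munit j ** N s) $ a $ b = smat (lam s j) (N s) $ a $ b"
        using N(1) by (simp add: rel_B_def)
      then have "N s $ a $ j * N s $ j $ b = lam s j * N s $ a $ b" by (simp add: munit_middle)
      then show ?thesis by (simp add: N(2) algebra_simps)
    qed
    have "J.val (\<lambda>\<rho>. GB lam s a j \<rho> * GB lam s j b \<rho>) = J.val (\<lambda>\<rho>. lam s j * (HB lam \<rho> * GB lam s a b \<rho>))"
      "J.der (\<lambda>\<rho>. GB lam s a j \<rho> * GB lam s j b \<rho>) = J.der (\<lambda>\<rho>. lam s j * (HB lam \<rho> * GB lam s a b \<rho>))"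
      by (rule loc; use id in \<open>simp add: reg\<close>)+
    then show "G s a j * G s j b = lam s j * (H * G s a b)"
      "G s a j * G' s j b + G s j b * G' s a j = lam s j * (H * G' s a b + G s a b * H')"
      by (simp_all add: J.val_mult J.der_mult J.val_const J.der_const reg G_def G'_def H_def H'_def v d)
  qed
  have QQ: "(Q s ** Q t) $ a $ b = ?e s t * Q s $ a $ b" for s t a b
  proof -
    have "(Q s ** Q t) $ a $ b = (\<Sum>j\<in>UNIV. G s a j * G t j b) / (H * H)"
      by (simp add: matrix_matrix_mult_def Q sum_divide_distrib)
    then show ?thesis using H by (simp add: prod Q)
  qed
  then show "Q s ** Q t = (if s = t then Q s else 0)" for s t by (simp add: vec_eq_iff)
  \<comment> \<open>The second term collects the derivatives of the two denominators in a product of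
    two ratios.\<close>
  have UQ: "(U s ** Q t + Q s ** U t) $ a $ b = ?e s t * U s $ a $ b" for s t a b
  proof -
    have "(U s ** Q t + Q s ** U t) $ a $ b
        = (\<Sum>j\<in>UNIV. G s a j * G' t j b + G t j b * G' s a j) / (H * H)
          - 2 * H' * (\<Sum>j\<in>UNIV. G s a j * G t j b) / (H * H * H)"
      using H by (simp add: matrix_matrix_mult_def Q U sum_divide_distrib sum_distrib_left
          flip: sum.distrib sum_subtractf) (rule sum.cong, simp_all add: field_simps)
    also have "\<dots> = ?e s t * U s $ a $ b"
      using H unfolding prod by (simp add: U field_simps)
    finally show ?thesis .
  qed
  then show "U s ** Q t + Q s ** U t = (if s = t then U s else 0)" for s t by (simp add: vec_eq_iff)
  show QQj: "Q s $ a $ j * Q s $ j $ b = Q s $ j $ j * Q s $ a $ b" for s a j b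
    using coc(1)[of s a j b] H by (simp add: Q diag)
  have Qjj: "Q s $ j $ j = lam s j" for s j using H by (simp add: Q diag)
  show "Q s $ a $ b \<noteq> 0" for s a b
  proof
    assume "Q s $ a $ b = 0"
    \<comment> \<open>The entries at \<open>a\<close>, \<open>b\<close> and at \<open>b\<close>,
      \<open>a\<close> multiply to the product of the two diagonal entries.\<close>
    then have "lam s b * lam s a = 0" using QQj[of s a b a] by (simp add: Qjj)
    then show False using nz by simp
  qed
  show "U s $ a $ a = 0" for s a using H by (simp add: U diag)
  show "U s $ a $ j * Q s $ j $ b + Q s $ a $ j * U s $ j $ b = Q s $ j $ j * U s $ a $ b" for s a j b
  proof -
    have "U s $ a $ j * Q s $ j $ b + Q s $ a $ j * U s $ j $ b
      = (G s a j * G' s j b + G s j b * G' s a j) / (H * H) - 2 * H' * (G s a j * G s j b) / (H * H * H)"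
      using H by (simp add: Q U field_simps)
    also have "\<dots> = Q s $ j $ j * U s $ a $ b"
      using H unfolding coc Qjj by (simp add: U field_simps)
    finally show ?thesis .
  qed
qed

end

section \<open>Vanishing of the pulled-back form\<close>

lemma push_Psi:
  fixes lam :: "'k::finite \<Rightarrow> 'n::finite \<Rightarrow> complex"
  assumes "f \<in> inv_funs (rels_A l) (reps_A CARD('k) l)"
  shows "push (moduli_A CARD('k) l) (Psi_comorphism lam l) z f = z (\<lambda>\<rho>\<in>reps_B lam. f (restr lam l \<rho>))"
  using assms by (simp add: push_def compose_def Psi_comorphism_def moduli_A_eq fun_alg_def restr_def)

lemma push_Psi_restrict:
  fixes lam :: "'k::finite \<Rightarrow> 'n::finite \<Rightarrow> complex"
  assumes l: "\<And>j. l j = (\<Sum>i\<in>UNIV. lam i j)" and f: "repA.reg CARD('k) l f"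
  shows "push (moduli_A CARD('k) l) (Psi_comorphism lam l) z (restrict f (reps_A CARD('k) l))
    = z (\<lambda>\<rho>\<in>reps_B lam. f (restr lam l \<rho>))"
proof -
  have "(\<lambda>\<rho>\<in>reps_B lam. restrict f (reps_A CARD('k) l) (restr lam l \<rho>)) = (\<lambda>\<rho>\<in>reps_B lam. f (restr lam l \<rho>))"
    by (rule restrict_ext) (simp add: restrict_rep(1)[OF l] restr_def)
  then show ?thesis using push_Psi[of "restrict f (reps_A CARD('k) l)" l lam z] f by (simp add: repA.reg_def)
qed

lemma push_Psi_tangent:
  fixes lam :: "'k::finite \<Rightarrow> 'n::finite \<Rightarrow> complex"
  assumes l: "\<And>j. l j = (\<Sum>i\<in>UNIV. lam i j)" and u: "u \<in> tangent (moduli_B lam) x"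
  shows "push (moduli_A CARD('k) l) (Psi_comorphism lam l) u
    \<in> tangent (moduli_A CARD('k) l) (push (moduli_A CARD('k) l) (Psi_comorphism lam l) x)"
proof -
  let ?FA = "inv_funs (rels_A l) (reps_A CARD('k) l)" and ?FB = "inv_funs (rels_B lam) (reps_B lam)"
  define Psi where "Psi f = (\<lambda>\<rho>\<in>reps_B lam. f (restr lam l \<rho>))"
    for f :: "('n gen_A ncpoly set \<Rightarrow> complex^'n^'n) \<Rightarrow> complex"
  have mem: "Psi f \<in> ?FB" if "f \<in> ?FA" for f unfolding Psi_def by (rule Psi_mem[OF l that])
  have push: "push (moduli_A CARD('k) l) (Psi_comorphism lam l) z f = z (Psi f)" if "f \<in> ?FA" for z f
    unfolding Psi_def by (rule push_Psi[OF that])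
  have Psi: "Psi (\<lambda>\<rho>\<in>reps_A CARD('k) l. f \<rho> + g \<rho>) = (\<lambda>\<rho>\<in>reps_B lam. Psi f \<rho> + Psi g \<rho>)"
    "Psi (\<lambda>\<rho>\<in>reps_A CARD('k) l. f \<rho> * g \<rho>) = (\<lambda>\<rho>\<in>reps_B lam. Psi f \<rho> * Psi g \<rho>)"
    "Psi (\<lambda>\<rho>\<in>reps_A CARD('k) l. c * f \<rho>) = (\<lambda>\<rho>\<in>reps_B lam. c * Psi f \<rho>)" for f g c
    unfolding Psi_def by (rule restrict_ext, simp add: restrict_rep(1)[OF l] restr_def)+
  have u_hom: "u (\<lambda>\<rho>\<in>reps_B lam. f \<rho> + g \<rho>) = u f + u g"
    "u (\<lambda>\<rho>\<in>reps_B lam. f \<rho> * g \<rho>) = x f * u g + x g * u f"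
    "u (\<lambda>\<rho>\<in>reps_B lam. c * f \<rho>) = c * u f" if "f \<in> ?FB" "g \<in> ?FB" for f g c
    using u that by (auto simp: tangent_def moduli_B_eq fun_alg_def)
  have ops: "f \<oplus>\<^bsub>moduli_A k l\<^esub> g = (\<lambda>\<rho>\<in>reps_A k l. f \<rho> + g \<rho>)"
    "f \<otimes>\<^bsub>moduli_A k l\<^esub> g = (\<lambda>\<rho>\<in>reps_A k l. f \<rho> * g \<rho>)"
    "c \<odot>\<^bsub>moduli_A k l\<^esub> f = (\<lambda>\<rho>\<in>reps_A k l. c * f \<rho>)"
    "carrier (moduli_A k l) = inv_funs (rels_A l) (reps_A k l)" for f g c k
    by (simp_all add: moduli_A_eq fun_alg_def)
  have "push (moduli_A CARD('k) l) (Psi_comorphism lam l) u \<in> extensional ?FA"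
    by (simp add: push_def compose_def ops)
  moreover have "u (Psi (\<lambda>\<rho>\<in>reps_A CARD('k) l. f \<rho> + g \<rho>)) = u (Psi f) + u (Psi g)"
    "u (Psi (\<lambda>\<rho>\<in>reps_A CARD('k) l. f \<rho> * g \<rho>)) = x (Psi f) * u (Psi g) + x (Psi g) * u (Psi f)"
    "u (Psi (\<lambda>\<rho>\<in>reps_A CARD('k) l. c * f \<rho>)) = c * u (Psi f)"
    if "f \<in> ?FA" "g \<in> ?FA" for f g c
    unfolding Psi(1) Psi(2)[of f g] Psi(3) by (rule u_hom[OF mem[OF that(1)] mem[OF that(2)]])+
  ultimately show ?thesis
    unfolding tangent_def ops
    by (auto simp: push repA.add_mem repA.mult_mem repA.cmult_mem PiE_def)
qed

text \<open>Both lifts are brought to the form required by \<open>kks_gauge\<close>: a conjugate of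
  the sum of the deformations supplied by \<open>frame_jet\<close>, plus a torus direction. The
  trace that remains is the one in \<open>trace_frame_potentials\<close>.\<close>

lemma (in gauge) kks_lift:
  fixes lam :: "'k::finite \<Rightarrow> 'n \<Rightarrow> complex"
  assumes nz: "\<And>i j. lam i j \<noteq> 0" and l: "\<And>j. l j = (\<Sum>i\<in>UNIV. lam i j)"
    and x: "x \<in> points (moduli_B lam)" and u: "u \<in> tangent (moduli_B lam) x" and v: "v \<in> tangent (moduli_B lam) x"
    and M: "M \<in> level_set CARD('k) l" and h: "gden munit M \<noteq> 0"
    and y: "push (moduli_A CARD('k) l) (Psi_comorphism lam l) x = eval_at (moduli_A CARD('k) l) (level_rep l M)"
    and a: "a \<in> tangent (level_alg CARD('k) l) (eval_at (level_alg CARD('k) l) M)"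
    and b: "b \<in> tangent (level_alg CARD('k) l) (eval_at (level_alg CARD('k) l) M)"
    and au: "push (moduli_A CARD('k) l) (level_comorphism CARD('k) l) a
      = push (moduli_A CARD('k) l) (Psi_comorphism lam l) u"
    and bv: "push (moduli_A CARD('k) l) (level_comorphism CARD('k) l) b
      = push (moduli_A CARD('k) l) (Psi_comorphism lam l) v"
  shows "kks M (tangent_matrix CARD('k) l a) (tangent_matrix CARD('k) l b) = 0"
proof -
  let ?r = "\<lambda>f. restrict f (reps_B lam)"
  define H where "H = x (?r (HB lam))"
  define Q where "Q s = (\<chi> a b. x (?r (GB lam s a b)) / H)" for s
  define T where "T D s = (\<chi> a b. (D (?r (GB lam s a b)) - x (?r (GB lam s a b)) / H * D (?r (HB lam))) / H)" for D s
  have jet: "jet (reps_B lam) (inv_funs (rels_B lam) (reps_B lam)) x D" if "D \<in> tangent (moduli_B lam) x" for D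
    by (intro jet.intro jet_axioms.intro repB.fun_subalgebra_axioms) (use x that in \<open>simp_all add: moduli_B_eq\<close>)
  \<comment> \<open>The pull-back of \<open>GA\<close> is a sum of functions \<open>GB\<close>, and
    both characters and derivations are additive.\<close>
  have pushGA: "push (moduli_A CARD('k) l) (Psi_comorphism lam l) D (restrict (GA l i j) (reps_A CARD('k) l))
      = (\<Sum>s\<in>UNIV. D (?r (GB lam s i j)))"
    and pushHA: "push (moduli_A CARD('k) l) (Psi_comorphism lam l) D (restrict (HA l) (reps_A CARD('k) l)) = D (?r (HB lam))"
    if "D = x \<or> D \<in> tangent (moduli_B lam) x" for D i j
  proof -
    interpret J: jet "reps_B lam" "inv_funs (rels_B lam) (reps_B lam)" x u by (rule jet[OF u])
    have r: "?r (\<lambda>\<rho>. GA l i j (restr lam l \<rho>)) = ?r (\<lambda>\<rho>. \<Sum>s\<in>UNIV. GB lam s i j \<rho>)"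
      "?r (\<lambda>\<rho>. HA l (restr lam l \<rho>)) = ?r (HB lam)"
      by (auto intro!: restrict_ext simp: restr_GA_HA[OF l])
    have "D (?r (\<lambda>\<rho>. \<Sum>s\<in>UNIV. GB lam s i j \<rho>)) = (\<Sum>s\<in>UNIV. D (?r (GB lam s i j)))"
      using that
    proof
      assume "D = x"
      then show ?thesis using J.val_sum[of UNIV "\<lambda>s. GB lam s i j"] by (simp add: J.val_def reg_GB)
    next
      assume "D \<in> tangent (moduli_B lam) x"
      then interpret K: jet "reps_B lam" "inv_funs (rels_B lam) (reps_B lam)" x D by (rule jet)
      show ?thesis using K.der_sum[of UNIV "\<lambda>s. GB lam s i j"] by (simp add: K.der_def reg_GB)
    qed
    then show "push (moduli_A CARD('k) l) (Psi_comorphism lam l) D (restrict (GA l i j) (reps_A CARD('k) l))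
      = (\<Sum>s\<in>UNIV. D (?r (GB lam s i j)))"
      by (simp only: push_Psi_restrict[OF l reg_GA] r)
    show "push (moduli_A CARD('k) l) (Psi_comorphism lam l) D (restrict (HA l) (reps_A CARD('k) l)) = D (?r (HB lam))"
      by (simp only: push_Psi_restrict[OF l reg_HA] r)
  qed
  have ev: "eval_at (moduli_A CARD('k) l) (level_rep l M) (restrict f (reps_A CARD('k) l)) = f (level_rep l M)"
    if "repA.reg CARD('k) l f" for f
    using repA.eval_at_restrict[OF level_rep(1)[OF M] that] by (simp add: moduli_A_eq)
  have Hh: "H = gden munit M"
    using ev[OF reg_HA] pushHA[of x] by (simp add: y level_HA[OF M] H_def)
  have H0: "H \<noteq> 0" using h by (simp add: Hh)
  have gN: "gnum munit M M i j = (\<Sum>s\<in>UNIV. Q s) $ i $ j * H" for i j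
    using ev[OF reg_GA[of _ _ i j]] pushGA[of x i j] H0
    by (simp add: y level_GA[OF M] Q_def sum_divide_distrib[symmetric])
  note fU = frame_jet[OF nz jet[OF u], folded H_def, OF H0, folded Q_def T_def]
    and fV = frame_jet[OF nz jet[OF v], folded H_def, OF H0, folded Q_def T_def]
  define N where "N = (\<Sum>s\<in>UNIV. Q s)"
  \<comment> \<open>Inverse weights undo the gauge and lead from \<open>N\<close> back to
    \<open>M\<close>.\<close>
  define w where "w i = inverse (wt M i)" for i
  have wt: "wt M i \<noteq> 0" for i by (rule wt_nonzero[OF h])
  have w: "w i \<noteq> 0" for i using wt by (simp add: w_def)
  have lift: "\<exists>c. tangent_matrix CARD('k) l a = dmat w ** (\<Sum>s\<in>UNIV. T D s) ** matrix_inv (dmat w)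
      + (dmat c ** M - M ** dmat c)"
    if D: "D \<in> tangent (moduli_B lam) x" and a: "a \<in> tangent (level_alg CARD('k) l) (eval_at (level_alg CARD('k) l) M)"
      and eq: "push (moduli_A CARD('k) l) (level_comorphism CARD('k) l) a
        = push (moduli_A CARD('k) l) (Psi_comorphism lam l) D" for D a
  proof -
    obtain c where c: "tangent_matrix CARD('k) l a $ i $ j =
      ((\<Sum>s\<in>UNIV. D (?r (GB lam s i j))) - gnum munit M M i j / H * D (?r (HB lam))) / H * wt M j / wt M i
      + (c i - c j) * M $ i $ j" for i j
      using lift_formula[OF M h a] D unfolding eq Hh[symmetric] by (auto simp: pushGA pushHA)
    have "((\<Sum>s\<in>UNIV. D (?r (GB lam s i j))) - gnum munit M M i j / H * D (?r (HB lam))) / H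
        = (\<Sum>s\<in>UNIV. T D s) $ i $ j" for i j
      using H0 by (simp add: gN T_def Q_def sum_subtractf sum_distrib_right sum_divide_distrib diff_divide_distrib)
    then have "tangent_matrix CARD('k) l a = dmat w ** (\<Sum>s\<in>UNIV. T D s) ** matrix_inv (dmat w)
      + (dmat c ** M - M ** dmat c)"
      using wt unfolding vec_eq_iff c by (simp add: dmat_conj_nth[OF w] dmat_mult_nth mult_dmat_nth w_def field_simps)
    then show ?thesis by blast
  qed
  obtain c d where c: "tangent_matrix CARD('k) l a = dmat w ** (\<Sum>s\<in>UNIV. T u s) ** matrix_inv (dmat w)
      + (dmat c ** M - M ** dmat c)"
    and d: "tangent_matrix CARD('k) l b = dmat w ** (\<Sum>s\<in>UNIV. T v s) ** matrix_inv (dmat w)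
      + (dmat d ** M - M ** dmat d)"
    using lift[OF u a au] lift[OF v b bv] by blast
  have MN: "M = dmat w ** N ** matrix_inv (dmat w)"
  proof -
    have "M $ i $ j = w i * N $ i $ j / w j" for i j
      using gnum_munit[of M M i j] wt[of i] wt[of j] H0 by (simp add: gN N_def w_def field_simps flip: Hh)
    then show ?thesis unfolding vec_eq_iff dmat_conj_nth[OF w] by blast
  qed
  \<comment> \<open>One potential generates the deformation of every \<open>Q s\<close>, hence also
    that of their sum \<open>N\<close>.\<close>
  have pot: "(\<Sum>s\<in>UNIV. U s) = frame_potential Q U ** N - N ** frame_potential Q U"
    if "\<And>s t. U s ** Q t + Q s ** U t = (if s = t then U s else 0)" for U
  proof -
    have "(\<Sum>s\<in>UNIV. U s) = (\<Sum>s\<in>UNIV. frame_potential Q U ** Q s - Q s ** frame_potential Q U)"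
      by (simp only: commutator_frame_potential[OF fU(1) that])
    then show ?thesis by (simp add: N_def mat_sum_left mat_sum_right sum_subtractf)
  qed
  show ?thesis
  proof (rule kks_gauge[OF w MN pot[OF fU(2)] pot[OF fV(2)] _ _ _ c d])
    show "(\<Sum>s\<in>UNIV. T u s) $ i $ i = 0" "(\<Sum>s\<in>UNIV. T v s) $ i $ i = 0" for i
      by (simp_all add: fU(6) fV(6))
    show "trace (N ** (frame_potential Q (T u) ** frame_potential Q (T v)
        - frame_potential Q (T v) ** frame_potential Q (T u))) = 0"
      unfolding N_def by (rule trace_frame_potentials[OF fU(1,2) fV(2) fU(3,5,4) fV(6)])
  qed
qed

theorem theorem5:
  fixes lam :: "'k::finite \<Rightarrow> 'n::finite \<Rightarrow> complex"
    and l :: "'n \<Rightarrow> complex"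
  assumes "CARD('k) \<le> CARD('n)"
    and "\<And>i j. lam i j \<noteq> 0"
    and "\<And>i. (\<Sum>j\<in>UNIV. lam i j) = 1"
    and "CARD('k) = CARD('n) \<Longrightarrow> (\<forall>j. (\<Sum>i\<in>UNIV. lam i j) = 1)"
    and "\<And>j. l j = (\<Sum>i\<in>UNIV. lam i j)"
    and "\<And>j. l j \<noteq> 0"
  shows "\<forall>x\<in>points (moduli_B lam).
    push (moduli_A CARD('k) l) (Psi_comorphism lam l) x \<in> moduli_A_open CARD('k) l \<longrightarrow>
    (\<forall>u\<in>tangent (moduli_B lam) x. \<forall>v\<in>tangent (moduli_B lam) x.
      pullback_form (moduli_A CARD('k) l) (Psi_comorphism lam l) (omega_A CARD('k) l) x u v = 0)"
proof (intro ballI impI)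
  fix x u v
  assume x: "x \<in> points (moduli_B lam)"
    and op: "push (moduli_A CARD('k) l) (Psi_comorphism lam l) x \<in> moduli_A_open CARD('k) l"
    and u: "u \<in> tangent (moduli_B lam) x" and v: "v \<in> tangent (moduli_B lam) x"
  let ?k = "CARD('k)"
  let ?push = "push (moduli_A ?k l) (Psi_comorphism lam l)" and ?lev = "push (moduli_A ?k l) (level_comorphism ?k l)"
  obtain M where M: "M \<in> stable_set ?k l" and y: "?push x = eval_at (moduli_A ?k l) (level_rep l M)"
    using op by (auto simp: moduli_A_open_def)
  have level: "M \<in> level_set ?k l" if "M \<in> stable_set ?k l" for M using that by (simp add: stable_set_def)
  \<comment> \<open>Any base index will do; \<open>undefined\<close> stands for an arbitrary
    one.\<close>
  obtain W V where h: "gauge.gden undefined W V munit M \<noteq> 0" by (rule stable_gauge[OF M])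
  interpret gauge undefined W V .
  have zero: "kks M' (tangent_matrix ?k l a) (tangent_matrix ?k l b) = 0"
    if M': "M' \<in> stable_set ?k l" "?push x = eval_at (moduli_A ?k l) (level_rep l M')"
      and ab: "a \<in> tangent (level_alg ?k l) (eval_at (level_alg ?k l) M')"
        "b \<in> tangent (level_alg ?k l) (eval_at (level_alg ?k l) M')" "?lev a = ?push u" "?lev b = ?push v" for M' a b
  proof (rule kks_lift[OF assms(2,5) x u v level[OF M'(1)] _ M'(2) ab])
    \<comment> \<open>The denominator is the value of an invariant at the image point. The words
      chosen for \<open>M\<close> therefore gauge-fix every stable matrix over that point.\<close>
    have "gden munit N = ?push x (restrict (HA l) (reps_A ?k l))"
      if "N \<in> stable_set ?k l" "?push x = eval_at (moduli_A ?k l) (level_rep l N)" for N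
      using repA.eval_at_restrict[OF level_rep(1)[OF level[OF that(1)]] reg_HA]
      unfolding that(2) by (simp add: moduli_A_eq level_HA[OF level[OF that(1)]])
    then show "gden munit M' \<noteq> 0" using h M y M' by metis
  qed
  \<comment> \<open>Without a lift every number would satisfy the condition in
    \<open>omega_A\<close> vacuously; existence of lifts makes the value 0 unique.\<close>
  have "\<exists>a \<in> tangent (level_alg ?k l) (eval_at (level_alg ?k l) M). ?lev a = ?push D"
    if "D \<in> tangent (moduli_B lam) x" for D
    using lift_exists[OF level[OF M] h] push_Psi_tangent[OF assms(5) that] by (simp add: y)
  then obtain a b where ab: "a \<in> tangent (level_alg ?k l) (eval_at (level_alg ?k l) M)"
    "b \<in> tangent (level_alg ?k l) (eval_at (level_alg ?k l) M)" "?lev a = ?push u" "?lev b = ?push v"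
    using u v by meson
  show "pullback_form (moduli_A ?k l) (Psi_comorphism lam l) (omega_A ?k l) x u v = 0"
    unfolding pullback_form_def omega_A_def
  proof (rule the_equality)
    fix c
    assume "\<forall>M\<in>stable_set ?k l. ?push x = eval_at (moduli_A ?k l) (level_rep l M) \<longrightarrow>
     (\<forall>a\<in>tangent (level_alg ?k l) (eval_at (level_alg ?k l) M).
      \<forall>b\<in>tangent (level_alg ?k l) (eval_at (level_alg ?k l) M).
        ?lev a = ?push u \<and> ?lev b = ?push v \<longrightarrow> c = kks M (tangent_matrix ?k l a) (tangent_matrix ?k l b))"
    then have "c = kks M (tangent_matrix ?k l a) (tangent_matrix ?k l b)" using M y ab by blast
    then show "c = 0" using zero[OF M y ab] by simp
  qed (use zero in auto)
qed

end
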